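(* Let $r,s\in\mathbb Z_+$, $a_1,\dots,a_r,b_1,\dots,b_s\in\mathfrak h^{\mathcal B}\cup\mathfrak h^{\mathcal F}$, $m_1,\dots,m_r,n_1,\dots,n_s\in\mathbb Z_+$. Then, as series of operators on $W$, $$\begin{aligned}&{\circ\atop\circ}a_1^{(m_1-1)}(x_1)\cdots a_r^{(m_r-1)}(x_r){\circ\atop\circ}\cdot{\circ\atop\circ}b_1^{(n_1-1)}(y_1)\cdots b_s^{(n_s-1)}(y_s){\circ\atop\circ}\\&=\sum_{\rho,\eta=0}^{\min(r,s)}\ \sum_{I^b\in A^{\mathcal B}_\eta,\,J^b\in B^{\mathcal B}_\eta}\operatorname{perm}\Bigl(\ell_{\mathcal B}(a_{i^b_\alpha},b_{j^b_\beta})F^{\mathcal B}_{m_{i^b_\alpha}n_{j^b_\beta}}(x_{i^b_\alpha},y_{j^b_\beta})\Bigr)_{\alpha,\beta=1}^{\eta}\\&\quad\cdot\sum_{I^f\in A^{\mathcal F}_\rho,\,J^f\in B^{\mathcal F}_\rho}(-1)^{r^{\mathcal F}(i^f_1)+\cdots+r^{\mathcal F}(i^f_\rho)+s^{\mathcal F}(j^f_1)+\cdots+s^{\mathcal F}(j^f_\rho)}(-1)^{r^{\mathcal F}\rho+\frac{\rho(\rho+1)}2}\\&\qquad\cdot\det\Bigl(\ell_{\mathcal F}(a_{i^f_\gamma},b_{j^f_\delta})G_{m_{i^f_\gamma}n_{j^f_\delta}}(x_{i^f_\gamma},y_{j^f_\delta})\Bigr)_{\gamma,\delta=1}^{\rho}\\&\qquad\cdot{\circ\atop\circ}a_1^{(m_1-1)}(x_1)\cdots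 a_r^{(m_r-1)}(x_r)b_1^{(n_1-1)}(y_1)\cdots b_s^{(n_s-1)}(y_s){\circ\atop\circ}_{O(I^b,I^f,J^b,J^f)},\end{aligned}$$ where negative powers of $x_i-y_j$ in $F^{\mathcal B}_{mn}(x_i,y_j)$ and $G_{mn}(x_i,y_j)$ are expanded in nonnegative powers of $y_j$.
   Context: **The space $W$.** $\mathbb Z_+=\{1,2,\dots\}$. Let $\mathfrak h$ be a finite-dimensional complex vector space with a nondegenerate symmetric bilinear form $(\cdot,\cdot)$; $\mathfrak h^{\mathcal B},\mathfrak h^{\mathcal F}$ are two copies of $\mathfrak h$, mutually orthogonal in $\mathfrak h^{\mathcal B}\oplus\mathfrak h^{\mathcal F}$; $|a|=0$ for $a\in\mathfrak h^{\mathcal B}$, $|a|=1$ for $a\in\mathfrak h^{\mathcal F}$. Let $\widehat{\mathfrak h}^{\mathcal B,\mathcal F}_{\mathbb Z}=(\mathfrak h^{\mathcal B}\oplus\mathfrak h^{\mathcal F})\otimes\mathbb C[t,t^{-1}]\oplus\mathbb C\mathbf k_{\mathcal B}\oplus\mathbb C\mathbf k_{\mathcal F}$, with $a\otimes t^n$ of parity $|a|$ and $\mathbf k_{\mathcal B},\mathbf k_{\mathcal F}$ even; $[u,v]=uv-(-1)^{|u||v|}vu$ in its tensor algebra. Let $N^{tw}$ be the quotient of the tensor algebra by the two-sided ideal generated by: $[\mathbf k_{\mathcal B},\mathbf k_{\mathcal F}]$; $[a\otimes t^m,\mathbf k_{\mathcal B}]$, $[a\otimes t^m,\mathbf k_{\mathcal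 F}]$ ($a\in\mathfrak h^{\mathcal B}\cup\mathfrak h^{\mathcal F}$, $m\in\mathbb Z$); $[a\otimes t^m,b\otimes t^0]$ ($a,b\in\mathfrak h^{\mathcal B}\cup\mathfrak h^{\mathcal F}$, $m\neq0$); $[a\otimes t^m,b\otimes t^n]$ ($a\in\mathfrak h^{\mathcal B},b\in\mathfrak h^{\mathcal F}$, $m,n$ nonzero of opposite signs); $[a\otimes t^m,b\otimes t^n]-m(a,b)\delta_{m+n,0}\mathbf k_{\mathcal B}$ ($a,b\in\mathfrak h^{\mathcal B}$, $m\in\mathbb Z_+,n\in-\mathbb Z_+$); $[a\otimes t^m,b\otimes t^n]-(a,b)\delta_{m+n,0}\mathbf k_{\mathcal F}$ ($a,b\in\mathfrak h^{\mathcal F}$, $m\in\mathbb Z_+,n\in-\mathbb Z_+$). Let $M$ be a module for the tensor algebra $T(\mathfrak h^{\mathcal B}\oplus\mathfrak h^{\mathcal F})$ with a lower-bounded $\mathbb C$-grading preserved by the action. Let $a\otimes t^0$ act on $M$ as $a$, $a\otimes t^n$ ($n>0$) as $0$, and $\mathbf k_{\mathcal B},\mathbf k_{\mathcal F}$ as scalars $\ell_{\mathcal B},\ell_{\mathcal F}\in\mathbb C$; let $W=N^{tw}\otimes_{N^{tw}_{\ge0}}M$, $N^{tw}_{\ge0}$ being the subalgebra generated by all $a\otimes t^n$ ($n\ge0$) and $\mathbf k_{\mathcal B},\mathbf k_{\mathcal F}$. Write $a(n)$ for the action of $a\otimes t^n$ on $W$. **Fields and normal ordering.** $a(x)=\sum_{n\in\mathbb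 Z}a(n)x^{-n-1+|a|/2}$, $a^{(m)}(x)=\frac1{m!}\frac{d^m}{dx^m}a(x)$. ${\circ\atop\circ}\cdots{\circ\atop\circ}$ of a product of modes is obtained by placing the negative modes first, then the positive modes, each group in its original relative order, followed by ${\circ\atop\circ}\cdots{\circ\atop\circ}$ of the zero modes in their original relative order, times the sign of the induced permutation of the fermionic factors; for zero modes it is defined recursively (empty product $=1$): ${\circ\atop\circ}a_1(0)\cdots a_r(0){\circ\atop\circ}=a_1(0){\circ\atop\circ}a_2(0)\cdots a_r(0){\circ\atop\circ}$ if $a_1\in\mathfrak h^{\mathcal B}$, and if $a_1\in\mathfrak h^{\mathcal F}$, $${\circ\atop\circ}a_1(0)\cdots a_r(0){\circ\atop\circ}=a_1(0){\circ\atop\circ}a_2(0)\cdots a_r(0){\circ\atop\circ}+\sum_{i\ge2,\,a_i\in\mathfrak h^{\mathcal F}}\frac{(-1)^{r^{\mathcal F}(i)-1}}2(a_1,a_i){\circ\atop\circ}a_2(0)\cdots\widehat{a_i(0)}\cdots a_r(0){\circ\atop\circ},$$ with $r^{\mathcal F}(i)=\#\{j\le i:a_j\in\mathfrak h^{\mathcal F}\}$. It is extended coefficientwise to products of series. **Functions.** $F^{\mathcal B}_{mn}(x,y)=\frac1{(m-1)!(n-1)!}\partial_x^{m-1}\partial_y^{n-1}(x-y)^{-2}$; $G(x,y)=\frac12x^{-1/2}y^{-1/2}(x+y)(x-y)^{-1}$, $G_{mn}(x,y)=\frac1{(m-1)!(n-1)!}\partial_x^{m-1}\partial_y^{n-1}G(x,y)$.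 **Index notation.** $A^{\mathcal B}=\{i:a_i\in\mathfrak h^{\mathcal B}\}$, $A^{\mathcal F}=\{i:a_i\in\mathfrak h^{\mathcal F}\}$, and $B^{\mathcal B},B^{\mathcal F}\subset\{1,\dots,s\}$ similarly for the $b_j$. $A^{\mathcal B}_\eta$ is the set of increasing $\eta$-tuples $I^b=(i^b_1<\cdots<i^b_\eta)$ in $A^{\mathcal B}$; $A^{\mathcal F}_\rho\ni I^f$, $B^{\mathcal B}_\eta\ni J^b$, $B^{\mathcal F}_\rho\ni J^f$ similarly (length $0$: only the empty tuple). $r^{\mathcal F}=\#A^{\mathcal F}$, $r^{\mathcal F}(i)=\#\{j\le i:j\in A^{\mathcal F}\}$, $s^{\mathcal F}(j)=\#\{k\le j:k\in B^{\mathcal F}\}$. The subscript $O(I^b,I^f,J^b,J^f)$ means that the factors $a_i$ with index in $I^b$ or $I^f$ and $b_j$ with index in $J^b$ or $J^f$ are omitted before normal ordering. Permanent and determinant of the empty matrix are $1$.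
   Formalization: In the recursion for normal ordering of zero modes, the term (a_1,a_i)/2 is replaced by ℓ_F(a_1,a_i)/2; as printed the identity fails for ℓ_F≠1 (r=s=1, a,b fermionic with (a,b)≠0, coefficient of x^{-1/2}y^{-1/2}). For ℓ_F=1 nothing changes. *)

theory Defs
  imports
    Complex_Main
    "HOL-Library.Poly_Mapping"
    "HOL-Library.Product_Plus"
    "HOL-Combinatorics.Permutations"
    "HOL-Algebra.QuotRing"
    "HOL-Algebra.Module"
    "HOL-Algebra.Generated_Rings"
    "HOL-Algebra.Free_Abelian_Groups"
begin

section \<open>Tensor algebras, modules and tensor products\<close>

text \<open>
  Words form a monoid under concatenation, so that \<open>'v word \<Rightarrow>\<^sub>0 complex\<close> with the
  convolution product of Poly_Mapping is the free unital associative algebra on \<open>'v\<close>.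
\<close>

datatype 'v word = Word (letters: "'v list")

instantiation word :: (type) monoid_add
begin

definition zero_word :: "'a word" where "zero_word = Word []"

definition plus_word :: "'a word \<Rightarrow> 'a word \<Rightarrow> 'a word" where
  "plus_word u v = Word (letters u @ letters v)"

instance by standard (auto simp: zero_word_def plus_word_def)

end

type_synonym 'v free_alg = "'v word \<Rightarrow>\<^sub>0 complex"

definition free_alg :: "'v free_alg ring" where
  "free_alg = \<lparr>carrier = UNIV, monoid.mult = (*), monoid.one = 1, ring.zero = 0, ring.add = (+)\<rparr>"

text \<open>
  The tensor algebra of a complex vector space is the free algebra on its underlying set modulo
  linearity of the generators.  Its elements are cosets.
\<close>

definition tensor_ideal :: "(complex \<Rightarrow> 'v \<Rightarrow> 'v) \<Rightarrow> 'v::ab_group_add free_alg set" where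
  "tensor_ideal sc = Idl\<^bsub>free_alg\<^esub>
     ({Poly_Mapping.single (Word [u + v]) 1 - Poly_Mapping.single (Word [u]) 1
         - Poly_Mapping.single (Word [v]) 1 | u v. True} \<union>
      {Poly_Mapping.single (Word [sc c v]) 1 - Poly_Mapping.single (Word [v]) c | c v. True})"

definition tensor_alg :: "(complex \<Rightarrow> 'v \<Rightarrow> 'v) \<Rightarrow> 'v::ab_group_add free_alg set ring" where
  "tensor_alg sc = free_alg Quot tensor_ideal sc"

definition tensor_emb :: "(complex \<Rightarrow> 'v \<Rightarrow> 'v) \<Rightarrow> 'v \<Rightarrow> 'v::ab_group_add free_alg set" where
  "tensor_emb sc v = tensor_ideal sc +>\<^bsub>free_alg\<^esub> Poly_Mapping.single (Word [v]) 1"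

definition tensor_const :: "(complex \<Rightarrow> 'v \<Rightarrow> 'v) \<Rightarrow> complex \<Rightarrow> 'v::ab_group_add free_alg set" where
  "tensor_const sc c = tensor_ideal sc +>\<^bsub>free_alg\<^esub> Poly_Mapping.single 0 c"

text \<open>
  Left modules over a noncommutative complex algebra.  The algebra is a ring record \<open>R\<close> together
  with the map \<open>const\<close> from the scalars to \<open>R\<close>; the module is the whole type \<open>'m\<close>.
\<close>

definition left_module ::
  "('r, 'x) ring_scheme \<Rightarrow> (complex \<Rightarrow> 'r) \<Rightarrow> (complex \<Rightarrow> 'm \<Rightarrow> 'm) \<Rightarrow>
     ('r \<Rightarrow> 'm::ab_group_add \<Rightarrow> 'm) \<Rightarrow> bool" where
  "left_module R const sc act \<longleftrightarrow>
     vector_space sc \<and>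
     (\<forall>p\<in>carrier R. \<forall>u v. act p (u + v) = act p u + act p v) \<and>
     (\<forall>p\<in>carrier R. \<forall>q\<in>carrier R. \<forall>u. act (p \<oplus>\<^bsub>R\<^esub> q) u = act p u + act q u) \<and>
     (\<forall>p\<in>carrier R. \<forall>q\<in>carrier R. \<forall>u. act (p \<otimes>\<^bsub>R\<^esub> q) u = act p (act q u)) \<and>
     (\<forall>u. act \<one>\<^bsub>R\<^esub> u = u) \<and>
     (\<forall>c u. act (const c) u = sc c u)"

definition lower_bounded_grading ::
  "(complex \<Rightarrow> 'm \<Rightarrow> 'm) \<Rightarrow> (complex \<Rightarrow> 'm::ab_group_add set) \<Rightarrow> bool" where
  "lower_bounded_grading sc gr \<longleftrightarrow>
     (\<forall>z. module.subspace sc (gr z)) \<and>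
     (\<forall>u. \<exists>!f. finite {z. f z \<noteq> 0} \<and> (\<forall>z. f z \<in> gr z) \<and> u = (\<Sum>z | f z \<noteq> 0. f z)) \<and>
     (\<exists>B::real. \<forall>z. Re z < B \<longrightarrow> gr z = {0})"

text \<open>
  For a ring \<open>N\<close>, a subring \<open>S\<close> and a left \<open>S\<close>-module \<open>'m\<close>, the tensor product of \<open>N\<close> and \<open>'m\<close>
  over \<open>S\<close> is the free abelian group on pairs modulo biadditivity and \<open>S\<close>-balancedness.
\<close>

definition tp_free :: "('n, 'x) ring_scheme \<Rightarrow> ('n \<times> 'm \<Rightarrow>\<^sub>0 int) monoid" where
  "tp_free N = free_Abelian_group (carrier N \<times> UNIV)"

definition tp_rel ::
  "('n, 'x) ring_scheme \<Rightarrow> 'n set \<Rightarrow> ('n \<Rightarrow> 'm \<Rightarrow> 'm) \<Rightarrow> ('n \<times> 'm::ab_group_add \<Rightarrow>\<^sub>0 int) set" where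
  "tp_rel N S act = generate (tp_free N)
     ({frag_of (p \<oplus>\<^bsub>N\<^esub> q, u) - frag_of (p, u) - frag_of (q, u) | p q u.
         p \<in> carrier N \<and> q \<in> carrier N} \<union>
      {frag_of (p, u + v) - frag_of (p, u) - frag_of (p, v) | p u v. p \<in> carrier N} \<union>
      {frag_of (p \<otimes>\<^bsub>N\<^esub> q, u) - frag_of (p, act q u) | p q u. p \<in> carrier N \<and> q \<in> S})"

text \<open>
  The action of \<open>p \<in> N\<close> on the left tensor factor; the union is over representatives of the
  coset \<open>w\<close> and all the united cosets coincide.
\<close>

definition tp_act ::
  "('n, 'x) ring_scheme \<Rightarrow> 'n set \<Rightarrow> ('n \<Rightarrow> 'm \<Rightarrow> 'm) \<Rightarrow> 'n \<Rightarrow>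
     ('n \<times> 'm::ab_group_add \<Rightarrow>\<^sub>0 int) set \<Rightarrow> ('n \<times> 'm \<Rightarrow>\<^sub>0 int) set" where
  "tp_act N S act p w =
     (\<Union>f\<in>w. tp_rel N S act #>\<^bsub>tp_free N\<^esub> frag_extend (\<lambda>(q, u). frag_of (p \<otimes>\<^bsub>N\<^esub> q, u)) f)"

text \<open>
  The record type of modules in HOL-Algebra extends that of rings; the ring multiplication of a
  module carries no meaning.  The group operation of \<open>Mod\<close> is written multiplicatively.
\<close>

definition tensor_product ::
  "('n, 'x) ring_scheme \<Rightarrow> (complex \<Rightarrow> 'n) \<Rightarrow> 'n set \<Rightarrow> ('n \<Rightarrow> 'm \<Rightarrow> 'm) \<Rightarrow>
     (complex, ('n \<times> 'm::ab_group_add \<Rightarrow>\<^sub>0 int) set) module" where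
  "tensor_product N const S act =
     (let Q = tp_free N Mod tp_rel N S act in
      \<lparr>carrier = carrier Q, monoid.mult = undefined, monoid.one = undefined,
       ring.zero = \<one>\<^bsub>Q\<^esub>, ring.add = (\<otimes>\<^bsub>Q\<^esub>), module.smult = (\<lambda>c. tp_act N S act (const c))\<rparr>)"


section \<open>The algebra \<open>N\<^sup>t\<^sup>w\<close> and the module \<open>W\<close>\<close>

definition nondegenerate_symmetric_form ::
  "(complex \<Rightarrow> 'h \<Rightarrow> 'h) \<Rightarrow> ('h::ab_group_add \<Rightarrow> 'h \<Rightarrow> complex) \<Rightarrow> bool" where
  "nondegenerate_symmetric_form sc form \<longleftrightarrow>
     (\<forall>u. Vector_Spaces.linear sc (*) (form u)) \<and>
     (\<forall>u v. form u v = form v u) \<and>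
     (\<forall>u. (\<forall>v. form u v = 0) \<longrightarrow> u = 0)"

text \<open>
  Elements of the union of the bosonic and the fermionic copy of \<open>'h\<close>, which is not the direct
  sum; the latter is \<open>'h \<times> 'h\<close>, bosonic copy first.
\<close>

datatype 'h bf = Bos 'h | Fer 'h

fun is_fer :: "'h bf \<Rightarrow> bool" where
  "is_fer (Bos u) = False"
| "is_fer (Fer u) = True"

abbreviation parity :: "'h bf \<Rightarrow> nat" where
  "parity a \<equiv> of_bool (is_fer a)"

fun bf_emb :: "'h::zero bf \<Rightarrow> 'h \<times> 'h" where
  "bf_emb (Bos u) = (u, 0)"
| "bf_emb (Fer u) = (0, u)"

fun bf_form :: "('h \<Rightarrow> 'h \<Rightarrow> complex) \<Rightarrow> 'h bf \<Rightarrow> 'h bf \<Rightarrow> complex" where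
  "bf_form form (Bos u) (Bos v) = form u v"
| "bf_form form (Fer u) (Fer v) = form u v"
| "bf_form form (Bos u) (Fer v) = 0"
| "bf_form form (Fer u) (Bos v) = 0"

definition dsum_scale :: "(complex \<Rightarrow> 'h \<Rightarrow> 'h) \<Rightarrow> complex \<Rightarrow> 'h \<times> 'h \<Rightarrow> 'h \<times> 'h" where
  "dsum_scale sc c = map_prod (sc c) (sc c)"

text \<open>
  Laurent polynomials with coefficients in the direct sum are finitely supported functions on the
  integers; the last two components are the coordinates along \<open>k\<^sub>B\<close> and \<open>k\<^sub>F\<close>.
\<close>

type_synonym 'h hhat = "(int \<Rightarrow>\<^sub>0 'h \<times> 'h) \<times> complex \<times> complex"

definition hhat_scale ::
  "(complex \<Rightarrow> 'h::ab_group_add \<Rightarrow> 'h) \<Rightarrow> complex \<Rightarrow> 'h hhat \<Rightarrow> 'h hhat" where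
  "hhat_scale sc c = (\<lambda>(f, u, v). (Poly_Mapping.map (dsum_scale sc c) f, c * u, c * v))"

abbreviation T_mode ::
  "(complex \<Rightarrow> 'h::ab_group_add \<Rightarrow> 'h) \<Rightarrow> 'h bf \<Rightarrow> int \<Rightarrow> 'h hhat free_alg set" where
  "T_mode sc a n \<equiv> tensor_emb (hhat_scale sc) (Poly_Mapping.single n (bf_emb a), 0, 0)"

abbreviation T_kB :: "(complex \<Rightarrow> 'h::ab_group_add \<Rightarrow> 'h) \<Rightarrow> 'h hhat free_alg set" where
  "T_kB sc \<equiv> tensor_emb (hhat_scale sc) (0, 1, 0)"

abbreviation T_kF :: "(complex \<Rightarrow> 'h::ab_group_add \<Rightarrow> 'h) \<Rightarrow> 'h hhat free_alg set" where
  "T_kF sc \<equiv> tensor_emb (hhat_scale sc) (0, 0, 1)"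

text \<open>The supercommutator of elements \<open>x\<close> of parity \<open>p\<close> and \<open>y\<close> of parity \<open>q\<close>.\<close>

definition T_comm ::
  "(complex \<Rightarrow> 'h \<Rightarrow> 'h) \<Rightarrow> nat \<Rightarrow> nat \<Rightarrow> 'h::ab_group_add hhat free_alg set \<Rightarrow>
     'h hhat free_alg set \<Rightarrow> 'h hhat free_alg set" where
  "T_comm sc p q x y = (let T = tensor_alg (hhat_scale sc) in
     x \<otimes>\<^bsub>T\<^esub> y \<ominus>\<^bsub>T\<^esub> tensor_const (hhat_scale sc) ((- 1) ^ (p * q)) \<otimes>\<^bsub>T\<^esub> (y \<otimes>\<^bsub>T\<^esub> x))"

definition tw_rels ::
  "(complex \<Rightarrow> 'h \<Rightarrow> 'h) \<Rightarrow> ('h \<Rightarrow> 'h \<Rightarrow> complex) \<Rightarrow> 'h::ab_group_add hhat free_alg set set" where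
  "tw_rels sc form = (let T = tensor_alg (hhat_scale sc); const = tensor_const (hhat_scale sc) in
     {T_comm sc 0 0 (T_kB sc) (T_kF sc)} \<union>
     {T_comm sc (parity a) 0 (T_mode sc a m) (T_kB sc) | a m. True} \<union>
     {T_comm sc (parity a) 0 (T_mode sc a m) (T_kF sc) | a m. True} \<union>
     {T_comm sc (parity a) (parity b) (T_mode sc a m) (T_mode sc b 0) | a b m. m \<noteq> 0} \<union>
     {T_comm sc (parity a) (parity b) (T_mode sc a m) (T_mode sc b n) | a b m n.
        \<not> is_fer a \<and> is_fer b \<and> (0 < m \<and> n < 0 \<or> m < 0 \<and> 0 < n)} \<union>
     {T_comm sc (parity a) (parity b) (T_mode sc a m) (T_mode sc b n) \<ominus>\<^bsub>T\<^esub>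
        const (of_int m * bf_form form a b * of_bool (m + n = 0)) \<otimes>\<^bsub>T\<^esub> T_kB sc | a b m n.
        \<not> is_fer a \<and> \<not> is_fer b \<and> 0 < m \<and> n < 0} \<union>
     {T_comm sc (parity a) (parity b) (T_mode sc a m) (T_mode sc b n) \<ominus>\<^bsub>T\<^esub>
        const (bf_form form a b * of_bool (m + n = 0)) \<otimes>\<^bsub>T\<^esub> T_kF sc | a b m n.
        is_fer a \<and> is_fer b \<and> 0 < m \<and> n < 0})"

type_synonym 'h Ntw = "'h hhat free_alg set set"

definition Ntw_ideal ::
  "(complex \<Rightarrow> 'h \<Rightarrow> 'h) \<Rightarrow> ('h \<Rightarrow> 'h \<Rightarrow> complex) \<Rightarrow> 'h::ab_group_add hhat free_alg set set" where
  "Ntw_ideal sc form = Idl\<^bsub>tensor_alg (hhat_scale sc)\<^esub> tw_rels sc form"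

definition Ntw ::
  "(complex \<Rightarrow> 'h \<Rightarrow> 'h) \<Rightarrow> ('h \<Rightarrow> 'h \<Rightarrow> complex) \<Rightarrow> 'h::ab_group_add Ntw ring" where
  "Ntw sc form = tensor_alg (hhat_scale sc) Quot Ntw_ideal sc form"

definition Ntw_class ::
  "(complex \<Rightarrow> 'h \<Rightarrow> 'h) \<Rightarrow> ('h \<Rightarrow> 'h \<Rightarrow> complex) \<Rightarrow>
     'h::ab_group_add hhat free_alg set \<Rightarrow> 'h Ntw" where
  "Ntw_class sc form x = Ntw_ideal sc form +>\<^bsub>tensor_alg (hhat_scale sc)\<^esub> x"

abbreviation N_const where
  "N_const sc form c \<equiv> Ntw_class sc form (tensor_const (hhat_scale sc) c)"

abbreviation N_mode where
  "N_mode sc form a n \<equiv> Ntw_class sc form (T_mode sc a n)"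

abbreviation N_kB where
  "N_kB sc form \<equiv> Ntw_class sc form (T_kB sc)"

abbreviation N_kF where
  "N_kF sc form \<equiv> Ntw_class sc form (T_kF sc)"

text \<open>The subalgebra generated by the nonnegative modes and the two central elements.\<close>

definition Ntw_ge0 ::
  "(complex \<Rightarrow> 'h \<Rightarrow> 'h) \<Rightarrow> ('h \<Rightarrow> 'h \<Rightarrow> complex) \<Rightarrow> 'h::ab_group_add Ntw set" where
  "Ntw_ge0 sc form = generate_ring (Ntw sc form)
     (range (N_const sc form) \<union> {N_mode sc form a n | a n. 0 \<le> n} \<union>
      {N_kB sc form, N_kF sc form})"

text \<open>
  \<open>actT\<close> is the given action on \<open>M\<close> of the tensor algebra of the direct sum of the two copies, and
  \<open>act0\<close> is the resulting \<open>N\<^sup>t\<^sup>w\<^sub>\<ge>\<^sub>0\<close>-module structure on \<open>M\<close>.  As \<open>N\<^sup>t\<^sup>w\<^sub>\<ge>\<^sub>0\<close> is generated by the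
  elements listed, \<open>act0\<close> is determined on it by these conditions.
\<close>

definition induced_ge0_action ::
  "(complex \<Rightarrow> 'h \<Rightarrow> 'h) \<Rightarrow> ('h::ab_group_add \<Rightarrow> 'h \<Rightarrow> complex) \<Rightarrow> complex \<Rightarrow> complex \<Rightarrow>
     (complex \<Rightarrow> 'm \<Rightarrow> 'm) \<Rightarrow> (('h \<times> 'h) free_alg set \<Rightarrow> 'm \<Rightarrow> 'm) \<Rightarrow>
     ('h Ntw \<Rightarrow> 'm::ab_group_add \<Rightarrow> 'm) \<Rightarrow> bool" where
  "induced_ge0_action sc form lB lF scM actT act0 \<longleftrightarrow>
     left_module (Ntw sc form\<lparr>carrier := Ntw_ge0 sc form\<rparr>) (N_const sc form) scM act0 \<and>
     (\<forall>a u. act0 (N_mode sc form a 0) u = actT (tensor_emb (dsum_scale sc) (bf_emb a)) u) \<and>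
     (\<forall>a n u. 0 < n \<longrightarrow> act0 (N_mode sc form a n) u = 0) \<and>
     (\<forall>u. act0 (N_kB sc form) u = scM lB u) \<and>
     (\<forall>u. act0 (N_kF sc form) u = scM lF u)"

type_synonym ('h, 'm) Wtw = "('h Ntw \<times> 'm \<Rightarrow>\<^sub>0 int) set"

definition Wtw ::
  "(complex \<Rightarrow> 'h \<Rightarrow> 'h) \<Rightarrow> ('h \<Rightarrow> 'h \<Rightarrow> complex) \<Rightarrow> ('h::ab_group_add Ntw \<Rightarrow> 'm \<Rightarrow> 'm) \<Rightarrow>
     (complex, ('h, 'm::ab_group_add) Wtw) module" where
  "Wtw sc form act0 = tensor_product (Ntw sc form) (N_const sc form) (Ntw_ge0 sc form) act0"

definition W_mode ::
  "(complex \<Rightarrow> 'h \<Rightarrow> 'h) \<Rightarrow> ('h \<Rightarrow> 'h \<Rightarrow> complex) \<Rightarrow> ('h::ab_group_add Ntw \<Rightarrow> 'm \<Rightarrow> 'm) \<Rightarrow>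
     'h bf \<Rightarrow> int \<Rightarrow> ('h, 'm::ab_group_add) Wtw \<Rightarrow> ('h, 'm) Wtw" where
  "W_mode sc form act0 a n =
     tp_act (Ntw sc form) (Ntw_ge0 sc form) act0 (N_mode sc form a n)"


section \<open>Formal series in the variables \<open>x\<^sub>i\<close>, \<open>y\<^sub>j\<close>\<close>

text \<open>
  A series is the function mapping a family of rational exponents to the coefficient of the
  corresponding monomial.  Products of series are only used where every coefficient of the product
  is a finite sum; the sums below range over the nonzero contributions only, because sums over
  infinite index sets are \<open>0\<close> by convention.
\<close>

datatype var = Xv nat | Yv nat

type_synonym expo = "var \<Rightarrow> rat"
type_synonym fseries = "expo \<Rightarrow> complex"
type_synonym 'w opseries = "expo \<Rightarrow> 'w \<Rightarrow> 'w"

definition fs_monom :: "var \<Rightarrow> rat \<Rightarrow> fseries" where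
  "fs_monom v q e = (if e = (\<lambda>_. 0)(v := q) then 1 else 0)"

definition fs_one :: fseries where
  "fs_one e = (if e = (\<lambda>_. 0) then 1 else 0)"

definition fs_scale :: "complex \<Rightarrow> fseries \<Rightarrow> fseries" where
  "fs_scale c f e = c * f e"

definition fs_add :: "fseries \<Rightarrow> fseries \<Rightarrow> fseries" where
  "fs_add f g e = f e + g e"

definition fs_mult :: "fseries \<Rightarrow> fseries \<Rightarrow> fseries" where
  "fs_mult f g e =
     (\<Sum>(e1, e2) | f e1 \<noteq> 0 \<and> g e2 \<noteq> 0 \<and> (\<forall>v. e1 v + e2 v = e v). f e1 * g e2)"

definition fs_prod :: "fseries list \<Rightarrow> fseries" where
  "fs_prod fs = foldr fs_mult fs fs_one"

definition fs_deriv :: "var \<Rightarrow> fseries \<Rightarrow> fseries" where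
  "fs_deriv v f e = of_rat (e v + 1) * f (e(v := e v + 1))"

text \<open>The divided power \<open>\<partial>\<^sub>v\<^sup>k / k!\<close>.\<close>

definition fs_hderiv :: "var \<Rightarrow> nat \<Rightarrow> fseries \<Rightarrow> fseries" where
  "fs_hderiv v k f = fs_scale (1 / fact k) ((fs_deriv v ^^ k) f)"

text \<open>
  The expansion of \<open>(v - w)\<^sup>N\<close> in nonnegative powers of \<open>w\<close>; the sum has at most one term.  This
  expansion commutes with derivatives, so the functions \<open>F\<close> and \<open>G\<close> below may be expanded before
  they are differentiated.
\<close>

definition fs_binom :: "var \<Rightarrow> var \<Rightarrow> int \<Rightarrow> fseries" where
  "fs_binom v w N e =
     (\<Sum>k | e = (\<lambda>_. 0)(v := of_int N - of_nat k, w := of_nat k). (of_int N gchoose k) * (- 1) ^ k)"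

definition F_series :: "nat \<Rightarrow> nat \<Rightarrow> var \<Rightarrow> var \<Rightarrow> fseries" where
  "F_series m n v w = fs_hderiv v (m - 1) (fs_hderiv w (n - 1) (fs_binom v w (- 2)))"

definition G0_series :: "var \<Rightarrow> var \<Rightarrow> fseries" where
  "G0_series v w = fs_scale (1/2)
     (fs_prod [fs_monom v (- 1/2), fs_monom w (- 1/2),
               fs_add (fs_monom v 1) (fs_monom w 1), fs_binom v w (- 1)])"

definition G_series :: "nat \<Rightarrow> nat \<Rightarrow> var \<Rightarrow> var \<Rightarrow> fseries" where
  "G_series m n v w = fs_hderiv v (m - 1) (fs_hderiv w (n - 1) (G0_series v w))"

definition fs_perm :: "nat \<Rightarrow> (nat \<Rightarrow> nat \<Rightarrow> fseries) \<Rightarrow> fseries" where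
  "fs_perm k A e = (\<Sum>\<sigma> | \<sigma> permutes {..<k}. fs_prod (map (\<lambda>i. A i (\<sigma> i)) [0..<k]) e)"

definition fs_det :: "nat \<Rightarrow> (nat \<Rightarrow> nat \<Rightarrow> fseries) \<Rightarrow> fseries" where
  "fs_det k A e =
     (\<Sum>\<sigma> | \<sigma> permutes {..<k}. of_int (sign \<sigma>) * fs_prod (map (\<lambda>i. A i (\<sigma> i)) [0..<k]) e)"

text \<open>Series of operators on the complex vector space \<open>W\<close>, compared on the carrier only.\<close>

definition op_nonzero :: "(complex, 'w) module \<Rightarrow> ('w \<Rightarrow> 'w) \<Rightarrow> bool" where
  "op_nonzero W A \<longleftrightarrow> (\<exists>w\<in>carrier W. A w \<noteq> \<zero>\<^bsub>W\<^esub>)"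

definition os_mult ::
  "(complex, 'w) module \<Rightarrow> 'w opseries \<Rightarrow> 'w opseries \<Rightarrow> 'w opseries" where
  "os_mult W A B e w =
     (\<Oplus>\<^bsub>W\<^esub>p \<in> {(e1, e2). op_nonzero W (A e1) \<and> op_nonzero W (B e2) \<and>
                             (\<forall>v. e1 v + e2 v = e v)}. A (fst p) (B (snd p) w))"

definition os_smult ::
  "(complex, 'w) module \<Rightarrow> fseries \<Rightarrow> 'w opseries \<Rightarrow> 'w opseries" where
  "os_smult W f B e w =
     (\<Oplus>\<^bsub>W\<^esub>p \<in> {(e1, e2). f e1 \<noteq> 0 \<and> op_nonzero W (B e2) \<and>
                             (\<forall>v. e1 v + e2 v = e v)}. f (fst p) \<odot>\<^bsub>W\<^esub> B (snd p) w)"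

definition os_sum ::
  "(complex, 'w) module \<Rightarrow> 'i set \<Rightarrow> ('i \<Rightarrow> 'w opseries) \<Rightarrow> 'w opseries" where
  "os_sum W I A e w = (\<Oplus>\<^bsub>W\<^esub>i \<in> I. A i e w)"

definition os_eq :: "(complex, 'w) module \<Rightarrow> 'w opseries \<Rightarrow> 'w opseries \<Rightarrow> bool" where
  "os_eq W A B \<longleftrightarrow> (\<forall>e. \<forall>w\<in>carrier W. A e w = B e w)"


section \<open>Normal ordering\<close>

definition count_fer :: "'h bf list \<Rightarrow> nat" where
  "count_fer l = length (filter is_fer l)"

definition delete_nth :: "nat \<Rightarrow> 'a list \<Rightarrow> 'a list" where
  "delete_nth i l = take i l @ drop (Suc i) l"

lemma length_delete_nth [simp]: "i < length l \<Longrightarrow> length (delete_nth i l) = length l - 1"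
  by (simp add: delete_nth_def)

text \<open>
  Normal ordering of zero modes, with modes \<open>md a n\<close> acting on \<open>W\<close>.  In the list \<open>a # l\<close> the
  factor in 1-based position \<open>i + 2\<close> is \<open>l ! i\<close>.

  The scalar \<open>\<kappa>\<close> is the normalisation of the contraction of two zero modes.  The recursion is
  usually written with \<open>\<kappa> = 1\<close>, which presupposes that \<open>k\<^sub>F\<close> acts as \<open>1\<close>.  When \<open>k\<^sub>F\<close> acts as
  \<open>\<ell>\<^sub>F\<close> the normalisation has to be \<open>\<kappa> = \<ell>\<^sub>F\<close>: for one fermionic field on each side, the coefficient
  of \<open>x\<^sup>-\<^sup>1\<^sup>/\<^sup>2 y\<^sup>-\<^sup>1\<^sup>/\<^sup>2\<close> in the contraction \<open>\<ell>\<^sub>F (a,b) G(x,y)\<close> is \<open>\<ell>\<^sub>F (a,b) / 2\<close>, whereas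
  \<open>a(0) b(0)\<close> differs from its normal ordering by \<open>\<kappa> (a,b) / 2\<close>.
\<close>

function no_zero ::
  "(complex, 'w) module \<Rightarrow> ('h bf \<Rightarrow> int \<Rightarrow> 'w \<Rightarrow> 'w) \<Rightarrow> ('h \<Rightarrow> 'h \<Rightarrow> complex) \<Rightarrow> complex \<Rightarrow>
     'h bf list \<Rightarrow> 'w \<Rightarrow> 'w" where
  "no_zero W md form \<kappa> [] w = w"
| "no_zero W md form \<kappa> (a # l) w =
     (if is_fer a then
        foldr (\<oplus>\<^bsub>W\<^esub>)
          (map (\<lambda>i. ((- 1) ^ (count_fer (a # take (Suc i) l) - 1) / 2 * \<kappa> * bf_form form a (l ! i))
                      \<odot>\<^bsub>W\<^esub> no_zero W md form \<kappa> (delete_nth i l) w)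
             (filter (\<lambda>i. is_fer (l ! i)) [0..<length l]))
          (md a 0 (no_zero W md form \<kappa> l w))
      else md a 0 (no_zero W md form \<kappa> l w))"
  by pat_completeness auto

termination
  by (relation "Wellfounded.measure (\<lambda>(_, _, _, _, l, _). length l)") auto

text \<open>The rearrangement of a list of modes with the negative ones first and the zero ones last.\<close>

definition mode_sort :: "('a \<Rightarrow> int) \<Rightarrow> 'a list \<Rightarrow> 'a list" where
  "mode_sort f l =
     filter (\<lambda>p. f p < 0) l @ filter (\<lambda>p. 0 < f p) l @ filter (\<lambda>p. f p = 0) l"

text \<open>The sign of the permutation of the fermionic factors which this rearrangement induces.\<close>

definition fer_sign :: "('h bf \<times> int) list \<Rightarrow> int" where
  "fer_sign l =
     (let l' = filter (\<lambda>p. is_fer (fst p)) l;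
          js = mode_sort (\<lambda>j. snd (l' ! j)) [0..<length l']
      in sign (\<lambda>j. if j < length l' then js ! j else j))"

definition normal_order ::
  "(complex, 'w) module \<Rightarrow> ('h bf \<Rightarrow> int \<Rightarrow> 'w \<Rightarrow> 'w) \<Rightarrow> ('h \<Rightarrow> 'h \<Rightarrow> complex) \<Rightarrow> complex \<Rightarrow>
     ('h bf \<times> int) list \<Rightarrow> 'w \<Rightarrow> 'w" where
  "normal_order W md form \<kappa> l w =
     of_int (fer_sign l) \<odot>\<^bsub>W\<^esub>
       foldr (\<lambda>(a, n). md a n) (filter (\<lambda>p. snd p < 0) l @ filter (\<lambda>p. 0 < snd p) l)
         (no_zero W md form \<kappa> (map fst (filter (\<lambda>p. snd p = 0) l)) w)"

text \<open>
  The triple \<open>(a, k, v)\<close> stands for the field \<open>a\<^sup>(\<^sup>k\<^sup>)(v)\<close>, the sum over \<open>n\<close> of the modes \<open>a(n)\<close>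
  times \<open>\<partial>\<^sub>v\<^sup>k / k!\<close> of \<open>v\<^sup>-\<^sup>n\<^sup>-\<^sup>1\<^sup>+\<^sup>|\<^sup>a\<^sup>|\<^sup>/\<^sup>2\<close>.
\<close>

definition mode_coeff :: "'h bf \<times> nat \<times> var \<Rightarrow> int \<Rightarrow> fseries" where
  "mode_coeff = (\<lambda>(a, k, v) n.
     fs_hderiv v k (fs_monom v (- of_int n - 1 + of_nat (parity a) / 2)))"

definition no_fields ::
  "(complex, 'w) module \<Rightarrow> ('h bf \<Rightarrow> int \<Rightarrow> 'w \<Rightarrow> 'w) \<Rightarrow> ('h \<Rightarrow> 'h \<Rightarrow> complex) \<Rightarrow> complex \<Rightarrow>
     ('h bf \<times> nat \<times> var) list \<Rightarrow> 'w opseries" where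
  "no_fields W md form \<kappa> fs e w =
     (\<Oplus>\<^bsub>W\<^esub>ns \<in> {ns. length ns = length fs \<and> fs_prod (map2 mode_coeff fs ns) e \<noteq> 0}.
        fs_prod (map2 mode_coeff fs ns) e \<odot>\<^bsub>W\<^esub> normal_order W md form \<kappa> (zip (map fst fs) ns) w)"


section \<open>Index sets\<close>

definition idxB :: "(nat \<Rightarrow> 'h bf) \<Rightarrow> nat \<Rightarrow> nat set" where
  "idxB a r = {i \<in> {1..r}. \<not> is_fer (a i)}"

definition idxF :: "(nat \<Rightarrow> 'h bf) \<Rightarrow> nat \<Rightarrow> nat set" where
  "idxF a r = {i \<in> {1..r}. is_fer (a i)}"

text \<open>Increasing tuples, as lists; list positions are 0-based.\<close>

definition incr_tuples :: "nat set \<Rightarrow> nat \<Rightarrow> nat list set" where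
  "incr_tuples A k = {I. length I = k \<and> sorted_wrt (<) I \<and> set I \<subseteq> A}"

text \<open>\<open>r\<^sup>F(i)\<close>; in particular \<open>r\<^sup>F\<close> itself is \<open>num_fer a r\<close>.\<close>

definition num_fer :: "(nat \<Rightarrow> 'h bf) \<Rightarrow> nat \<Rightarrow> nat" where
  "num_fer a i = card {j \<in> {1..i}. is_fer (a j)}"

text \<open>The factors \<open>a\<^sub>i\<^sup>(\<^sup>m\<^sup>_\<^sup>i\<^sup>-\<^sup>1\<^sup>)(x\<^sub>i)\<close>, \<open>i = 1, \<dots>, r\<close>, without those with index in \<open>D\<close>.\<close>

definition field_list :: "(nat \<Rightarrow> var) \<Rightarrow> (nat \<Rightarrow> 'h bf) \<Rightarrow> (nat \<Rightarrow> nat) \<Rightarrow> nat \<Rightarrow> nat set \<Rightarrow>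
    ('h bf \<times> nat \<times> var) list" where
  "field_list x a m r D = map (\<lambda>i. (a i, m i - 1, x i)) (filter (\<lambda>i. i \<notin> D) [1..<Suc r])"

end

theory Submission
  imports Defs "Jordan_Normal_Form.Determinant"
begin

text \<open>
  A single mode \<open>p\<close> times a normal ordered product \<open>:l:\<close> is \<open>:p l:\<close> plus the terms in which \<open>p\<close> is
  contracted with one factor of \<open>l\<close>.  For nonzero modes this is the commutation relation of positive
  and negative modes; for zero modes, which satisfy no relations among themselves, it is the
  recursion defining their normal ordering.  Hence \<open>:p l: :l':\<close> is determined by the products
  \<open>:k: :l':\<close> with \<open>k\<close> shorter than \<open>p l\<close>.  The sum over the partial matchings of factors of \<open>l\<close> with
  factors of \<open>l'\<close> obeys the same recursion, because contracting with \<open>p\<close> acts on it as a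
  superderivation.  The sum over the matchings of given index sets is a permanent for the bosons
  and, up to sign, a determinant for the fermions, by expansion along the first row.

  Fields reduce to modes because the variables of all fields are distinct: a monomial picks at most
  one mode of each field, and the coefficients of \<open>F\<^bsub>mn\<^esub>\<close> and \<open>G\<^bsub>mn\<^esub>\<close> at it are the contractions of
  these modes, including the contraction \<open>1/2\<close> of two fermionic zero modes.

  Identities in \<open>W\<close> are tested on the linear functionals \<open>W \<rightarrow> \<complex>\<close>, so that all sums over
  contractions are sums of complex numbers.
\<close>

section \<open>Contractions\<close>

locale contraction =
  fixes fer :: "'l \<Rightarrow> bool" and c :: "'l \<Rightarrow> 'l \<Rightarrow> complex"
  assumes c_parity: "c p q \<noteq> 0 \<Longrightarrow> fer p = fer q"
begin

definition eps :: "'l \<Rightarrow> 'l \<Rightarrow> complex" where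
  "eps p q = (if fer p \<and> fer q then -1 else 1)"

definition epsl :: "'l \<Rightarrow> 'l list \<Rightarrow> complex" where
  "epsl p l = (\<Prod>q\<leftarrow>l. eps p q)"

text \<open>
  \<open>contr p \<Phi> l\<close> is the sum of \<open>\<Phi>\<close> over the lists obtained from \<open>p # l\<close> by contracting \<open>p\<close> with one
  entry of \<open>l\<close>, signed by moving \<open>p\<close> to that entry.
\<close>

fun contr :: "'l \<Rightarrow> ('l list \<Rightarrow> complex) \<Rightarrow> 'l list \<Rightarrow> complex" where
  "contr p \<Phi> [] = 0"
| "contr p \<Phi> (x # l) = c p x * \<Phi> l + eps p x * contr p (\<lambda>l. \<Phi> (x # l)) l"

text \<open>The sum of \<open>\<Phi>\<close> over all partial matchings of entries of the first list with entries of \<open>B\<close>.\<close>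

fun wick :: "'l list \<Rightarrow> ('l list \<Rightarrow> complex) \<Rightarrow> 'l list \<Rightarrow> complex" where
  "wick [] \<Phi> B = \<Phi> B"
| "wick (p # A) \<Phi> B = wick A (\<lambda>l. \<Phi> (p # l)) B + epsl p A * contr p (wick A \<Phi>) B"

lemma epsl_simps [simp]: "epsl p [] = 1" "epsl p (x # l) = eps p x * epsl p l"
  "epsl p (l @ l') = epsl p l * epsl p l'"
  by (simp_all add: epsl_def)

lemma eps_sym: "eps p q = eps q p"
  by (auto simp: eps_def)

lemma eps_square [simp]: "eps p q * eps p q = 1" "eps p q * (eps p q * z) = z"
  by (auto simp: eps_def)

lemma epsl_square [simp]: "epsl p l * epsl p l = 1" "epsl p l * (epsl p l * z) = z"
proof -
  show "epsl p l * epsl p l = 1"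
    by (induction l) (auto simp: algebra_simps)
  then show "epsl p l * (epsl p l * z) = z"
    by (metis mult.assoc mult_1)
qed

lemma eps_boson [simp]: "\<not> fer p \<Longrightarrow> eps p q = 1" "\<not> fer p \<Longrightarrow> eps q p = 1"
  by (auto simp: eps_def)

lemma epsl_boson [simp]: "\<not> fer p \<Longrightarrow> epsl p l = 1"
  by (induction l) auto

lemma eps_cong: "fer p = fer q \<Longrightarrow> eps p x = eps q x" "fer p = fer q \<Longrightarrow> eps x p = eps x q"
  by (auto simp: eps_def)

lemma epsl_cong: "fer p = fer q \<Longrightarrow> epsl p l = epsl q l"
  by (simp add: epsl_def eps_def)

lemma contr_cong: "(\<And>l. \<Phi> l = \<Psi> l) \<Longrightarrow> contr p \<Phi> l = contr p \<Psi> l"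
  by presburger

lemma contr_add: "contr p (\<lambda>l. \<Phi> l + \<Psi> l) l = contr p \<Phi> l + contr p \<Psi> l"
  by (induction l arbitrary: \<Phi> \<Psi>) (auto simp: algebra_simps)

lemma contr_scale: "contr p (\<lambda>l. z * \<Phi> l) l = z * contr p \<Phi> l"
  "contr p (\<lambda>l. \<Phi> l * z) l = contr p \<Phi> l * z"
  by (induction l arbitrary: \<Phi>) (auto simp: algebra_simps)

lemma contr_zero [simp]: "contr p (\<lambda>l. 0) l = 0"
  by (induction l) auto

lemma contr_no_partner: "(\<And>x. x \<in> set l \<Longrightarrow> c p x = 0) \<Longrightarrow> contr p \<Phi> l = 0"
  by (induction l arbitrary: \<Phi>) auto

lemma wick_add: "wick A (\<lambda>l. \<Phi> l + \<Psi> l) B = wick A \<Phi> B + wick A \<Psi> B"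
proof (induction A arbitrary: \<Phi> \<Psi> B)
  case (Cons p A)
  have "wick A (\<lambda>l. \<Phi> l + \<Psi> l) = (\<lambda>B. wick A \<Phi> B + wick A \<Psi> B)"
    using Cons.IH by blast
  then show ?case
    by (simp add: Cons.IH contr_add algebra_simps)
qed simp

lemma wick_scale: "wick A (\<lambda>l. z * \<Phi> l) B = z * wick A \<Phi> B"
  "wick A (\<lambda>l. \<Phi> l * z) B = wick A \<Phi> B * z"
proof -
  show *: "wick A (\<lambda>l. z * \<Phi> l) B = z * wick A \<Phi> B" for z A \<Phi> B
proof (induction A arbitrary: \<Phi> B)
  case (Cons p A)
  have "wick A (\<lambda>l. z * \<Phi> l) = (\<lambda>B. z * wick A \<Phi> B)"
    using Cons.IH by blast
  then show ?case
    by (simp add: Cons.IH contr_scale algebra_simps)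
qed simp
  show "wick A (\<lambda>l. \<Phi> l * z) B = wick A \<Phi> B * z"
    using *[of A z \<Phi> B] by (simp add: mult.commute)
qed

lemma contr_swap: "contr p (\<lambda>B. contr q (\<lambda>A. G A B) A) B = contr q (\<lambda>A. contr p (\<lambda>B. G A B) B) A"
proof (induction B arbitrary: G)
  case (Cons x B)
  show ?case
    by (simp add: contr_add contr_scale Cons.IH[of "\<lambda>A B. G A (x # B)"])
qed simp

lemma contr_contr: "contr p (contr q \<Phi>) l = eps p q * contr q (contr p \<Phi>) l"
proof (induction l arbitrary: \<Phi>)
  case (Cons x l)
  have 1: "c p x = eps p q * eps q x * c p x"
    using c_parity[of p x] eps_cong(2)[of x p q] eps_sym[of p q]
    by (cases "c p x = 0") (auto simp: mult.assoc[symmetric])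
  have 2: "eps p x * c q x = eps p q * c q x"
    using c_parity[of q x] eps_cong(2)[of x q p] eps_sym[of p q]
    by (cases "c q x = 0") auto
  have "contr p (contr q \<Phi>) (x # l) = c p x * contr q \<Phi> l + eps p x * c q x * contr p \<Phi> l
     + eps p x * eps q x * contr p (contr q (\<lambda>l. \<Phi> (x # l))) l"
    by (simp add: contr_add contr_scale algebra_simps)
  also have "\<dots> = eps p q * (c q x * contr p \<Phi> l + eps q x * c p x * contr q \<Phi> l
     + eps q x * eps p x * contr q (contr p (\<lambda>l. \<Phi> (x # l))) l)"
    by (subst 1, subst 2, subst Cons.IH) (simp add: algebra_simps)
  also have "\<dots> = eps p q * contr q (contr p \<Phi>) (x # l)"
    by (simp add: contr_add contr_scale algebra_simps)
  finally show ?case .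
qed simp

lemma contr_epsl: "eps p q * contr p (\<lambda>l. epsl q l * \<Phi> l) l = epsl q l * contr p \<Phi> l"
proof (induction l arbitrary: \<Phi>)
  case (Cons x l)
  have 1: "eps p q * c p x = eps q x * c p x"
    using c_parity[of p x] eps_cong(2)[of p x q] eps_sym[of p q]
    by (cases "c p x = 0") auto
  have "eps p q * contr p (\<lambda>l. epsl q l * \<Phi> l) (x # l) = (eps p q * c p x) * epsl q l * \<Phi> l
      + eps p x * eps q x * (eps p q * contr p (\<lambda>l. epsl q l * \<Phi> (x # l)) l)"
    using contr_scale(1)[of p "eps q x" "\<lambda>l. epsl q l * \<Phi> (x # l)" l]
    by (simp add: algebra_simps)
  also have "\<dots> = epsl q (x # l) * contr p \<Phi> (x # l)"
    by (subst 1, subst Cons.IH) (simp add: algebra_simps)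
  finally show ?case .
qed simp

lemma wick_contr:
  "wick A (contr p \<Phi>) B = contr p (\<lambda>A'. wick A' \<Phi> B) A + epsl p A * contr p (wick A \<Phi>) B"
proof (induction A arbitrary: \<Phi> B)
  case (Cons q A)
  let ?\<Phi>q = "\<lambda>l. \<Phi> (q # l)"
  have IH: "wick A (contr p \<Phi>) = (\<lambda>B. contr p (\<lambda>A'. wick A' \<Phi> B) A + epsl p A * contr p (wick A \<Phi>) B)"
    using Cons.IH by blast
  have 1: "wick A (\<lambda>l. contr p \<Phi> (q # l)) B =
      c p q * wick A \<Phi> B + eps p q * contr p (\<lambda>A'. wick A' ?\<Phi>q B) A
      + eps p q * epsl p A * contr p (wick A ?\<Phi>q) B"
    by (simp add: wick_add wick_scale Cons.IH algebra_simps)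
  have 2: "contr q (wick A (contr p \<Phi>)) B =
      contr q (\<lambda>B. contr p (\<lambda>A'. wick A' \<Phi> B) A) B + epsl p A * contr q (contr p (wick A \<Phi>)) B"
    by (simp add: IH contr_add contr_scale)
  have 3: "epsl q A * contr q (\<lambda>B. contr p (\<lambda>A'. wick A' \<Phi> B) A) B =
      eps p q * contr p (\<lambda>A'. epsl q A' * contr q (wick A' \<Phi>) B) A"
    by (subst contr_swap) (simp only: contr_epsl)
  have 4: "contr q (contr p (wick A \<Phi>)) B = eps p q * contr p (contr q (wick A \<Phi>)) B"
    by (subst contr_contr) (simp only: eps_sym)
  have 5: "contr p (wick (q # A) \<Phi>) B = contr p (wick A ?\<Phi>q) B
      + epsl q A * contr p (contr q (wick A \<Phi>)) B"
  proof -
    have "wick (q # A) \<Phi> = (\<lambda>B. wick A ?\<Phi>q B + epsl q A * contr q (wick A \<Phi>) B)"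
      by auto
    then show ?thesis
      by (simp add: contr_add contr_scale)
  qed
  have 6: "contr p (\<lambda>A'. wick A' \<Phi> B) (q # A) = c p q * wick A \<Phi> B
      + eps p q * contr p (\<lambda>A'. wick A' ?\<Phi>q B) A
      + eps p q * contr p (\<lambda>A'. epsl q A' * contr q (wick A' \<Phi>) B) A"
    by (simp add: contr_add algebra_simps)
  have alg: "c p q * w + e * X + e * ep * Y + eq * (CQ + ep * CC) =
      c p q * w + e * X + e * CP + e * ep * (Y + eq * CC')"
    if "eq * CQ = e * CP" "CC = e * CC'" for w e X ep Y eq CQ CC CP CC' :: complex
    unfolding that(2) distrib_left that(1) by (simp add: mult_ac)
  show ?case
    unfolding 5 6 wick.simps(2)[of q A "contr p \<Phi>"] 1 2 epsl_simps
    by (rule alg[OF 3 4])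
next
  case Nil
  have "wick [] \<Phi> = \<Phi>" for \<Phi> by (rule ext) simp
  then show ?case by simp
qed

end

section \<open>Normal ordering\<close>

definition mode_contr ::
  "('h \<Rightarrow> 'h \<Rightarrow> complex) \<Rightarrow> complex \<Rightarrow> complex \<Rightarrow> 'h bf \<times> int \<Rightarrow> 'h bf \<times> int \<Rightarrow> complex" where
  "mode_contr form lB lF p q =
     (if snd p < 0 \<or> snd p + snd q \<noteq> 0 then 0
      else if is_fer (fst p) then lF * bf_form form (fst p) (fst q) * (if snd p = 0 then 1/2 else 1)
      else lB * bf_form form (fst p) (fst q) * of_int (snd p))"

lemma bf_form_parity: "bf_form form a b \<noteq> 0 \<Longrightarrow> is_fer a = is_fer b"
  by (cases a; cases b) auto

locale mode_contraction =
  fixes form :: "'h \<Rightarrow> 'h \<Rightarrow> complex" and lB lF :: complex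
begin

abbreviation mctr where "mctr \<equiv> mode_contr form lB lF"

sublocale contraction "\<lambda>p. is_fer (fst p)" mctr
  by standard (auto simp: mode_contr_def split: if_splits dest: bf_form_parity)

definition mode_class :: "'h bf \<times> int \<Rightarrow> nat" where
  "mode_class p = (if snd p < 0 then 0 else if 0 < snd p then 1 else 2)"

fun sort_sign :: "('h bf \<times> int) list \<Rightarrow> complex" where
  "sort_sign [] = 1"
| "sort_sign (x # l) = epsl x (filter (\<lambda>y. mode_class y < mode_class x) l) * sort_sign l"

abbreviation negm :: "('h bf \<times> int) list \<Rightarrow> ('h bf \<times> int) list" where
  "negm \<equiv> filter (\<lambda>p. snd p < 0)"
abbreviation posm :: "('h bf \<times> int) list \<Rightarrow> ('h bf \<times> int) list" where
  "posm \<equiv> filter (\<lambda>p. 0 < snd p)"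
abbreviation zerm :: "('h bf \<times> int) list \<Rightarrow> ('h bf \<times> int) list" where
  "zerm \<equiv> filter (\<lambda>p. snd p = 0)"

definition sorted_fun where
  "sorted_fun \<Psi> l = sort_sign l * \<Psi> (negm l) (posm l) (zerm l)"

lemma mode_class_filter:
  "snd x < 0 \<Longrightarrow> filter (\<lambda>y. mode_class y < mode_class x) l = []"
  "0 < snd x \<Longrightarrow> filter (\<lambda>y. mode_class y < mode_class x) l = negm l"
  "snd x = 0 \<Longrightarrow> epsl q (filter (\<lambda>y. mode_class y < mode_class x) l) = epsl q (negm l) * epsl q (posm l)"
  by (induction l) (auto simp: mode_class_def split: if_splits)

lemma sorted_fun_Cons:
  "snd x < 0 \<Longrightarrow> sorted_fun \<Psi> (x # l) = sorted_fun (\<lambda>N P Z. \<Psi> (x # N) P Z) l"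
  "0 < snd x \<Longrightarrow> sorted_fun \<Psi> (x # l) = sorted_fun (\<lambda>N P Z. epsl x N * \<Psi> N (x # P) Z) l"
  "snd x = 0 \<Longrightarrow>
     sorted_fun \<Psi> (x # l) = sorted_fun (\<lambda>N P Z. epsl x N * epsl x P * \<Psi> N P (x # Z)) l"
  by (auto simp: sorted_fun_def mode_class_filter)

lemma mctr_neg: "snd p < 0 \<Longrightarrow> mctr p q = 0"
  by (simp add: mode_contr_def)

lemma contr_sorted_fun_zero:
  assumes p: "snd p = 0"
  shows "contr p (sorted_fun \<Psi>) l =
    epsl p (negm l) * epsl p (posm l) * sorted_fun (\<lambda>N P Z. contr p (\<Psi> N P) Z) l"
proof (induction l arbitrary: \<Psi>)
  case (Cons x l)
  consider "snd x < 0" | "0 < snd x" | "snd x = 0" by linarith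
  then show ?case
  proof cases
    case 1
    then have "mctr p x = 0" using p by (simp add: mode_contr_def)
    with 1 show ?thesis by (simp add: sorted_fun_Cons Cons.IH)
  next
    case 2
    then have "mctr p x = 0" using p by (simp add: mode_contr_def)
    with 2 show ?thesis by (simp add: sorted_fun_Cons Cons.IH contr_scale)
  next
    case 3
    have *: "mctr p x = mctr p x * epsl p N * epsl x N" for N
      using c_parity[of p x] epsl_cong[of p x N] by (cases "mctr p x = 0") (auto simp: mult.assoc)
    have **: "mctr p x * u = epsl p N * epsl p P * (epsl x N * (epsl x P * (mctr p x * u)))" for N P u
      using *[of N] *[of P] by (smt (verit) mult.assoc mult.commute)
    show ?thesis using 3
      apply (simp add: sorted_fun_Cons Cons.IH contr_scale)
      apply (simp add: sorted_fun_def)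
      apply (subst **[of _ "negm l" "posm l"])
      apply (simp add: algebra_simps)
      done
  qed
qed (auto simp: sorted_fun_def)

lemma contr_sorted_fun_pos:
  assumes p: "0 < snd p"
  shows "contr p (sorted_fun \<Psi>) l = sorted_fun (\<lambda>N P Z. contr p (\<lambda>N. \<Psi> N P Z) N) l"
proof (induction l arbitrary: \<Psi>)
  case (Cons x l)
  have *: "eps p x * contr p (\<lambda>N. epsl x N * \<Phi> N) N = epsl x N * contr p \<Phi> N" for \<Phi> N
    using contr_epsl[of p x \<Phi> N] by simp
  consider "snd x < 0" | "0 < snd x" | "snd x = 0" by linarith
  then show ?case
  proof cases
    case 1
    then show ?thesis by (simp add: sorted_fun_Cons Cons.IH) (simp add: sorted_fun_def algebra_simps)
  next
    case 2
    then have "mctr p x = 0" using p by (simp add: mode_contr_def)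
    with 2 show ?thesis using *[of "\<lambda>N. \<Psi> N (x # posm l) (zerm l)" "negm l"]
      by (simp add: sorted_fun_Cons Cons.IH) (simp add: sorted_fun_def)
  next
    case 3
    then have "mctr p x = 0" using p by (simp add: mode_contr_def)
    with 3 show ?thesis 
      using *[of "\<lambda>N. epsl x (posm l) * \<Psi> N (posm l) (x # zerm l)" "negm l"]
      by (simp add: sorted_fun_Cons Cons.IH contr_scale mult.assoc) (simp add: sorted_fun_def contr_scale)
  qed
qed (auto simp: sorted_fun_def)

lemma contr_cong_length:
  "(\<And>l'. length l' < length l \<Longrightarrow> \<Phi> l' = \<Psi> l') \<Longrightarrow> contr p \<Phi> l = contr p \<Psi> l"
proof (induction l arbitrary: \<Phi> \<Psi>)
  case (Cons x l)
  have "contr p (\<lambda>l. \<Phi> (x # l)) l = contr p (\<lambda>l. \<Psi> (x # l)) l"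
    by (rule Cons.IH) (simp add: Cons.prems)
  with Cons.prems show ?case by simp
qed simp

lemma contr_explicit:
  "contr p \<Phi> l = (\<Sum>i<length l. epsl p (take i l) * mctr p (l ! i) * \<Phi> (delete_nth i l))"
proof (induction l arbitrary: \<Phi>)
  case (Cons x l)
  show ?case
    unfolding contr.simps(2) Cons.IH length_Cons sum.lessThan_Suc_shift
    by (simp add: delete_nth_def sum_distrib_left mult.assoc)
qed simp

end

lemma mode_sort_upt_Suc:
  obtains k where
    "mode_sort f [0..<Suc n] = take k (map Suc (mode_sort (f \<circ> Suc) [0..<n])) @ 0 #
        drop k (map Suc (mode_sort (f \<circ> Suc) [0..<n]))"
    "k = (if f 0 < 0 then 0 else if 0 < f 0 then length (filter (\<lambda>j. f (Suc j) < 0) [0..<n])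
          else length (filter (\<lambda>j. f (Suc j) \<noteq> 0) [0..<n]))"
proof
  let ?k = "if f 0 < 0 then 0 else if 0 < f 0 then length (filter (\<lambda>j. f (Suc j) < 0) [0..<n])
          else length (filter (\<lambda>j. f (Suc j) \<noteq> 0) [0..<n])"
  have *: "[0..<Suc n] = 0 # map Suc [0..<n]"
    by (metis map_Suc_upt upt_conv_Cons zero_less_Suc)
  have **: "length (filter (\<lambda>j. f (Suc j) \<noteq> 0) xs) =
      length (filter (\<lambda>j. f (Suc j) < 0) xs) + length (filter (\<lambda>j. 0 < f (Suc j)) xs)" for xs
    by (induction xs) auto
  show "mode_sort f [0..<Suc n] = take ?k (map Suc (mode_sort (f \<circ> Suc) [0..<n])) @ 0 #
        drop ?k (map Suc (mode_sort (f \<circ> Suc) [0..<n]))"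
    unfolding * mode_sort_def by (simp add: filter_map o_def **)
qed simp

definition sort_perm :: "(nat \<Rightarrow> int) \<Rightarrow> nat \<Rightarrow> nat \<Rightarrow> nat" where
  "sort_perm f n j = (if j < n then mode_sort f [0..<n] ! j else j)"

lemma length_mode_sort [simp]: "length (mode_sort f l) = length l"
  by (induction l) (auto simp: mode_sort_def)

lemma sort_perm_Suc:
  obtains k where "sort_perm f (Suc n) = permutation_insert k 0 (sort_perm (f \<circ> Suc) n)" "k < Suc n"
    "k = (if f 0 < 0 then 0 else if 0 < f 0 then length (filter (\<lambda>j. f (Suc j) < 0) [0..<n])
          else length (filter (\<lambda>j. f (Suc j) \<noteq> 0) [0..<n]))"
proof -
  obtain k where k: "mode_sort f [0..<Suc n] = take k (map Suc (mode_sort (f \<circ> Suc) [0..<n])) @ 0 #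
        drop k (map Suc (mode_sort (f \<circ> Suc) [0..<n]))"
    "k = (if f 0 < 0 then 0 else if 0 < f 0 then length (filter (\<lambda>j. f (Suc j) < 0) [0..<n])
          else length (filter (\<lambda>j. f (Suc j) \<noteq> 0) [0..<n]))"
    by (rule mode_sort_upt_Suc)
  have kn: "k \<le> n"
    unfolding k(2) using length_filter_le[of _ "[0..<n]"] by auto
  have "sort_perm f (Suc n) j = permutation_insert k 0 (sort_perm (f \<circ> Suc) n) j" for j
    unfolding sort_perm_def permutation_insert_expand k(1) using kn
    by (auto simp: nth_append nth_Cons' not_less min_def)
  with kn k(2) show ?thesis by (intro that[of k]) auto
qed

lemma sort_perm_permutes: "sort_perm f n permutes {0..<n}"
proof (induction n arbitrary: f)
  case 0
  show ?case by (simp add: sort_perm_def fun_eq_iff)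
next
  case (Suc n)
  obtain k where "sort_perm f (Suc n) = permutation_insert k 0 (sort_perm (f \<circ> Suc) n)" "k < Suc n"
    by (rule sort_perm_Suc)
  with Suc permutation_insert_permutes show ?case by simp
qed

lemma fer_sign_sort_perm:
  "fer_sign l = sign (sort_perm (\<lambda>j. snd (filter (\<lambda>p. is_fer (fst p)) l ! j)) (count_fer (map fst l)))"
proof -
  have "count_fer (map fst l) = length (filter (\<lambda>p. is_fer (fst p)) l)"
    by (induction l) (auto simp: count_fer_def)
  then show ?thesis
    by (simp add: fer_sign_def Let_def sort_perm_def[abs_def])
qed

context mode_contraction
begin

lemma epsl_fer: "is_fer (fst p) \<Longrightarrow> epsl p l = (-1) ^ length (filter (\<lambda>p. is_fer (fst p)) l)"
  by (induction l) (auto simp: eps_def)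

lemma length_filter_nth: "length (filter (\<lambda>j. P (xs ! j)) [0..<length xs]) = length (filter P xs)"
  by (metis (no_types, lifting) length_map map_nth filter_map comp_apply filter_cong)

lemma fer_sign_eq: "of_int (fer_sign l) = sort_sign l"
proof (induction l)
  case Nil
  show ?case by (simp add: fer_sign_sort_perm sort_perm_def[abs_def] count_fer_def)
next
  case (Cons x l)
  show ?case
  proof (cases "is_fer (fst x)")
    case False
    then have "fer_sign (x # l) = fer_sign l"
      by (simp add: fer_sign_def)
    with False Cons show ?thesis by simp
  next
    case True
    define l' where "l' = filter (\<lambda>p. is_fer (fst p)) l"
    define f where "f = (\<lambda>j. snd ((x # l') ! j))"
    have n: "count_fer (map fst l) = length l'"
      unfolding l'_def by (induction l) (auto simp: count_fer_def)
    have f: "f \<circ> Suc = (\<lambda>j. snd (l' ! j))" by (auto simp: f_def)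
    obtain k where k: "sort_perm f (Suc (length l')) = permutation_insert k 0 (sort_perm (f \<circ> Suc) (length l'))"
      "k < Suc (length l')"
      "k = (if f 0 < 0 then 0 else if 0 < f 0 then length (filter (\<lambda>j. f (Suc j) < 0) [0..<length l'])
          else length (filter (\<lambda>j. f (Suc j) \<noteq> 0) [0..<length l']))"
      by (rule sort_perm_Suc)
    have k': "k = length (filter (\<lambda>y. mode_class y < mode_class x) l')"
      unfolding k(3) f_def
      using length_filter_nth[of "\<lambda>y. snd y < 0" l'] length_filter_nth[of "\<lambda>y. snd y \<noteq> 0" l']
      by (auto simp: mode_class_def intro!: arg_cong[of _ _ length] filter_cong split: if_splits)
    have "fer_sign (x # l) = sign (sort_perm f (Suc (length l')))"
      unfolding fer_sign_sort_perm using True n by (simp add: f_def l'_def count_fer_def)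
    also have "of_int \<dots> = ((-1) ^ (k + 0) * of_int (sign (sort_perm (f \<circ> Suc) (length l'))) :: complex)"
      unfolding k(1) by (rule signof_permutation_insert[OF sort_perm_permutes]) (use k(2) in auto)
    also have "sign (sort_perm (f \<circ> Suc) (length l')) = fer_sign l"
      unfolding fer_sign_sort_perm n f l'_def ..
    also have "(-1) ^ (k + 0) = epsl x (filter (\<lambda>y. mode_class y < mode_class x) l)"
      unfolding k' epsl_fer[OF True] l'_def
      by (simp add: conj_commute)
    finally show ?thesis using Cons.IH by simp
  qed
qed

end

section \<open>Linear functionals on a complex vector space\<close>

locale complex_space = abelian_group W for W :: "(complex, 'w) module" (structure) +
  assumes smult_closed [simp, intro]: "u \<in> carrier W \<Longrightarrow> z \<odot> u \<in> carrier W"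
    and smult_add: "u \<in> carrier W \<Longrightarrow> v \<in> carrier W \<Longrightarrow> z \<odot> (u \<oplus> v) = z \<odot> u \<oplus> z \<odot> v"
    and smult_scalar_add: "u \<in> carrier W \<Longrightarrow> (z + z') \<odot> u = z \<odot> u \<oplus> z' \<odot> u"
    and smult_smult: "u \<in> carrier W \<Longrightarrow> z \<odot> (z' \<odot> u) = (z * z') \<odot> u"
    and smult_1: "u \<in> carrier W \<Longrightarrow> 1 \<odot> u = u"
begin

definition functional :: "('w \<Rightarrow> complex) \<Rightarrow> bool" where
  "functional \<phi> \<longleftrightarrow> (\<forall>u\<in>carrier W. \<forall>v\<in>carrier W. \<phi> (u \<oplus> v) = \<phi> u + \<phi> v) \<and>
     (\<forall>u\<in>carrier W. \<forall>z. \<phi> (z \<odot> u) = z * \<phi> u)"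

lemma functional_add:
  "functional \<phi> \<Longrightarrow> u \<in> carrier W \<Longrightarrow> v \<in> carrier W \<Longrightarrow> \<phi> (u \<oplus> v) = \<phi> u + \<phi> v"
  by (simp add: functional_def)

lemma functional_smult: "functional \<phi> \<Longrightarrow> u \<in> carrier W \<Longrightarrow> \<phi> (z \<odot> u) = z * \<phi> u"
  by (simp add: functional_def)

lemma smult_0: "u \<in> carrier W \<Longrightarrow> 0 \<odot> u = \<zero>"
  using smult_scalar_add[of u 0 0] smult_closed[of u 0] by (metis add.r_cancel_one' add_0)

lemma functional_zero: "functional \<phi> \<Longrightarrow> \<phi> \<zero> = 0"
  using functional_smult[of \<phi> \<zero> 0] smult_0[of \<zero>] by simp

lemma functional_finsum:
  assumes "functional \<phi>" "\<And>i. i \<in> I \<Longrightarrow> f i \<in> carrier W"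
  shows "\<phi> (\<Oplus>i\<in>I. f i) = (\<Sum>i\<in>I. \<phi> (f i))"
  using assms(2)
proof (induction I rule: infinite_finite_induct)
  case (insert x I)
  then have "\<phi> (\<Oplus>i\<in>insert x I. f i) = \<phi> (f x \<oplus> (\<Oplus>i\<in>I. f i))"
    by (subst finsum_insert) auto
  with insert show ?case
    using functional_add[OF assms(1)] by (simp add: finsum_closed Pi_def)
qed (auto simp: functional_zero[OF assms(1)])

definition eval_comb :: "('w \<Rightarrow>\<^sub>0 complex) \<Rightarrow> 'w" where
  "eval_comb f = (\<Oplus>w\<in>Poly_Mapping.keys f \<inter> carrier W. Poly_Mapping.lookup f w \<odot> w)"

lemma eval_comb_superset:
  assumes "finite A" "Poly_Mapping.keys f \<subseteq> A"
  shows "eval_comb f = (\<Oplus>w\<in>A \<inter> carrier W. Poly_Mapping.lookup f w \<odot> w)"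
  unfolding eval_comb_def
  by (rule add.finprod_mono_neutral_cong_left) (use assms in \<open>auto simp: smult_0 in_keys_iff\<close>)

lemma eval_comb_closed [simp]: "eval_comb f \<in> carrier W"
  unfolding eval_comb_def by (rule finsum_closed) auto

lemma eval_comb_add: "eval_comb (f + g) = eval_comb f \<oplus> eval_comb g"
proof -
  let ?A = "Poly_Mapping.keys f \<union> Poly_Mapping.keys g"
  have *: "finite ?A" "Poly_Mapping.keys f \<subseteq> ?A" "Poly_Mapping.keys g \<subseteq> ?A"
    "Poly_Mapping.keys (f + g) \<subseteq> ?A"
    using Poly_Mapping.keys_add[of f g] by auto
  show ?thesis
    unfolding eval_comb_superset[OF *(1,2)] eval_comb_superset[OF *(1,3)]
      eval_comb_superset[OF *(1,4)] lookup_add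
    by (subst finsum_addf[symmetric], blast, blast, rule finsum_cong') (auto simp: smult_scalar_add)
qed

lemma finsum_smult:
  assumes "\<And>i. i \<in> I \<Longrightarrow> f i \<in> carrier W" "finite I"
  shows "z \<odot> (\<Oplus>i\<in>I. f i) = (\<Oplus>i\<in>I. z \<odot> f i)"
  using assms(2,1)
proof (induction I rule: finite_induct)
  case empty
  have "z \<odot> \<zero> = z \<odot> (0 \<odot> \<zero>)" by (simp add: smult_0)
  also have "\<dots> = \<zero>" by (subst smult_smult) (auto simp: smult_0)
  finally show ?case by simp
next
  case (insert x F)
  then show ?case by (subst (1 2) finsum_insert) (auto simp: smult_add finsum_closed Pi_def)
qed

lemma eval_comb_scale: "eval_comb (Poly_Mapping.map ((*) z) f) = z \<odot> eval_comb f"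
proof -
  have *: "Poly_Mapping.keys (Poly_Mapping.map ((*) z) f) \<subseteq> Poly_Mapping.keys f"
    by (auto simp: in_keys_iff map.rep_eq when_def)
  have "eval_comb (Poly_Mapping.map ((*) z) f) =
      (\<Oplus>w\<in>Poly_Mapping.keys f \<inter> carrier W. z \<odot> (Poly_Mapping.lookup f w \<odot> w))"
    unfolding eval_comb_superset[OF finite_keys *]
    by (rule finsum_cong') (auto simp: map.rep_eq when_def smult_smult in_keys_iff)
  also have "\<dots> = z \<odot> eval_comb f"
    unfolding eval_comb_def by (rule finsum_smult[symmetric]) auto
  finally show ?thesis .
qed

lemma eval_comb_single: "w \<in> carrier W \<Longrightarrow> eval_comb (Poly_Mapping.single w z) = z \<odot> w"
  by (auto simp: eval_comb_def smult_0)

lemma functional_separates: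
  assumes "u \<in> carrier W" "v \<in> carrier W" "\<And>\<phi>. functional \<phi> \<Longrightarrow> \<phi> u = \<phi> v"
  shows "u = v"
proof (rule ccontr)
  assume "u \<noteq> v"
  define w where "w = u \<ominus> v"
  have "u = w \<oplus> v"
    using assms(1,2) by (simp add: w_def a_minus_def a_assoc l_neg)
  then have w: "w \<in> carrier W" "w \<noteq> \<zero>"
    using assms(1,2) \<open>u \<noteq> v\<close> by (auto simp: w_def)
  let ?sc = "\<lambda>(z::complex) (f::'w \<Rightarrow>\<^sub>0 complex). Poly_Mapping.map ((*) z) f"
  have lookup_sc: "Poly_Mapping.lookup (?sc z f) x = z * Poly_Mapping.lookup f x" for z f x
    by (auto simp: map.rep_eq when_def)
  interpret X: vector_space ?sc
    by standard (auto intro!: poly_mapping_eqI simp: lookup_sc lookup_add algebra_simps)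
  interpret P: vector_space_pair ?sc "(*)"
    by standard (auto simp: algebra_simps)
  define K where "K = {f. eval_comb f = \<zero>}"
  have K: "X.subspace K"
    unfolding X.subspace_def K_def
  proof (safe)
    show "eval_comb 0 = \<zero>" by (simp add: eval_comb_def)
    show "eval_comb (f + g) = \<zero>" if "eval_comb f = \<zero>" "eval_comb g = \<zero>" for f g
      using that by (simp add: eval_comb_add)
    show "eval_comb (?sc z f) = \<zero>" if "eval_comb f = \<zero>" for z f
      using that finsum_smult[of "{}" "\<lambda>i. i" z] by (simp add: eval_comb_scale)
  qed
  obtain B where B: "B \<subseteq> K" "X.independent B" "K \<subseteq> X.span B"
    using X.maximal_independent_subset[of K] by blast
  have KB: "K = X.span B"
    using B K X.span_minimal by blast
  let ?x = "Poly_Mapping.single w (1::complex)"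
  have "?x \<notin> X.span B"
    unfolding KB[symmetric] K_def using w by (simp add: eval_comb_single smult_1)
  then have ind: "X.independent (insert ?x B)"
    using B(2) X.independent_insertI by blast
  obtain g where g: "Vector_Spaces.linear ?sc (*) g" "\<forall>f\<in>insert ?x B. g f = (if f = ?x then 1 else 0)"
    using P.linear_independent_extend[OF ind, of "\<lambda>f. if f = ?x then 1 else 0"] by blast
  interpret g: Vector_Spaces.linear ?sc "(*)" g by (fact g(1))
  have gK: "g f = 0" if "f \<in> K" for f
  proof -
    have "?x \<notin> B" using \<open>?x \<notin> X.span B\<close> X.span_base by blast
    then have "\<And>f. f \<in> B \<Longrightarrow> g f = 0" using g(2) by auto
    then show ?thesis
      using P.linear_eq_0_on_span[OF g(1)] that KB by blast
  qed
  define \<phi> where "\<phi> = (\<lambda>w. g (Poly_Mapping.single w 1))"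
  have "functional \<phi>"
    unfolding functional_def
  proof (safe)
    fix x y assume xy: "x \<in> carrier W" "y \<in> carrier W"
    have "Poly_Mapping.single (x \<oplus> y) 1 +
        (?sc (-1) (Poly_Mapping.single x 1) + ?sc (-1) (Poly_Mapping.single y 1)) \<in> K"
      using xy smult_scalar_add[of "x \<oplus> y" 1 "-1"]
      unfolding K_def mem_Collect_eq eval_comb_add eval_comb_scale
      by (simp add: eval_comb_single smult_1 smult_0 smult_add[symmetric])
    moreover have "s = t + u" if "s + (-1 * t + -1 * u) = 0" for s t u :: complex
    proof -
      have "s = (s + (-1 * t + -1 * u)) + (t + u)" by simp
      with that show ?thesis by simp
    qed
    ultimately show "\<phi> (x \<oplus> y) = \<phi> x + \<phi> y"
      using gK unfolding \<phi>_def by (metis g.add g.scale)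
  next
    fix x z assume x: "x \<in> carrier W"
    have "Poly_Mapping.single (z \<odot> x) 1 + ?sc (- z) (Poly_Mapping.single x 1) \<in> K"
      using x smult_scalar_add[of x z "- z"]
      unfolding K_def mem_Collect_eq eval_comb_add eval_comb_scale
      by (simp add: eval_comb_single smult_1 smult_0)
    from gK[OF this] show "\<phi> (z \<odot> x) = z * \<phi> x"
      unfolding \<phi>_def g.add g.scale by simp
  qed
  then have "\<phi> u = \<phi> v" by (rule assms(3))
  with \<open>u = w \<oplus> v\<close> have "\<phi> w = 0"
    using functional_add[OF \<open>functional \<phi>\<close> w(1) assms(2)] by simp
  moreover have "\<phi> w = 1" using g(2) by (simp add: \<phi>_def)
  ultimately show False by simp
qed

end

section \<open>The Wick theorem for modes\<close>

locale mode_space = complex_space W + mode_contraction form lB lF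
  for W :: "(complex, 'w) module" (structure)
    and form :: "'h \<Rightarrow> 'h \<Rightarrow> complex" and lB lF :: complex +
  fixes md :: "'h bf \<Rightarrow> int \<Rightarrow> 'w \<Rightarrow> 'w"
  assumes md_closed [simp, intro]: "u \<in> carrier W \<Longrightarrow> md a n u \<in> carrier W"
    and md_add: "u \<in> carrier W \<Longrightarrow> v \<in> carrier W \<Longrightarrow> md a n (u \<oplus> v) = md a n u \<oplus> md a n v"
    and md_smult: "u \<in> carrier W \<Longrightarrow> md a n (z \<odot> u) = z \<odot> md a n u"
    and md_exchange: "u \<in> carrier W \<Longrightarrow> 0 \<le> n \<Longrightarrow> m < 0 \<or> (n = 0 \<and> m \<noteq> 0) \<Longrightarrow>
      md a n (md b m u) = eps (a, n) (b, m) \<odot> md b m (md a n u) \<oplus> mctr (a, n) (b, m) \<odot> u"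
begin

abbreviation ops :: "('h bf \<times> int) list \<Rightarrow> 'w \<Rightarrow> 'w" where
  "ops \<equiv> foldr (\<lambda>(a, n). md a n)"

abbreviation nz :: "'h bf list \<Rightarrow> 'w \<Rightarrow> 'w" where
  "nz \<equiv> no_zero W md form lF"

abbreviation nord :: "('h bf \<times> int) list \<Rightarrow> 'w \<Rightarrow> 'w" where
  "nord \<equiv> normal_order W md form lF"

lemma functional_md: "functional \<phi> \<Longrightarrow> functional (\<lambda>u. \<phi> (md a n u))"
  by (simp add: functional_def md_add md_smult)

lemma ops_closed [simp, intro]: "u \<in> carrier W \<Longrightarrow> ops l u \<in> carrier W"
  by (induction l) auto

lemma functional_ops: "functional \<phi> \<Longrightarrow> functional (\<lambda>u. \<phi> (ops l u))"
proof (induction l arbitrary: \<phi>)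
  case (Cons p l)
  from Cons.IH[OF functional_md[OF Cons.prems, of "fst p" "snd p"]]
  show ?case by (simp add: case_prod_beta)
qed simp

lemma foldr_add_closed:
  "set l \<subseteq> carrier W \<Longrightarrow> u \<in> carrier W \<Longrightarrow> foldr (\<oplus>) l u \<in> carrier W"
  by (induction l) auto

lemma functional_foldr_add:
  "functional \<phi> \<Longrightarrow> set l \<subseteq> carrier W \<Longrightarrow> u \<in> carrier W \<Longrightarrow>
    \<phi> (foldr (\<oplus>) l u) = (\<Sum>x\<leftarrow>l. \<phi> x) + \<phi> u"
  by (induction l) (auto simp: functional_add foldr_add_closed)

lemma nz_closed [simp, intro]: "u \<in> carrier W \<Longrightarrow> nz l u \<in> carrier W"
proof (induction l rule: length_induct)
  case (1 l)
  show ?case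
  proof (cases l)
    case (Cons a l')
    with 1 have "nz l' u \<in> carrier W" by auto
    moreover have "\<And>i. i < length l' \<Longrightarrow> nz (delete_nth i l') u \<in> carrier W"
      using 1 Cons by auto
    ultimately show ?thesis using Cons by (auto intro!: foldr_add_closed)
  qed (use 1 in auto)
qed

lemma nord_closed [simp, intro]: "u \<in> carrier W \<Longrightarrow> nord l u \<in> carrier W"
  by (auto simp: normal_order_def)

lemma md_zero_nz:
  assumes \<phi>: "functional \<phi>" and u: "u \<in> carrier W" and l: "\<And>p. p \<in> set l \<Longrightarrow> snd p = 0"
  shows "\<phi> (md a 0 (nz (map fst l) u)) =
    \<phi> (nz (a # map fst l) u) + contr (a, 0) (\<lambda>l. \<phi> (nz (map fst l) u)) l"
proof (cases "is_fer a")
  case False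
  have "contr (a, 0) (\<lambda>l. \<phi> (nz (map fst l) u)) l = 0"
    by (rule contr_no_partner) (use False in \<open>auto simp: mode_contr_def\<close>)
  with False show ?thesis by simp
next
  case True
  let ?l = "map fst l"
  let ?c = "\<lambda>i. (- 1) ^ (count_fer (a # take (Suc i) ?l) - 1) / 2 * lF * bf_form form a (?l ! i)"
  let ?d = "\<lambda>i. epsl (a, 0) (take i l) * mctr (a, 0) (l ! i) * \<phi> (nz (delete_nth i ?l) u)"
  have cf: "count_fer (map fst l) = length (filter (\<lambda>p. is_fer (fst p)) l)" for l :: "('h bf \<times> int) list"
    by (simp add: count_fer_def filter_map o_def)
  have c: "?c i * \<phi> (nz (delete_nth i ?l) u) = - ?d i"
    if "i < length l" "is_fer (?l ! i)" for i
  proof -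
    have "count_fer (a # take (Suc i) ?l) = Suc (Suc (count_fer (take i ?l)))"
      using True that by (simp add: count_fer_def take_Suc_conv_app_nth)
    moreover have "epsl (a, 0) (take i l) = (-1) ^ count_fer (take i ?l)"
      using True by (simp add: epsl_fer cf[symmetric] take_map)
    moreover have "mctr (a, 0) (l ! i) = lF * bf_form form a (?l ! i) / 2"
      using True that l[of "l ! i"] by (simp add: mode_contr_def)
    ultimately show ?thesis by simp
  qed
  have c0: "?d i = 0" if "i < length l" "\<not> is_fer (?l ! i)" for i
    using that True c_parity[of "(a, 0)" "l ! i"] by auto
  have "\<phi> (nz (a # ?l) u) =
      (\<Sum>i\<leftarrow>filter (\<lambda>i. is_fer (?l ! i)) [0..<length l]. \<phi> (?c i \<odot> nz (delete_nth i ?l) u))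
      + \<phi> (md a 0 (nz ?l u))"
    using True u by (simp add: functional_foldr_add[OF \<phi>] image_subset_iff o_def)
  also have "(\<Sum>i\<leftarrow>filter (\<lambda>i. is_fer (?l ! i)) [0..<length l]. \<phi> (?c i \<odot> nz (delete_nth i ?l) u)) =
      (\<Sum>i\<leftarrow>[0..<length l]. if is_fer (?l ! i) then - ?d i else 0)"
    using u c by (subst sum_list_map_filter'[symmetric]) (auto intro!: arg_cong[of _ _ sum_list] simp: functional_smult[OF \<phi>])
  also have "\<dots> = (\<Sum>i<length l. - ?d i)"
    unfolding interv_sum_list_conv_sum_set_nat
    by (rule sum.cong) (use c0 in auto)
  also have "\<dots> = - contr (a, 0) (\<lambda>l. \<phi> (nz (map fst l) u)) l"
    unfolding contr_explicit sum_negf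
    by (auto intro!: sum.cong simp: delete_nth_def take_map drop_map)
  finally show ?thesis by simp
qed

lemma md_zero_ops:
  assumes "functional \<phi>" "u \<in> carrier W" "\<And>p. p \<in> set X \<Longrightarrow> snd p \<noteq> 0"
  shows "\<phi> (md a 0 (ops X u)) = epsl (a, 0) X * \<phi> (ops X (md a 0 u))"
  using assms
proof (induction X arbitrary: \<phi>)
  case (Cons p X)
  obtain b m where p: "p = (b, m)" "m \<noteq> 0" using Cons.prems(3)[of p] by (cases p) auto
  have 0: "mctr (a, 0) p = 0" using p by (simp add: mode_contr_def)
  have "\<phi> (md a 0 (ops (p # X) u)) = eps (a, 0) p * \<phi> (md b m (md a 0 (ops X u)))"
    using p 0 Cons.prems(1,2)
    by (simp add: md_exchange functional_add functional_smult)
  also have "\<phi> (md b m (md a 0 (ops X u))) = epsl (a, 0) X * \<phi> (md b m (ops X (md a 0 u)))"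
    by (rule Cons.IH) (use Cons.prems functional_md in auto)
  finally show ?case using p by simp
qed simp

lemma md_pos_ops:
  assumes "functional \<phi>" "u \<in> carrier W" "\<And>p. p \<in> set N \<Longrightarrow> snd p < 0" "0 < n"
  shows "\<phi> (md a n (ops N u)) =
    epsl (a, n) N * \<phi> (ops N (md a n u)) + contr (a, n) (\<lambda>N. \<phi> (ops N u)) N"
  using assms
proof (induction N arbitrary: \<phi>)
  case (Cons p N)
  obtain b m where p: "p = (b, m)" "m < 0" using Cons.prems(3)[of p] by (cases p) auto
  have "\<phi> (md a n (ops (p # N) u)) = eps (a, n) p * \<phi> (md b m (md a n (ops N u)))
      + mctr (a, n) p * \<phi> (ops N u)"
    using p Cons.prems
    by (simp add: md_exchange functional_add functional_smult)
  also have "\<phi> (md b m (md a n (ops N u))) = epsl (a, n) N * \<phi> (md b m (ops N (md a n u)))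
      + contr (a, n) (\<lambda>N. \<phi> (md b m (ops N u))) N"
    by (rule Cons.IH) (use Cons.prems functional_md in auto)
  finally show ?case using p by (simp add: algebra_simps)
qed simp

lemma nord_sorted_fun:
  assumes "functional \<phi>" "u \<in> carrier W"
  shows "\<phi> (nord l u) = sorted_fun (\<lambda>N P Z. \<phi> (ops N (ops P (nz (map fst Z) u)))) l"
  using assms by (simp add: normal_order_def sorted_fun_def functional_smult fer_sign_eq)

lemma md_nord:
  assumes \<phi>: "functional \<phi>" and u: "u \<in> carrier W"
  shows "\<phi> (md a n (nord l u)) = \<phi> (nord ((a, n) # l) u) + contr (a, n) (\<lambda>l. \<phi> (nord l u)) l"
proof -
  let ?\<Psi> = "\<lambda>\<phi> N P Z. \<phi> (ops N (ops P (nz (map fst Z) u)))"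
  let ?p = "(a, n)"
  note md = nord_sorted_fun[OF functional_md[OF \<phi>] u, of a n l]
  have contr: "contr ?p (\<lambda>l. \<phi> (nord l u)) l = contr ?p (sorted_fun (?\<Psi> \<phi>)) l"
    by (rule contr_cong) (rule nord_sorted_fun[OF \<phi> u])
  consider "n < 0" | "0 < n" | "n = 0" by linarith
  then show ?thesis
  proof cases
    case 1
    then show ?thesis
      unfolding md nord_sorted_fun[OF \<phi> u]
      by (simp add: sorted_fun_Cons contr_no_partner mctr_neg)
  next
    case 2
    have "\<phi> (md a n (ops (negm l) v)) = epsl ?p (negm l) * \<phi> (ops (negm l) (md a n v))
        + contr ?p (\<lambda>N. \<phi> (ops N v)) (negm l)" if "v \<in> carrier W" for v
      by (rule md_pos_ops) (use \<phi> that 2 in auto)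
    with 2 u show ?thesis
      unfolding contr unfolding md nord_sorted_fun[OF \<phi> u]
      by (simp add: sorted_fun_Cons contr_sorted_fun_pos) (simp add: sorted_fun_def algebra_simps)
  next
    case 3
    have 1: "\<phi> (md a 0 (ops (negm l) (ops (posm l) v))) = epsl (a, 0) (negm l) * epsl (a, 0) (posm l) *
        \<phi> (ops (negm l) (ops (posm l) (md a 0 v)))" if "v \<in> carrier W" for v
    proof -
      have "snd p \<noteq> 0" if "p \<in> set (negm l @ posm l)" for p
        using that by auto
      from md_zero_ops[OF \<phi> that, where X = "negm l @ posm l", OF this] show ?thesis by simp
    qed
    have 2: "\<phi> (ops (negm l) (ops (posm l) (md a 0 (nz (map fst (zerm l)) u)))) =
       \<phi> (ops (negm l) (ops (posm l) (nz (a # map fst (zerm l)) u))) +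
       contr (a, 0) (\<lambda>l'. \<phi> (ops (negm l) (ops (posm l) (nz (map fst l') u)))) (zerm l)"
      by (rule md_zero_nz[of "\<lambda>v. \<phi> (ops (negm l) (ops (posm l) v))"])
        (use functional_ops[OF functional_ops[OF \<phi>]] u in auto)
    from 3 u show ?thesis
      unfolding contr unfolding md nord_sorted_fun[OF \<phi> u]
      by (simp add: sorted_fun_Cons contr_sorted_fun_zero del: no_zero.simps)
        (simp add: sorted_fun_def 1 2 algebra_simps del: no_zero.simps)
  qed
qed

lemma nord_mult:
  assumes "functional \<phi>" "u \<in> carrier W"
  shows "\<phi> (nord A (nord B u)) = wick A (\<lambda>l. \<phi> (nord l u)) B"
  using assms(1)
proof (induction A arbitrary: \<phi> rule: length_induct)
  case (1 A)
  show ?case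
  proof (cases A)
    case Nil
    have "nord [] v = v" if "v \<in> carrier W" for v
      using that by (simp add: normal_order_def smult_1 fer_sign_def mode_sort_def)
    with Nil assms(2) show ?thesis by simp
  next
    case (Cons p A')
    obtain a n where p: "p = (a, n)" by (cases p)
    have IH: "\<phi> (nord C (nord B u)) = wick C (\<lambda>l. \<phi> (nord l u)) B"
      if "length C < length A" "functional \<phi>" for C \<phi>
      using 1 that by blast
    have "\<phi> (nord A (nord B u)) = \<phi> (md a n (nord A' (nord B u)))
        - contr p (\<lambda>l. \<phi> (nord l (nord B u))) A'"
      using md_nord[OF 1(2), of "nord B u" a n A'] assms(2) Cons p by simp
    also have "contr p (\<lambda>l. \<phi> (nord l (nord B u))) A' = contr p (\<lambda>l. wick l (\<lambda>l. \<phi> (nord l u)) B) A'"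
      by (rule contr_cong_length) (use IH 1(2) Cons in auto)
    also have "\<phi> (md a n (nord A' (nord B u))) = wick A' (\<lambda>l. \<phi> (md a n (nord l u))) B"
      by (rule IH) (use 1(2) functional_md Cons in auto)
    also have "\<dots> = wick A' (\<lambda>l. \<phi> (nord (p # l) u)) B + wick A' (contr p (\<lambda>l. \<phi> (nord l u))) B"
      unfolding md_nord[OF 1(2) assms(2)] p wick_add ..
    finally show ?thesis
      unfolding Cons wick_contr by simp
  qed
qed

end

section \<open>The sum over contractions in terms of permanents and determinants\<close>

lemma sum_Pow_insert:
  fixes g :: "'a set \<Rightarrow> 'b::comm_monoid_add"
  assumes "p \<notin> S" "finite S"
  shows "(\<Sum>I\<in>Pow (insert p S). g I) = (\<Sum>I\<in>Pow S. g I) + (\<Sum>I\<in>Pow S. g (insert p I))"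
proof -
  have "inj_on (insert p) (Pow S)"
    using assms(1) by (auto simp: inj_on_def)
  moreover have "Pow S \<inter> insert p ` Pow S = {}"
    using assms(1) by auto
  ultimately show ?thesis
    using assms(2) by (simp add: Pow_insert sum.union_disjoint sum.reindex)
qed

lemma sum_Pow_remove:
  fixes h :: "'a \<Rightarrow> 'a set \<Rightarrow> 'b::comm_monoid_add"
  assumes "finite T"
  shows "(\<Sum>J\<in>Pow T. \<Sum>j\<in>J. h j (J - {j})) = (\<Sum>j\<in>T. \<Sum>J\<in>Pow (T - {j}). h j J)"
proof -
  have f: "finite J" if "J \<in> Pow T" for J using assms that finite_subset by auto
  have "(\<Sum>J\<in>Pow T. \<Sum>j\<in>J. h j (J - {j})) = (\<Sum>(J, j)\<in>Sigma (Pow T) (\<lambda>J. J). h j (J - {j}))"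
    using assms f by (subst sum.Sigma) auto
  also have "\<dots> = (\<Sum>(j, J)\<in>Sigma T (\<lambda>j. Pow (T - {j})). h j J)"
    by (rule sum.reindex_bij_witness[where j = "\<lambda>(J, j). (j, J - {j})" and i = "\<lambda>(j, J). (insert j J, j)"])
      (auto simp: insert_absorb)
  also have "\<dots> = (\<Sum>j\<in>T. \<Sum>J\<in>Pow (T - {j}). h j J)"
    using assms by (subst sum.Sigma) auto
  finally show ?thesis .
qed

lemma neg_one_power_cong: "even (a + b) \<Longrightarrow> (-1 :: complex) ^ a = (-1) ^ b"
  by (cases "even a"; cases "even b") auto

locale indexed_contraction = contraction fer c
  for fer :: "'l \<Rightarrow> bool" and c :: "'l \<Rightarrow> 'l \<Rightarrow> complex" +
  fixes \<alpha> \<beta> :: "nat \<Rightarrow> 'l"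
begin

fun row_perm :: "nat list \<Rightarrow> nat set \<Rightarrow> complex" where
  "row_perm [] J = (if J = {} then 1 else 0)"
| "row_perm (i # I) J = (\<Sum>j\<in>J. c (\<alpha> i) (\<beta> j) * row_perm I (J - {j}))"

fun row_det :: "nat list \<Rightarrow> nat set \<Rightarrow> complex" where
  "row_det [] J = (if J = {} then 1 else 0)"
| "row_det (i # I) J = (\<Sum>j\<in>J. (-1) ^ card {k \<in> J. k < j} * c (\<alpha> i) (\<beta> j) * row_det I (J - {j}))"

definition bosA :: "nat set \<Rightarrow> nat set" where "bosA I = {i \<in> I. \<not> fer (\<alpha> i)}"
definition ferA :: "nat set \<Rightarrow> nat set" where "ferA I = {i \<in> I. fer (\<alpha> i)}"
definition bosB :: "nat set \<Rightarrow> nat set" where "bosB I = {i \<in> I. \<not> fer (\<beta> i)}"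
definition ferB :: "nat set \<Rightarrow> nat set" where "ferB I = {i \<in> I. fer (\<beta> i)}"

definition wick_exponent :: "nat set \<Rightarrow> nat set \<Rightarrow> nat set \<Rightarrow> nat set \<Rightarrow> nat" where
  "wick_exponent S T Ia Ja =
     (\<Sum>i\<in>Ia. card {k \<in> ferA S. k \<le> i}) + (\<Sum>j\<in>Ja. card {k \<in> ferB T. k \<le> j})
     + card (ferA S) * card Ia + card Ia * (card Ia + 1) div 2"

definition wick_weight :: "nat set \<Rightarrow> nat set \<Rightarrow> nat set \<Rightarrow> nat set \<Rightarrow> complex" where
  "wick_weight S T I J = (-1) ^ wick_exponent S T (ferA I) (ferB J)
     * row_perm (sorted_list_of_set (bosA I)) (bosB J)
     * row_det (sorted_list_of_set (ferA I)) (ferB J)"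

lemma row_det_card: "finite J \<Longrightarrow> row_det I J \<noteq> 0 \<Longrightarrow> length I = card J"
proof (induction I arbitrary: J)
  case Nil
  then have "J = {}" by (metis row_det.simps(1))
  then show ?case by simp
next
  case (Cons i I)
  from sum.not_neutral_contains_not_neutral[OF Cons.prems(2)[unfolded row_det.simps]]
  obtain j where j: "j \<in> J" "row_det I (J - {j}) \<noteq> 0"
    by (metis mult_zero_right)
  have "length I = card (J - {j})"
    by (rule Cons.IH[OF finite_Diff[OF Cons.prems(1)] j(2)])
  with card_Suc_Diff1[OF Cons.prems(1) j(1)] show ?case
    by (metis length_Cons)
qed

lemma row_perm_card: "finite J \<Longrightarrow> row_perm I J \<noteq> 0 \<Longrightarrow> length I = card J"
proof (induction I arbitrary: J)
  case Nil
  then have "J = {}" by (metis row_perm.simps(1))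
  then show ?case by simp
next
  case (Cons i I)
  from sum.not_neutral_contains_not_neutral[OF Cons.prems(2)[unfolded row_perm.simps]]
  obtain j where j: "j \<in> J" "row_perm I (J - {j}) \<noteq> 0"
    by (metis mult_zero_right)
  have "length I = card (J - {j})"
    by (rule Cons.IH[OF finite_Diff[OF Cons.prems(1)] j(2)])
  with card_Suc_Diff1[OF Cons.prems(1) j(1)] show ?case
    by (metis length_Cons)
qed

lemma contr_sorted:
  "sorted_wrt (<) l \<Longrightarrow> contr p \<Psi> (map \<beta> l) =
    (\<Sum>j\<in>set l. epsl p (map \<beta> (filter (\<lambda>k. k < j) l)) * c p (\<beta> j) * \<Psi> (map \<beta> (filter (\<lambda>k. k \<noteq> j) l)))"
proof (induction l arbitrary: \<Psi>)
  case (Cons x l)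
  then have x: "x \<notin> set l" "\<forall>y\<in>set l. x < y" by auto
  have f: "filter (\<lambda>k. k < x) l = []" "filter (\<lambda>k. k \<noteq> x) l = l"
    using x by (force simp: filter_empty_conv filter_id_conv)+
  show ?case
    using Cons x by (auto simp: f sum_distrib_left mult.assoc intro!: sum.cong)
qed simp

lemma epsl_sorted:
  "distinct l \<Longrightarrow> fer p \<Longrightarrow> epsl p (map \<beta> l) = (-1) ^ card (ferB (set l))"
  "distinct l \<Longrightarrow> fer p \<Longrightarrow> epsl p (map \<alpha> l) = (-1) ^ card (ferA (set l))"
proof -
  have 1: "{i. (i = x \<or> i \<in> S) \<and> P i} = (if P x then insert x {i \<in> S. P i} else {i \<in> S. P i})"
    for x :: nat and S P by auto
  show "distinct l \<Longrightarrow> fer p \<Longrightarrow> epsl p (map \<beta> l) = (-1) ^ card (ferB (set l))"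
    by (induction l) (auto simp: eps_def ferB_def 1)
  show "distinct l \<Longrightarrow> fer p \<Longrightarrow> epsl p (map \<alpha> l) = (-1) ^ card (ferA (set l))"
    by (induction l) (auto simp: eps_def ferA_def 1)
qed

lemma sorted_list_of_set_insert_less:
  fixes p :: nat
  assumes "finite I" "\<And>i. i \<in> I \<Longrightarrow> p < i"
  shows "sorted_list_of_set (insert p I) = p # sorted_list_of_set I"
proof -
  have "p \<notin> I" using assms(2) by blast
  then show ?thesis
    using assms by (simp add: sorted_list_of_set_insert insort_is_Cons order_less_imp_le)
qed

lemma wick_weight_skip:
  assumes S: "finite S" "\<And>i. i \<in> S \<Longrightarrow> p < i" and I: "I \<subseteq> S"
  shows "wick_weight (insert p S) T I J = wick_weight S T I J"
proof (cases "fer (\<alpha> p)")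
  case False
  then have "ferA (insert p S) = ferA S" by (auto simp: ferA_def)
  then show ?thesis by (simp add: wick_weight_def wick_exponent_def)
next
  case True
  have fin: "finite (ferA I)" "finite (ferA S)" using S(1) I by (auto simp: ferA_def finite_subset)
  have ins: "ferA (insert p S) = insert p (ferA S)" "p \<notin> ferA S"
    using True S(2) by (auto simp: ferA_def)
  have "card {k \<in> ferA (insert p S). k \<le> i} = Suc (card {k \<in> ferA S. k \<le> i})" if "i \<in> ferA I" for i
  proof -
    have "p < i" using that S(2) I by (auto simp: ferA_def)
    then have "{k \<in> ferA (insert p S). k \<le> i} = insert p {k \<in> ferA S. k \<le> i}"
      unfolding ins by auto
    then show ?thesis using fin ins by simp
  qed
  then have "(\<Sum>i\<in>ferA I. card {k \<in> ferA (insert p S). k \<le> i}) =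
      (\<Sum>i\<in>ferA I. card {k \<in> ferA S. k \<le> i}) + card (ferA I)"
    by (simp add: sum_Suc)
  moreover have "card (ferA (insert p S)) = Suc (card (ferA S))"
    using fin ins by simp
  ultimately have "wick_exponent (insert p S) T (ferA I) (ferB J) =
      wick_exponent S T (ferA I) (ferB J) + 2 * card (ferA I)"
    unfolding wick_exponent_def by simp
  then show ?thesis
    by (simp add: wick_weight_def power_add)
qed

lemma exponent_step:
  fixes SA SB rho nA q G L :: nat
  assumes "rho = L + G"
  shows "even ((1 + rho + SA + (q + 1 + SB + G) + Suc nA * Suc rho + Suc rho * (Suc rho + 1) div 2) + L
    + (nA + q + (SA + SB + nA * rho + rho * (rho + 1) div 2)))"
proof -
  have "Suc rho * (Suc rho + 1) div 2 = rho * (rho + 1) div 2 + rho + 1"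
    by (simp add: algebra_simps)
  then show ?thesis using assms by (simp add: algebra_simps)
qed

lemma wick_weight_insert:
  assumes S: "finite S" "\<And>i. i \<in> S \<Longrightarrow> p < i" and I: "I \<subseteq> S"
    and T: "finite T" and J: "J \<subseteq> T"
  shows "wick_weight (insert p S) T (insert p I) J =
    (\<Sum>j\<in>J. (if fer (\<alpha> p) then (-1) ^ (card (ferA S) + card (ferB {k \<in> T. k < j})) else 1)
       * c (\<alpha> p) (\<beta> j) * wick_weight S (T - {j}) I (J - {j}))"
proof -
  have finJ: "finite J" using T J finite_subset by blast
  have finI: "finite I" using S I finite_subset by blast
  have pI: "p < i" if "i \<in> I" for i using that S I by blast
  show ?thesis
  proof (cases "fer (\<alpha> p)")
    case False
    have 1: "bosA (insert p I) = insert p (bosA I)" "ferA (insert p I) = ferA I"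
      "ferA (insert p S) = ferA S"
      using False by (auto simp: bosA_def ferA_def)
    have 2: "sorted_list_of_set (insert p (bosA I)) = p # sorted_list_of_set (bosA I)"
      by (rule sorted_list_of_set_insert_less) (use finI pI in \<open>auto simp: bosA_def\<close>)
    have 3: "ferB (T - {j}) = ferB T" "ferB (J - {j}) = ferB J" "bosB (J - {j}) = bosB J - {j}"
      if "j \<in> bosB J" for j
      using that by (auto simp: ferB_def bosB_def)
    have "wick_weight (insert p S) T (insert p I) J =
        (\<Sum>j\<in>bosB J. c (\<alpha> p) (\<beta> j) * wick_weight S (T - {j}) I (J - {j}))"
      unfolding wick_weight_def wick_exponent_def 1 2 row_perm.simps sum_distrib_left sum_distrib_right
      by (rule sum.cong) (simp_all add: 3)
    also have "\<dots> = (\<Sum>j\<in>J. c (\<alpha> p) (\<beta> j) * wick_weight S (T - {j}) I (J - {j}))"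
      by (rule sum.mono_neutral_left) (use False finJ c_parity in \<open>auto simp: bosB_def\<close>)
    finally show ?thesis using False by simp
  next
    case True
    have 1: "bosA (insert p I) = bosA I" "ferA (insert p I) = insert p (ferA I)"
      "ferA (insert p S) = insert p (ferA S)"
      using True by (auto simp: bosA_def ferA_def)
    have pn: "p \<notin> ferA I" "p \<notin> ferA S" using pI S(2) by (auto simp: ferA_def)
    have fin: "finite (ferA I)" "finite (ferA S)" "finite (ferB T)" "finite (ferB J)"
      using finI S(1) T finJ by (auto simp: ferA_def ferB_def)
    have 2: "sorted_list_of_set (insert p (ferA I)) = p # sorted_list_of_set (ferA I)"
      by (rule sorted_list_of_set_insert_less) (use finI pI in \<open>auto simp: ferA_def\<close>)
    have 3: "bosB (J - {j}) = bosB J" "ferB (J - {j}) = ferB J - {j}" if "j \<in> ferB J" for j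
      using that by (auto simp: ferB_def bosB_def)
    have sign: "(-1) ^ wick_exponent (insert p S) T (insert p (ferA I)) (ferB J)
        * ((-1) ^ card {k \<in> ferB J. k < j} * row_det (sorted_list_of_set (ferA I)) (ferB J - {j}))
       = (-1) ^ (card (ferA S) + card (ferB {k \<in> T. k < j}))
         * (-1) ^ wick_exponent S (T - {j}) (ferA I) (ferB J - {j})
         * row_det (sorted_list_of_set (ferA I)) (ferB J - {j})"
      if j: "j \<in> ferB J" for j
    proof (cases "row_det (sorted_list_of_set (ferA I)) (ferB J - {j}) = 0")
      case False
      have cardJ: "card (ferA I) = card (ferB J - {j})"
        using row_det_card[OF _ False] fin by simp
      define L where "L = card {k \<in> ferB J. k < j}"
      define G where "G = card {k \<in> ferB J. j < k}"
      have un: "ferB J - {j} = {k \<in> ferB J. k < j} \<union> {k \<in> ferB J. j < k}"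
        by auto
      have disj: "{k \<in> ferB J. k < j} \<inter> {k \<in> ferB J. j < k} = {}"
        by auto
      have "finite {k \<in> ferB J. k < j}" "finite {k \<in> ferB J. j < k}"
        using fin(4) by simp_all
      from card_Un_disjoint[OF this disj]
      have rho: "card (ferA I) = L + G"
        by (simp only: cardJ L_def G_def un)
      have A: "(\<Sum>i\<in>insert p (ferA I). card {k \<in> insert p (ferA S). k \<le> i}) =
          1 + card (ferA I) + (\<Sum>i\<in>ferA I. card {k \<in> ferA S. k \<le> i})"
      proof -
        have "card {k \<in> insert p (ferA S). k \<le> i} = Suc (card {k \<in> ferA S. k \<le> i})" if "i \<in> ferA I" for i
        proof -
          have "p < i" using that pI by (auto simp: ferA_def)
          then have "{k \<in> insert p (ferA S). k \<le> i} = insert p {k \<in> ferA S. k \<le> i}" by auto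
          then show ?thesis using fin pn by simp
        qed
        moreover have "{k \<in> insert p (ferA S). k \<le> p} = {p}"
          using S(2) by (force simp: ferA_def)
        ultimately show ?thesis using fin pn by (simp add: sum_Suc)
      qed
      have B: "(\<Sum>i\<in>ferB J. card {k \<in> ferB T. k \<le> i}) =
          card (ferB {k \<in> T. k < j}) + 1 + (\<Sum>i\<in>ferB J - {j}. card {k \<in> ferB (T - {j}). k \<le> i}) + G"
      proof -
        have jT: "j \<in> ferB T" using j J by (auto simp: ferB_def)
        have "{k \<in> ferB T. k \<le> j} = insert j (ferB {k \<in> T. k < j})"
          using jT by (auto simp: ferB_def)
        then have "card {k \<in> ferB T. k \<le> j} = card (ferB {k \<in> T. k < j}) + 1"
          using T by (simp add: ferB_def)
        moreover have "card {k \<in> ferB T. k \<le> i} = card {k \<in> ferB (T - {j}). k \<le> i} + of_bool (j < i)"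
          if "i \<in> ferB J - {j}" for i
        proof (cases "j < i")
          case True
          then have "{k \<in> ferB T. k \<le> i} = insert j {k \<in> ferB (T - {j}). k \<le> i}"
            using jT by (auto simp: ferB_def)
          then show ?thesis using True T by (simp add: ferB_def)
        next
          case False
          then have "{k \<in> ferB T. k \<le> i} = {k \<in> ferB (T - {j}). k \<le> i}"
            using that by (auto simp: ferB_def)
          then show ?thesis using False by simp
        qed
        moreover have "(\<Sum>i\<in>ferB J - {j}. of_bool (j < i)) = G"
          unfolding G_def using fin by (subst sum_of_bool_eq) (auto intro!: arg_cong[of _ _ card])
        ultimately show ?thesis
          using j fin by (subst sum.remove[of _ j]) (auto simp: sum.distrib)
      qed
      have "even (wick_exponent (insert p S) T (insert p (ferA I)) (ferB J) + L
        + (card (ferA S) + card (ferB {k \<in> T. k < j}) + wick_exponent S (T - {j}) (ferA I) (ferB J - {j})))"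
        using exponent_step[OF rho, of "\<Sum>i\<in>ferA I. card {k \<in> ferA S. k \<le> i}" "card (ferB {k \<in> T. k < j})"
          "\<Sum>i\<in>ferB J - {j}. card {k \<in> ferB (T - {j}). k \<le> i}" "card (ferA S)"]
        unfolding wick_exponent_def 1 A B using fin pn by simp
      from neg_one_power_cong[OF this]
      show ?thesis unfolding L_def by (simp add: power_add)
    qed simp
    have "wick_weight (insert p S) T (insert p I) J =
        (\<Sum>j\<in>ferB J. row_perm (sorted_list_of_set (bosA I)) (bosB J) * c (\<alpha> p) (\<beta> j) *
         ((-1) ^ wick_exponent (insert p S) T (insert p (ferA I)) (ferB J)
          * ((-1) ^ card {k \<in> ferB J. k < j} * row_det (sorted_list_of_set (ferA I)) (ferB J - {j}))))"
      unfolding wick_weight_def 1 2 row_det.simps sum_distrib_left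
      by (rule sum.cong) (simp_all add: mult_ac)
    also have "\<dots> = (\<Sum>j\<in>ferB J. (-1) ^ (card (ferA S) + card (ferB {k \<in> T. k < j}))
       * c (\<alpha> p) (\<beta> j) * wick_weight S (T - {j}) I (J - {j}))"
      by (rule sum.cong, simp, subst sign) (simp_all add: wick_weight_def 3 mult_ac)
    also have "\<dots> = (\<Sum>j\<in>J. (-1) ^ (card (ferA S) + card (ferB {k \<in> T. k < j}))
       * c (\<alpha> p) (\<beta> j) * wick_weight S (T - {j}) I (J - {j}))"
      by (rule sum.mono_neutral_left) (use True finJ c_parity in \<open>auto simp: ferB_def\<close>)
    finally show ?thesis using True by simp
  qed
qed

lemma wick_explicit:
  assumes "sorted_wrt (<) k" "sorted_wrt (<) l"
  shows "wick (map \<alpha> k) \<Phi> (map \<beta> l) =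
    (\<Sum>I\<in>Pow (set k). \<Sum>J\<in>Pow (set l). wick_weight (set k) (set l) I J *
       \<Phi> (map \<alpha> (filter (\<lambda>i. i \<notin> I) k) @ map \<beta> (filter (\<lambda>j. j \<notin> J) l)))"
  using assms
proof (induction k arbitrary: \<Phi> l)
  case Nil
  have emp: "wick_weight {} (set l) {} J = (if J = {} then 1 else 0)" if "J \<subseteq> set l" for J
    by (auto simp: wick_weight_def wick_exponent_def bosA_def ferA_def bosB_def ferB_def)
  have "(\<Sum>J\<in>Pow (set l). wick_weight {} (set l) {} J * \<Phi> (map \<beta> (filter (\<lambda>j. j \<notin> J) l))) =
     (\<Sum>J\<in>Pow (set l). if J = {} then \<Phi> (map \<beta> l) else 0)"
    by (rule sum.cong) (auto simp: emp)
  then show ?case by simp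
next
  case (Cons p k)
  let ?S = "set k" and ?T = "set l"
  let ?\<Phi> = "\<lambda>I J l. \<Phi> (map \<alpha> (filter (\<lambda>i. i \<notin> I) k) @ map \<beta> (filter (\<lambda>j. j \<notin> J) l))"
  let ?\<epsilon> = "\<lambda>j. if fer (\<alpha> p) then (-1) ^ (card (ferA ?S) + card (ferB {k \<in> ?T. k < j})) else 1 :: complex"
  have p: "p \<notin> ?S" "\<And>i. i \<in> ?S \<Longrightarrow> p < i" and k: "sorted_wrt (<) k" "distinct k" and l: "distinct l"
    using Cons.prems by (auto dest: strict_sorted_imp_sorted simp: strict_sorted_iff)
  have IH: "wick (map \<alpha> k) \<Phi> (map \<beta> l) =
    (\<Sum>I\<in>Pow ?S. \<Sum>J\<in>Pow (set l). wick_weight ?S (set l) I J *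
       \<Phi> (map \<alpha> (filter (\<lambda>i. i \<notin> I) k) @ map \<beta> (filter (\<lambda>j. j \<notin> J) l)))"
    if "sorted_wrt (<) l" for l \<Phi>
    using Cons.IH[OF k(1) that] .
  have \<epsilon>: "epsl (\<alpha> p) (map \<alpha> k) * epsl (\<alpha> p) (map \<beta> (filter (\<lambda>i. i < j) l)) = ?\<epsilon> j" for j
    using k(2) l by (simp add: epsl_sorted power_add)
  have "epsl (\<alpha> p) (map \<alpha> k) * contr (\<alpha> p) (wick (map \<alpha> k) \<Phi>) (map \<beta> l) =
      (\<Sum>j\<in>?T. ?\<epsilon> j * c (\<alpha> p) (\<beta> j) * wick (map \<alpha> k) \<Phi> (map \<beta> (filter (\<lambda>k. k \<noteq> j) l)))"
    unfolding contr_sorted[OF Cons.prems(2)] sum_distrib_left \<epsilon>[symmetric] by (simp add: mult.assoc)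
  also have "\<dots> = (\<Sum>j\<in>?T. \<Sum>I\<in>Pow ?S. \<Sum>J\<in>Pow (?T - {j}).
      ?\<epsilon> j * c (\<alpha> p) (\<beta> j) * wick_weight ?S (?T - {j}) I J * ?\<Phi> I (insert j J) l)"
  proof (rule sum.cong[OF refl])
    fix j assume "j \<in> ?T"
    have s: "sorted_wrt (<) (filter (\<lambda>k. k \<noteq> j) l)" using Cons.prems(2) by (rule sorted_wrt_filter)
    have f: "filter (\<lambda>i. i \<notin> J) (filter (\<lambda>k. k \<noteq> j) l) = filter (\<lambda>i. i \<notin> insert j J) l" for J
      by (auto intro: filter_cong)
    have e: "set (filter (\<lambda>k. k \<noteq> j) l) = ?T - {j}" by auto
    show "?\<epsilon> j * c (\<alpha> p) (\<beta> j) * wick (map \<alpha> k) \<Phi> (map \<beta> (filter (\<lambda>k. k \<noteq> j) l)) =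
      (\<Sum>I\<in>Pow ?S. \<Sum>J\<in>Pow (?T - {j}).
      ?\<epsilon> j * c (\<alpha> p) (\<beta> j) * wick_weight ?S (?T - {j}) I J * ?\<Phi> I (insert j J) l)"
      unfolding IH[OF s] e f by (simp only: sum_distrib_left mult.assoc)
  qed
  also have "\<dots> = (\<Sum>I\<in>Pow ?S. \<Sum>j\<in>?T. \<Sum>J\<in>Pow (?T - {j}).
      ?\<epsilon> j * c (\<alpha> p) (\<beta> j) * wick_weight ?S (?T - {j}) I J * ?\<Phi> I (insert j J) l)"
    by (rule sum.swap)
  also have "\<dots> = (\<Sum>I\<in>Pow ?S. \<Sum>J\<in>Pow ?T. \<Sum>j\<in>J.
      ?\<epsilon> j * c (\<alpha> p) (\<beta> j) * wick_weight ?S (?T - {j}) I (J - {j}) * ?\<Phi> I (insert j (J - {j})) l)"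
    by (rule sum.cong[OF refl], rule sum_Pow_remove[symmetric]) simp
  also have "\<dots> = (\<Sum>I\<in>Pow ?S. \<Sum>J\<in>Pow ?T.
      wick_weight (insert p ?S) ?T (insert p I) J * ?\<Phi> I J l)"
  proof (intro sum.cong[OF refl])
    fix I J assume "I \<in> Pow ?S" "J \<in> Pow ?T"
    then have IJ: "I \<subseteq> ?S" "J \<subseteq> ?T" by auto
    show "(\<Sum>j\<in>J. ?\<epsilon> j * c (\<alpha> p) (\<beta> j) * wick_weight ?S (?T - {j}) I (J - {j}) * ?\<Phi> I (insert j (J - {j})) l)
      = wick_weight (insert p ?S) ?T (insert p I) J * ?\<Phi> I J l"
      by (subst wick_weight_insert[OF finite_set p(2) IJ(1) finite_set IJ(2)], assumption,
        unfold sum_distrib_right, rule sum.cong[OF refl]) (simp add: insert_absorb)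
  qed
  finally have 2: "epsl (\<alpha> p) (map \<alpha> k) * contr (\<alpha> p) (wick (map \<alpha> k) \<Phi>) (map \<beta> l) =
    (\<Sum>I\<in>Pow ?S. \<Sum>J\<in>Pow ?T. wick_weight (insert p ?S) ?T (insert p I) J * ?\<Phi> I J l)" .
  have w: "wick_weight (insert p ?S) ?T I J = wick_weight ?S ?T I J"
    and f1: "filter (\<lambda>i. i \<notin> I) (p # k) = p # filter (\<lambda>i. i \<notin> I) k" if "I \<in> Pow ?S" for I J
    using that p wick_weight_skip[OF finite_set p(2)] by auto
  have f2: "filter (\<lambda>i. i \<notin> insert p I) (p # k) = filter (\<lambda>i. i \<notin> I) k" for I
    using p(1) by (auto intro: filter_cong)
  have 3: "(\<Sum>I\<in>Pow ?S. \<Sum>J\<in>Pow ?T. wick_weight (insert p ?S) ?T I J *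
       \<Phi> (map \<alpha> (filter (\<lambda>i. i \<notin> I) (p # k)) @ map \<beta> (filter (\<lambda>j. j \<notin> J) l))) =
     (\<Sum>I\<in>Pow ?S. \<Sum>J\<in>Pow ?T. wick_weight ?S ?T I J *
       \<Phi> (\<alpha> p # map \<alpha> (filter (\<lambda>i. i \<notin> I) k) @ map \<beta> (filter (\<lambda>j. j \<notin> J) l)))"
    by (intro sum.cong refl) (simp only: w f1 list.map append_Cons)
  show ?case
    unfolding list.map(2)[of \<alpha> p k] wick.simps(2) 2 IH[OF Cons.prems(2)] list.set(2)
      sum_Pow_insert[OF p(1) finite_set] f2 3 ..
qed

lemma sum_permutes_Suc:
  fixes g :: "(nat \<Rightarrow> nat) \<Rightarrow> complex"
  shows "(\<Sum>\<sigma> | \<sigma> permutes {..<Suc n}. g \<sigma>) =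
    (\<Sum>j<Suc n. \<Sum>\<sigma> | \<sigma> permutes {..<n}. g (permutation_insert 0 j \<sigma>))"
proof -
  have eq: "{\<sigma>. \<sigma> permutes {..<Suc n}} = (\<Union>j<Suc n. {\<sigma>. \<sigma> permutes {0..<Suc n} \<and> \<sigma> 0 = j})"
    using permutes_in_image[of _ "{..<Suc n}" 0] by (force simp: lessThan_atLeast0)
  have fin: "finite {\<sigma>. \<sigma> permutes {0..<Suc n} \<and> \<sigma> 0 = j}" for j
    by (rule finite_subset[OF _ finite_permutations[of "{0..<Suc n}"]]) auto
  have "(\<Sum>\<sigma> | \<sigma> permutes {..<Suc n}. g \<sigma>) =
      (\<Sum>j<Suc n. \<Sum>\<sigma> | \<sigma> permutes {0..<Suc n} \<and> \<sigma> 0 = j. g \<sigma>)"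
    unfolding eq using fin by (subst sum.UNION_disjoint) auto
  also have "\<dots> = (\<Sum>j<Suc n. \<Sum>\<sigma> | \<sigma> permutes {..<n}. g (permutation_insert 0 j \<sigma>))"
  proof (rule sum.cong[OF refl])
    fix j assume j: "j \<in> {..<Suc n}"
    show "(\<Sum>\<sigma> | \<sigma> permutes {0..<Suc n} \<and> \<sigma> 0 = j. g \<sigma>) =
        (\<Sum>\<sigma> | \<sigma> permutes {..<n}. g (permutation_insert 0 j \<sigma>))"
      using permutation_fix[of 0 n j] permutation_insert_inj_on[of 0 n j] j
      by (simp add: sum.reindex lessThan_atLeast0)
  qed
  finally show ?thesis .
qed

lemma prod_permutation_insert:
  fixes M :: "nat \<Rightarrow> nat \<Rightarrow> complex"
  assumes "length J = Suc n" "j < Suc n" "\<sigma> permutes {..<n}"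
  shows "(\<Prod>i<Suc n. M ((x # I) ! i) (J ! permutation_insert 0 j \<sigma> i)) =
    M x (J ! j) * (\<Prod>i<n. M (I ! i) (delete_nth j J ! \<sigma> i))"
proof -
  have "J ! permutation_insert 0 j \<sigma> (Suc i) = delete_nth j J ! \<sigma> i" if "i < n" for i
  proof -
    have "\<sigma> i < n" using assms(3) that permutes_in_image by fastforce
    then show ?thesis
      using assms(1,2) by (auto simp: permutation_insert_expand delete_nth_def nth_append min_def)
  qed
  then show ?thesis
    unfolding prod.lessThan_Suc_shift by simp
qed

lemma delete_nth_sorted:
  fixes J :: "nat list"
  assumes "sorted_wrt (<) J" "j < length J"
  shows "set (delete_nth j J) = set J - {J ! j}" "sorted_wrt (<) (delete_nth j J)"
    "card {k \<in> set J. k < J ! j} = j"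
proof -
  have J: "J = take j J @ J ! j # drop (Suc j) J" by (rule id_take_nth_drop[OF assms(2)])
  then have s: "sorted_wrt (<) (take j J @ J ! j # drop (Suc j) J)" using assms(1) by simp
  show "sorted_wrt (<) (delete_nth j J)"
    using s by (auto simp: delete_nth_def sorted_wrt_append)
  have set: "set J = set (take j J) \<union> {J ! j} \<union> set (drop (Suc j) J)"
    by (subst J) auto
  show "set (delete_nth j J) = set J - {J ! j}"
    unfolding set delete_nth_def using s by (auto simp: sorted_wrt_append)
  have "{k \<in> set J. k < J ! j} = set (take j J)"
    unfolding set using s by (auto simp: sorted_wrt_append dest: order_less_trans)
  moreover have "distinct (take j J)"
    using assms(1) by (simp add: strict_sorted_iff)
  ultimately show "card {k \<in> set J. k < J ! j} = j"
    using assms(2) by (simp add: distinct_card)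
qed

lemma sum_nth_sorted:
  fixes J :: "nat list" and g :: "nat \<Rightarrow> complex"
  assumes "sorted_wrt (<) J" "length J = n"
  shows "(\<Sum>j<n. g (J ! j)) = (\<Sum>j\<in>set J. g j)"
proof -
  have "distinct J" using assms(1) by (simp add: strict_sorted_iff)
  then have "bij_betw ((!) J) {..<n} (set J)" using assms(2) by (simp add: bij_betw_nth)
  then show ?thesis by (rule sum.reindex_bij_betw)
qed

lemma row_perm_eq:
  assumes "length I = n" "length J = n" "sorted_wrt (<) J"
  shows "(\<Sum>\<sigma> | \<sigma> permutes {..<n}. \<Prod>i<n. c (\<alpha> (I ! i)) (\<beta> (J ! \<sigma> i))) = row_perm I (set J)"
  using assms
proof (induction n arbitrary: I J)
  case 0
  then show ?case by simp
next
  case (Suc n)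
  then obtain x I' where I: "I = x # I'" "length I' = n" by (cases I) auto
  let ?M = "\<lambda>i j. c (\<alpha> i) (\<beta> j)"
  have IH: "(\<Sum>\<sigma> | \<sigma> permutes {..<n}. \<Prod>i<n. ?M (I' ! i) (delete_nth j J ! \<sigma> i)) =
      row_perm I' (set J - {J ! j})" if "j < Suc n" for j
    using Suc.IH[of I' "delete_nth j J"] delete_nth_sorted[OF Suc.prems(3), of j] that I(2) Suc.prems(2)
    by simp
  have "(\<Sum>\<sigma> | \<sigma> permutes {..<Suc n}. \<Prod>i<Suc n. ?M (I ! i) (J ! \<sigma> i)) =
      (\<Sum>j<Suc n. ?M x (J ! j) * (\<Sum>\<sigma> | \<sigma> permutes {..<n}. \<Prod>i<n. ?M (I' ! i) (delete_nth j J ! \<sigma> i)))"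
    unfolding sum_permutes_Suc I(1) sum_distrib_left
    by (intro sum.cong[OF refl] prod_permutation_insert) (use Suc.prems in auto)
  also have "\<dots> = (\<Sum>j<Suc n. ?M x (J ! j) * row_perm I' (set J - {J ! j}))"
    using IH by simp
  also have "\<dots> = row_perm I (set J)"
    unfolding I(1) using sum_nth_sorted[OF Suc.prems(3,2), of "\<lambda>j. ?M x j * row_perm I' (set J - {j})"]
    by simp
  finally show ?case .
qed

lemma row_det_eq:
  assumes "length I = n" "length J = n" "sorted_wrt (<) J"
  shows "(\<Sum>\<sigma> | \<sigma> permutes {..<n}. of_int (sign \<sigma>) * (\<Prod>i<n. c (\<alpha> (I ! i)) (\<beta> (J ! \<sigma> i)))) =
    row_det I (set J)"
  using assms
proof (induction n arbitrary: I J)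
  case 0
  then show ?case by simp
next
  case (Suc n)
  then obtain x I' where I: "I = x # I'" "length I' = n" by (cases I) auto
  let ?M = "\<lambda>i j. c (\<alpha> i) (\<beta> j)"
  have IH: "(\<Sum>\<sigma> | \<sigma> permutes {..<n}. of_int (sign \<sigma>) * (\<Prod>i<n. ?M (I' ! i) (delete_nth j J ! \<sigma> i))) =
      row_det I' (set J - {J ! j})" if "j < Suc n" for j
    using Suc.IH[of I' "delete_nth j J"] delete_nth_sorted[OF Suc.prems(3), of j] that I(2) Suc.prems(2)
    by simp
  have sg: "of_int (sign (permutation_insert 0 j \<sigma>)) = (-1) ^ j * (of_int (sign \<sigma>) :: complex)"
    if "\<sigma> permutes {..<n}" "j < Suc n" for \<sigma> j
    using signof_permutation_insert[of \<sigma> n 0 j] that by (simp add: lessThan_atLeast0)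
  have "(\<Sum>\<sigma> | \<sigma> permutes {..<Suc n}. of_int (sign \<sigma>) * (\<Prod>i<Suc n. ?M (I ! i) (J ! \<sigma> i))) =
      (\<Sum>j<Suc n. (-1) ^ j * ?M x (J ! j) * (\<Sum>\<sigma> | \<sigma> permutes {..<n}. of_int (sign \<sigma>) *
         (\<Prod>i<n. ?M (I' ! i) (delete_nth j J ! \<sigma> i))))"
    unfolding sum_permutes_Suc I(1) sum_distrib_left
    by (intro sum.cong[OF refl], subst prod_permutation_insert) (use Suc.prems sg in auto)
  also have "\<dots> = (\<Sum>j<Suc n. (-1) ^ card {k \<in> set J. k < J ! j} * ?M x (J ! j) *
      row_det I' (set J - {J ! j}))"
    using IH delete_nth_sorted(3)[OF Suc.prems(3)] Suc.prems(2) by simp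
  also have "\<dots> = row_det I (set J)"
    unfolding I(1) using sum_nth_sorted[OF Suc.prems(3,2),
      of "\<lambda>j. (-1) ^ card {k \<in> set J. k < j} * ?M x j * row_det I' (set J - {j})"]
    by simp
  finally show ?case .
qed

end

section \<open>Coefficients of the series\<close>

definition fs_supported :: "var set \<Rightarrow> expo \<Rightarrow> bool" where
  "fs_supported S e \<longleftrightarrow> (\<forall>v. v \<notin> S \<longrightarrow> e v = 0)"

definition fs_restrict :: "expo \<Rightarrow> var set \<Rightarrow> expo" where
  "fs_restrict e S = (\<lambda>v. if v \<in> S then e v else 0)"

lemma fs_restrict_supported [simp]: "S \<subseteq> T \<Longrightarrow> fs_supported T (fs_restrict e S)"
  by (auto simp: fs_supported_def fs_restrict_def)

lemma fs_restrict_apply [simp]: "v \<in> S \<Longrightarrow> fs_restrict e S v = e v"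
  by (simp add: fs_restrict_def)

lemma disjoint_sum_unique:
  assumes "fs_supported S e1" "fs_supported T e2" "S \<inter> T = {}"
  shows "(\<forall>v. e1 v + e2 v = e v) \<longleftrightarrow>
    fs_supported (S \<union> T) e \<and> e1 = fs_restrict e S \<and> e2 = fs_restrict e T"
proof
  assume *: "\<forall>v. e1 v + e2 v = e v"
  have "e1 v = fs_restrict e S v \<and> e2 v = fs_restrict e T v \<and> (v \<notin> S \<union> T \<longrightarrow> e v = 0)" for v
    using *[rule_format, of v] assms
    by (cases "v \<in> S"; cases "v \<in> T") (auto simp: fs_supported_def fs_restrict_def)
  then show "fs_supported (S \<union> T) e \<and> e1 = fs_restrict e S \<and> e2 = fs_restrict e T"
    by (auto simp: fs_supported_def)
next
  assume *: "fs_supported (S \<union> T) e \<and> e1 = fs_restrict e S \<and> e2 = fs_restrict e T"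
  show "\<forall>v. e1 v + e2 v = e v"
    using * assms(3) by (auto simp: fs_supported_def fs_restrict_def)
qed

lemma disjoint_decomposition:
  assumes "\<And>e. P e \<Longrightarrow> fs_supported S e" "\<And>e. Q e \<Longrightarrow> fs_supported T e" "S \<inter> T = {}"
  shows "{(e1, e2). P e1 \<and> Q e2 \<and> (\<forall>v. e1 v + e2 v = e v)} =
    (if fs_supported (S \<union> T) e \<and> P (fs_restrict e S) \<and> Q (fs_restrict e T)
     then {(fs_restrict e S, fs_restrict e T)} else {})"
proof -
  have "(P e1 \<and> Q e2 \<and> (\<forall>v. e1 v + e2 v = e v)) \<longleftrightarrow>
      (fs_supported (S \<union> T) e \<and> P (fs_restrict e S) \<and> Q (fs_restrict e T) \<and>
       e1 = fs_restrict e S \<and> e2 = fs_restrict e T)" for e1 e2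
  proof (cases "P e1 \<and> Q e2")
    case True
    then show ?thesis
      using disjoint_sum_unique[OF assms(1)[of e1] assms(2)[of e2] assms(3), of e] by auto
  qed auto
  then show ?thesis by auto
qed

lemma fs_mult_disjoint:
  assumes "\<And>e. f e \<noteq> 0 \<Longrightarrow> fs_supported S e" "\<And>e. g e \<noteq> 0 \<Longrightarrow> fs_supported T e" "S \<inter> T = {}"
  shows "fs_mult f g e =
    (if fs_supported (S \<union> T) e then f (fs_restrict e S) * g (fs_restrict e T) else 0)"
proof -
  have "{(e1, e2). f e1 \<noteq> 0 \<and> g e2 \<noteq> 0 \<and> (\<forall>v. e1 v + e2 v = e v)} =
      (if fs_supported (S \<union> T) e \<and> f (fs_restrict e S) \<noteq> 0 \<and> g (fs_restrict e T) \<noteq> 0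
       then {(fs_restrict e S, fs_restrict e T)} else {})"
    by (rule disjoint_decomposition[OF assms])
  then show ?thesis
    unfolding fs_mult_def by auto
qed

lemma fs_prod_disjoint:
  assumes "distinct l" "\<And>i e. i \<in> set l \<Longrightarrow> f i e \<noteq> 0 \<Longrightarrow> fs_supported (S i) e"
    "\<And>i j. i \<in> set l \<Longrightarrow> j \<in> set l \<Longrightarrow> i \<noteq> j \<Longrightarrow> S i \<inter> S j = {}"
  shows "fs_prod (map f l) e =
    (if fs_supported (\<Union>i\<in>set l. S i) e then \<Prod>i\<in>set l. f i (fs_restrict e (S i)) else 0)"
  using assms
proof (induction l arbitrary: e)
  case Nil
  show ?case by (auto simp: fs_prod_def fs_one_def fs_supported_def)
next
  case (Cons i l)
  let ?U = "\<Union>i\<in>set l. S i"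
  have IH: "fs_prod (map f l) e =
    (if fs_supported ?U e then \<Prod>i\<in>set l. f i (fs_restrict e (S i)) else 0)" for e
    by (rule Cons.IH) (use Cons.prems in auto)
  have supp: "fs_supported ?U e" if "fs_prod (map f l) e \<noteq> 0" for e
    using that IH by metis
  have disj: "S i \<inter> ?U = {}"
    using Cons.prems(1) Cons.prems(3)[of i] by fastforce
  have "fs_prod (map f (i # l)) e = fs_mult (f i) (fs_prod (map f l)) e"
    by (simp add: fs_prod_def)
  also have "\<dots> = (if fs_supported (S i \<union> ?U) e
      then f i (fs_restrict e (S i)) * fs_prod (map f l) (fs_restrict e ?U) else 0)"
    by (rule fs_mult_disjoint) (use Cons.prems(2) supp disj in auto)
  also have "fs_prod (map f l) (fs_restrict e ?U) = (\<Prod>i\<in>set l. f i (fs_restrict e (S i)))"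
  proof -
    have "fs_restrict (fs_restrict e ?U) (S i) = fs_restrict e (S i)" if "i \<in> set l" for i
      using that by (auto simp: fs_restrict_def)
    then show ?thesis by (simp add: IH)
  qed
  finally show ?case using Cons.prems(1) by simp
qed

definition hderiv_coeff :: "nat \<Rightarrow> rat \<Rightarrow> complex" where
  "hderiv_coeff k q = (\<Prod>i<k. of_rat (q + of_nat (Suc i))) / fact k"

lemma fs_deriv_funpow:
  "(fs_deriv v ^^ k) f e = (\<Prod>i<k. of_rat (e v + of_nat (Suc i))) * f (e(v := e v + of_nat k))"
proof (induction k arbitrary: e)
  case (Suc k)
  have "(fs_deriv v ^^ Suc k) f e = of_rat (e v + 1) * (fs_deriv v ^^ k) f (e(v := e v + 1))"
    by (simp add: fs_deriv_def)
  also have "\<dots> = of_rat (e v + 1) *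
      ((\<Prod>i<k. of_rat (e v + 1 + of_nat (Suc i))) * f (e(v := e v + 1 + of_nat k)))"
    unfolding Suc.IH by simp
  also have "of_rat (e v + 1) * (\<Prod>i<k. of_rat (e v + 1 + of_nat (Suc i))) =
      (\<Prod>i<Suc k. of_rat (e v + of_nat (Suc i)) :: complex)"
    unfolding prod.lessThan_Suc_shift by (simp add: add_ac)
  then have "of_rat (e v + 1) * ((\<Prod>i<k. of_rat (e v + 1 + of_nat (Suc i))) * f (e(v := e v + 1 + of_nat k))) =
      (\<Prod>i<Suc k. of_rat (e v + of_nat (Suc i))) * f (e(v := e v + 1 + of_nat k))"
    by (simp only: mult.assoc[symmetric])
  also have "e v + 1 + of_nat k = e v + of_nat (Suc k)" by simp
  finally show ?case .
qed simp

lemma fs_hderiv_apply: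
  "fs_hderiv v k f e = hderiv_coeff k (e v) * f (e(v := e v + of_nat k))"
  by (simp add: fs_hderiv_def fs_scale_def fs_deriv_funpow hderiv_coeff_def)

text \<open>
  The exponent \<open>q\<close> of \<open>v\<close> in a monomial determines the mode of \<open>a\<^sup>(\<^sup>k\<^sup>)(v)\<close> contributing to it,
  with coefficient \<open>field_coeff a k q\<close>.
\<close>

definition mode_exponent :: "'h bf \<Rightarrow> nat \<Rightarrow> rat \<Rightarrow> rat" where
  "mode_exponent a k q = of_nat (parity a) / 2 - 1 - q - of_nat k"

definition mode_index :: "'h bf \<Rightarrow> nat \<Rightarrow> rat \<Rightarrow> int" where
  "mode_index a k q = \<lfloor>mode_exponent a k q\<rfloor>"

definition field_coeff :: "'h bf \<Rightarrow> nat \<Rightarrow> rat \<Rightarrow> complex" where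
  "field_coeff a k q = (if mode_exponent a k q \<in> \<int> then hderiv_coeff k q else 0)"

lemma mode_coeff_apply:
  "mode_coeff (a, k, v) n e =
    (if fs_supported {v} e \<and> n = mode_index a k (e v) then field_coeff a k (e v) else 0)"
proof -
  have "e(v := e v + of_nat k) = (\<lambda>_. 0)(v := - of_int n - 1 + of_nat (parity a) / 2) \<longleftrightarrow>
      fs_supported {v} e \<and> mode_exponent a k (e v) = of_int n"
    by (auto simp: fs_supported_def fun_eq_iff mode_exponent_def algebra_simps)
  moreover have "mode_exponent a k (e v) = of_int n \<longleftrightarrow>
      mode_exponent a k (e v) \<in> \<int> \<and> n = mode_index a k (e v)"
    unfolding mode_index_def by (metis Ints_of_int floor_of_int of_int_floor)
  ultimately show ?thesis
    by (auto simp: mode_coeff_def fs_hderiv_apply fs_monom_def field_coeff_def)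
qed

lemma mode_coeff_prod:
  assumes "distinct (map (snd \<circ> snd) fs)" "length ns = length fs"
  shows "fs_prod (map2 mode_coeff fs ns) e =
    (if fs_supported (set (map (snd \<circ> snd) fs)) e \<and> ns = map (\<lambda>(a, k, v). mode_index a k (e v)) fs
     then \<Prod>(a, k, v)\<leftarrow>fs. field_coeff a k (e v) else 0)"
proof -
  let ?v = "\<lambda>i. snd (snd (fs ! i))"
  let ?l = "[0..<length fs]"
  let ?g = "\<lambda>(a, k, v). field_coeff a k (e v)"
  have m: "map2 mode_coeff fs ns = map (\<lambda>i. mode_coeff (fs ! i) (ns ! i)) ?l"
    using assms(2) by (intro nth_equalityI) auto
  have app: "mode_coeff (fs ! i) n e =
      (if fs_supported {?v i} e \<and> n = (case fs ! i of (a, k, v) \<Rightarrow> mode_index a k (e v))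
       then case fs ! i of (a, k, v) \<Rightarrow> field_coeff a k (e v) else 0)" for i n e
    by (cases "fs ! i") (simp add: mode_coeff_apply)
  have 1: "fs_prod (map2 mode_coeff fs ns) e = (if fs_supported (\<Union>i\<in>set ?l. {?v i}) e
      then \<Prod>i\<in>set ?l. mode_coeff (fs ! i) (ns ! i) (fs_restrict e {?v i}) else 0)"
    unfolding m
  proof (rule fs_prod_disjoint)
    show "fs_supported {?v i} e" if "mode_coeff (fs ! i) (ns ! i) e \<noteq> 0" for i e
      using that app by metis
    show "{?v i} \<inter> {?v j} = {}" if "i \<in> set ?l" "j \<in> set ?l" "i \<noteq> j" for i j
      using assms(1) that by (auto simp: distinct_conv_nth)
  qed simp
  have 2: "(\<Union>i\<in>set ?l. {?v i}) = set (map (snd \<circ> snd) fs)"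
  proof -
    have "map (snd \<circ> snd) fs = map ?v ?l" by (rule nth_equalityI) auto
    then have "set (map (snd \<circ> snd) fs) = ?v ` set ?l" by simp
    then show ?thesis by auto
  qed
  have 3: "mode_coeff (fs ! i) (ns ! i) (fs_restrict e {?v i}) =
      (if ns ! i = map (\<lambda>(a, k, v). mode_index a k (e v)) fs ! i then ?g (fs ! i) else 0)"
    if "i < length fs" for i
    using that by (cases "fs ! i") (simp add: mode_coeff_apply)
  have 4: "(\<Prod>i\<in>set ?l. mode_coeff (fs ! i) (ns ! i) (fs_restrict e {?v i})) =
      (if ns = map (\<lambda>(a, k, v). mode_index a k (e v)) fs then \<Prod>f\<leftarrow>fs. ?g f else 0)"
  proof (cases "ns = map (\<lambda>(a, k, v). mode_index a k (e v)) fs")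
    case True
    have "(\<Prod>i\<in>set ?l. mode_coeff (fs ! i) (ns ! i) (fs_restrict e {?v i})) = (\<Prod>i\<in>set ?l. ?g (fs ! i))"
      by (rule prod.cong[OF refl], subst 3) (use True in auto)
    also have "\<dots> = (\<Prod>f\<leftarrow>fs. ?g f)"
      by (subst prod.list_conv_set_nth) (simp add: atLeast0LessThan)
    finally show ?thesis using True by simp
  next
    case False
    then obtain i where "i < length fs" "ns ! i \<noteq> map (\<lambda>(a, k, v). mode_index a k (e v)) fs ! i"
      using assms(2) by (metis (no_types, lifting) length_map nth_equalityI)
    then have "(\<Prod>i\<in>set ?l. mode_coeff (fs ! i) (ns ! i) (fs_restrict e {?v i})) = 0"
      by (intro prod_zero) (auto simp: 3 intro!: bexI[of _ i])
    with False show ?thesis by simp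
  qed
  show ?thesis unfolding 1 2 4 by simp
qed

lemma fs_binom_apply:
  assumes "v \<noteq> w"
  shows "fs_binom v w N e = (if fs_supported {v, w} e \<and> e w \<in> \<nat> \<and> e v + e w = of_int N
    then (of_int N gchoose nat \<lfloor>e w\<rfloor>) * (-1) ^ nat \<lfloor>e w\<rfloor> else 0)"
proof -
  have "{k. e = (\<lambda>_. 0)(v := of_int N - of_nat k, w := of_nat k)} =
     (if fs_supported {v, w} e \<and> e w \<in> \<nat> \<and> e v + e w = of_int N then {nat \<lfloor>e w\<rfloor>} else {})"
  proof (cases "fs_supported {v, w} e \<and> e w \<in> \<nat> \<and> e v + e w = of_int N")
    case True
    then obtain k where k: "e w = of_nat k" by (auto elim: Nats_cases)
    moreover have "e v = of_int N - of_nat k" using True k by (simp add: algebra_simps)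
    ultimately have "e = (\<lambda>_. 0)(v := of_int N - of_nat k, w := of_nat k)"
      using True assms by (auto simp: fs_supported_def fun_eq_iff)
    moreover have "k' = k" if "e = (\<lambda>_. 0)(v := of_int N - of_nat k', w := of_nat k')" for k'
    proof -
      have "e w = of_nat k'" by (subst that) simp
      with k show ?thesis by simp
    qed
    ultimately have "{k. e = (\<lambda>_. 0)(v := of_int N - of_nat k, w := of_nat k)} = {k}" by blast
    with True k show ?thesis by simp
  next
    case False
    have "fs_supported {v, w} e \<and> e w \<in> \<nat> \<and> e v + e w = of_int N"
      if "e = (\<lambda>_. 0)(v := of_int N - of_nat k, w := of_nat k)" for k
      using assms by (subst (1 2 3 4) that) (auto simp: fs_supported_def)
    with False show ?thesis by auto
  qed
  then show ?thesis unfolding fs_binom_def by auto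
qed

lemma fs_mult_monom: "fs_mult (fs_monom v q) g e = g (e(v := e v - q))"
proof -
  have "(fs_monom v q e1 \<noteq> 0 \<and> (\<forall>u. e1 u + e2 u = e u)) \<longleftrightarrow>
      e1 = (\<lambda>_. 0)(v := q) \<and> e2 = e(v := e v - q)" for e1 e2
    by (auto simp: fs_monom_def fun_eq_iff eq_diff_eq add.commute)
  then have "(fs_monom v q e1 \<noteq> 0 \<and> g e2 \<noteq> 0 \<and> (\<forall>u. e1 u + e2 u = e u)) \<longleftrightarrow>
      g (e(v := e v - q)) \<noteq> 0 \<and> e1 = (\<lambda>_. 0)(v := q) \<and> e2 = e(v := e v - q)" for e1 e2
    by metis
  then have "{(e1, e2). fs_monom v q e1 \<noteq> 0 \<and> g e2 \<noteq> 0 \<and> (\<forall>u. e1 u + e2 u = e u)} =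
     (if g (e(v := e v - q)) \<noteq> 0 then {((\<lambda>_. 0)(v := q), e(v := e v - q))} else {})"
    by auto
  then show ?thesis by (auto simp: fs_mult_def fs_monom_def)
qed

lemma fs_mult_one: "fs_mult g fs_one = g"
proof
  fix e
  have "(fs_one e2 \<noteq> 0 \<and> (\<forall>u. e1 u + e2 u = e u)) \<longleftrightarrow> e1 = e \<and> e2 = (\<lambda>_. 0)" for e1 e2
    by (auto simp: fs_one_def fun_eq_iff)
  then have "{(e1, e2). g e1 \<noteq> 0 \<and> fs_one e2 \<noteq> 0 \<and> (\<forall>u. e1 u + e2 u = e u)} =
     (if g e \<noteq> 0 then {(e, \<lambda>_. 0)} else {})"
    by auto
  then show "fs_mult g fs_one e = g e" by (auto simp: fs_mult_def fs_one_def)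
qed

lemma fs_mult_monom_add:
  assumes "v \<noteq> w"
  shows "fs_mult (fs_add (fs_monom v 1) (fs_monom w 1)) g e = g (e(v := e v - 1)) + g (e(w := e w - 1))"
proof -
  let ?f = "fs_add (fs_monom v 1) (fs_monom w 1)"
  let ?ev = "(\<lambda>_. 0)(v := 1 :: rat)" and ?ew = "(\<lambda>_. 0)(w := 1 :: rat)"
  have ne: "?ev \<noteq> ?ew" using assms by (auto simp: fun_eq_iff split: if_splits)
  have f: "?f e1 = (if e1 = ?ev then 1 else if e1 = ?ew then 1 else 0)" for e1
    using ne by (auto simp: fs_add_def fs_monom_def)
  have "fs_mult ?f g e = (\<Sum>(e1, e2)\<in>{(?ev, e(v := e v - 1)), (?ew, e(w := e w - 1))}. ?f e1 * g e2)"
    unfolding fs_mult_def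
  proof (rule sum.mono_neutral_left)
    show "{(e1, e2). ?f e1 \<noteq> 0 \<and> g e2 \<noteq> 0 \<and> (\<forall>u. e1 u + e2 u = e u)}
      \<subseteq> {(?ev, e(v := e v - 1)), (?ew, e(w := e w - 1))}"
    proof (rule subsetI)
      fix d
      assume "d \<in> {(e1, e2). ?f e1 \<noteq> 0 \<and> g e2 \<noteq> 0 \<and> (\<forall>u. e1 u + e2 u = e u)}"
      then obtain e1 e2 where *: "?f e1 \<noteq> 0" "\<forall>u. e1 u + e2 u = e u" and d: "d = (e1, e2)"
        by auto
      have e2: "e2 = (\<lambda>u. e u - e1 u)" using *(2) by (auto simp: fun_eq_iff eq_diff_eq add.commute)
      have "e2 = e(w := e w - 1)" if "e1 = ?ew"
        unfolding e2 that by auto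
      moreover have "e2 = e(v := e v - 1)" if "e1 = ?ev"
        unfolding e2 that by auto
      moreover have "e1 = ?ev \<or> e1 = ?ew" using *(1) f by metis
      ultimately show "d \<in> {(?ev, e(v := e v - 1)), (?ew, e(w := e w - 1))}"
        unfolding d by blast
    qed
  qed (auto simp: f)
  then show ?thesis using ne by (simp add: f)
qed

lemma gchoose_minus_one: "((- 1 :: complex) gchoose k) * (- 1) ^ k = 1"
proof -
  have "((1 + of_nat k - 1) gchoose k) = (of_nat k gchoose k :: complex)"
    by simp
  also have "\<dots> = 1" by (simp only: binomial_gbinomial[symmetric]) simp
  finally show ?thesis using gbinomial_minus[of "1::complex" k] by simp
qed

lemma gchoose_minus_two: "((- 2 :: complex) gchoose k) * (- 1) ^ k = of_nat (Suc k)"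
proof -
  have "((2 + of_nat k - 1) gchoose k) = (of_nat (Suc k) gchoose k :: complex)"
    by simp
  also have "\<dots> = of_nat (Suc k)" by (simp only: binomial_gbinomial[symmetric]) simp
  finally show ?thesis using gbinomial_minus[of "2::complex" k] by simp
qed

lemma F_series_apply:
  assumes "v \<noteq> w" "\<not> is_fer a" "\<not> is_fer b"
  shows "fs_scale (lB * bf_form form a b) (F_series m n v w) e =
    (if fs_supported {v, w} e then field_coeff a (m - 1) (e v) * field_coeff b (n - 1) (e w) *
       mode_contr form lB lF (a, mode_index a (m - 1) (e v)) (b, mode_index b (n - 1) (e w)) else 0)"
proof -
  define P where "P = e v + of_nat (m - 1)"
  define Q where "Q = e w + of_nat (n - 1)"
  let ?e = "e(v := P, w := Q)"
  have F: "F_series m n v w e = hderiv_coeff (m - 1) (e v) * hderiv_coeff (n - 1) (e w) *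
      fs_binom v w (-2) ?e"
    using assms(1) by (simp add: F_series_def fs_hderiv_apply P_def Q_def)
  have supp: "fs_supported {v, w} ?e = fs_supported {v, w} e"
    by (auto simp: fs_supported_def)
  have mv: "mode_exponent a (m - 1) (e v) = - 1 - P" and mw: "mode_exponent b (n - 1) (e w) = - 1 - Q"
    using assms by (auto simp: mode_exponent_def P_def Q_def)
  show ?thesis
  proof (cases "fs_supported {v, w} e \<and> P \<in> \<int> \<and> Q \<in> \<int>")
    case True
    then obtain p q where pq: "P = of_int p" "Q = of_int q" by (auto elim!: Ints_cases)
    have ex: "- 1 - P = of_int (- 1 - p)" "- 1 - Q = of_int (- 1 - q)" using pq by auto
    have nat: "(rat_of_int q \<in> \<nat>) = (0 \<le> q)"
      by (auto simp: Nats_altdef2)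
    have sum: "(rat_of_int p + rat_of_int q = - 2) = (p + q = - 2)"
      by (metis of_int_add of_int_eq_iff of_int_minus of_int_numeral)
    have "fs_binom v w (-2) ?e = (if 0 \<le> q \<and> p + q = - 2 then of_nat (Suc (nat q)) else 0)"
      unfolding fs_binom_apply[OF assms(1)] supp using True assms(1) pq
      by (simp add: nat sum gchoose_minus_two del: of_nat_Suc)
    moreover have "mode_index a (m - 1) (e v) = - 1 - p" "mode_index b (n - 1) (e w) = - 1 - q"
      unfolding mode_index_def mv mw ex floor_of_int by auto
    moreover have "field_coeff a (m - 1) (e v) = hderiv_coeff (m - 1) (e v)"
      "field_coeff b (n - 1) (e w) = hderiv_coeff (n - 1) (e w)"
      unfolding field_coeff_def mv mw ex by auto
    moreover have "(if 0 \<le> q \<and> p + q = - 2 then of_nat (Suc (nat q)) else 0) =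
       (if - 1 - p < 0 \<or> - 1 - p + (- 1 - q) \<noteq> 0 then 0 else of_int (- 1 - p) :: complex)"
    proof (cases "0 \<le> q \<and> p + q = - 2")
      case True
      then have "p = - 2 - q" by simp
      with True show ?thesis by simp
    next
      case False
      show ?thesis
      proof (cases "p \<le> - 1 \<and> p + q = - 2")
        case True
        then have "p = - 1" using False by linarith
        with False show ?thesis by auto
      next
        case other: False
        with False show ?thesis by auto
      qed
    qed
    ultimately show ?thesis
      using True assms by (simp add: fs_scale_def F mode_contr_def)
  next
    case False
    have "z \<in> \<int>" if "- 1 - z \<in> \<int>" for z :: rat
      using Ints_diff[OF Ints_minus[OF Ints_1] that] by simp
    then have f: "field_coeff a (m - 1) (e v) * field_coeff b (n - 1) (e w) = 0" if "fs_supported {v, w} e"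
      using that False unfolding field_coeff_def mv mw by auto
    have "fs_binom v w (-2) ?e = 0"
    proof (rule ccontr)
      assume "\<not> ?thesis"
      then have "fs_supported {v, w} e" "Q \<in> \<nat>" "P + Q = - 2"
        using assms(1) unfolding fs_binom_apply[OF assms(1)] supp by (auto split: if_splits)
      moreover have "P = - 2 - Q" using \<open>P + Q = - 2\<close> by (simp add: eq_diff_eq)
      ultimately show False using False Nats_subset_Ints by auto
    qed
    then show ?thesis using f by (simp add: fs_scale_def F)
  qed
qed

lemma G_series_apply:
  assumes "v \<noteq> w" "is_fer a" "is_fer b"
  shows "fs_scale (lF * bf_form form a b) (G_series m n v w) e =
    (if fs_supported {v, w} e then field_coeff a (m - 1) (e v) * field_coeff b (n - 1) (e w) *
       mode_contr form lB lF (a, mode_index a (m - 1) (e v)) (b, mode_index b (n - 1) (e w)) else 0)"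
proof -
  define P where "P = e v + of_nat (m - 1)"
  define Q where "Q = e w + of_nat (n - 1)"
  let ?e = "e(v := P, w := Q)"
  let ?B = "\<lambda>P Q. fs_binom v w (-1) (e(v := P, w := Q))"
  have B: "?B P Q = (if fs_supported {v, w} e \<and> Q \<in> \<nat> \<and> P + Q = -1 then 1 else 0)" for P Q
  proof -
    have "fs_supported {v, w} (e(v := P, w := Q)) = fs_supported {v, w} e"
      by (auto simp: fs_supported_def)
    then show ?thesis
      unfolding fs_binom_apply[OF assms(1)] using assms(1) by (simp add: gchoose_minus_one)
  qed
  have "G0_series v w ?e = 1/2 * (?B (P - 1/2) (Q + 1/2) + ?B (P + 1/2) (Q - 1/2))"
    using assms(1) unfolding G0_series_def fs_prod_def fs_scale_def
    by (simp add: fs_mult_monom fs_mult_monom_add fs_mult_one fun_upd_twist)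
  then have G: "G_series m n v w e = hderiv_coeff (m - 1) (e v) * hderiv_coeff (n - 1) (e w) *
      (1/2 * (?B (P - 1/2) (Q + 1/2) + ?B (P + 1/2) (Q - 1/2)))"
    using assms(1) by (simp add: G_series_def fs_hderiv_apply P_def Q_def)
  have mv: "mode_exponent a (m - 1) (e v) = - 1/2 - P" and mw: "mode_exponent b (n - 1) (e w) = - 1/2 - Q"
    using assms by (auto simp: mode_exponent_def P_def Q_def field_simps)
  show ?thesis
  proof (cases "fs_supported {v, w} e \<and> - 1/2 - P \<in> \<int> \<and> - 1/2 - Q \<in> \<int>")
    case True
    then obtain p q where "- 1/2 - P = of_int p" "- 1/2 - Q = of_int q" by (auto elim!: Ints_cases)
    then have pq: "P = - 1/2 - of_int p" "Q = - 1/2 - of_int q" by (auto simp: algebra_simps)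
    have ex: "- 1/2 - P = of_int p" "- 1/2 - Q = of_int q" using pq by auto
    have nat: "(rat_of_int z \<in> \<nat>) = (0 \<le> z)" for z
      by (auto simp: Nats_altdef2)
    have e1: "Q + 1/2 = of_int (- q)" "Q - 1/2 = of_int (- q - 1)" using pq by auto
    have sum: "(P - 1/2 + of_int (- q) = - 1) = (p + q = 0)" "(P + 1/2 + of_int (- q - 1) = - 1) = (p + q = 0)"
    proof -
      have "(P - 1/2 + of_int (- q) = - 1) = (rat_of_int (p + q) = of_int 0)"
        "(P + 1/2 + of_int (- q - 1) = - 1) = (rat_of_int (p + q) = of_int 0)"
        unfolding pq by (auto simp: algebra_simps)
      then show "(P - 1/2 + of_int (- q) = - 1) = (p + q = 0)" "(P + 1/2 + of_int (- q - 1) = - 1) = (p + q = 0)"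
        unfolding of_int_eq_iff by auto
    qed
    have "1/2 * (?B (P - 1/2) (Q + 1/2) + ?B (P + 1/2) (Q - 1/2)) =
       (if p + q = 0 \<and> 0 \<le> p then if p = 0 then 1/2 else 1 else 0)"
      unfolding B e1 sum nat using True by auto
    moreover have "mode_index a (m - 1) (e v) = p" "mode_index b (n - 1) (e w) = q"
      unfolding mode_index_def mv mw ex floor_of_int by auto
    moreover have "field_coeff a (m - 1) (e v) = hderiv_coeff (m - 1) (e v)"
      "field_coeff b (n - 1) (e w) = hderiv_coeff (n - 1) (e w)"
      unfolding field_coeff_def mv mw ex by auto
    ultimately show ?thesis
      using True assms unfolding fs_scale_def G mode_contr_def by auto
  next
    case False
    then have f: "field_coeff a (m - 1) (e v) * field_coeff b (n - 1) (e w) = 0" if "fs_supported {v, w} e"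
      using that unfolding field_coeff_def mv mw by auto
    have no: False if "fs_supported {v, w} e" "Q + s / 2 \<in> \<nat>" "P - s / 2 + (Q + s / 2) = - 1" "s = 1 \<or> s = -1" for s
    proof -
      have "Q + s / 2 \<in> \<int>" using that(2) Nats_subset_Ints by blast
      moreover have "s / 2 + 1 / 2 \<in> \<int>" using that(4) by auto
      moreover have "- 1/2 - Q = (s / 2 + 1 / 2) - 1 - (Q + s / 2)" by (simp add: field_simps)
      ultimately have Q: "- 1/2 - Q \<in> \<int>" by (metis Ints_1 Ints_diff)
      have "- 1/2 - P = 0 - (- 1/2 - Q)" using that(3) by (simp add: algebra_simps)
      then have "- 1/2 - P \<in> \<int>" using Q by (metis Ints_0 Ints_diff)
      with Q that(1) False show False by simp
    qed
    have "?B (P - 1/2) (Q + 1/2) = 0" "?B (P + 1/2) (Q - 1/2) = 0"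
      unfolding B using no[of 1] no[of "-1"] by auto
    then show ?thesis using f by (simp add: fs_scale_def G)
  qed
qed

lemma fs_prod_pairs:
  assumes x: "inj_on x {..<k}" and y: "inj_on y {..<k}" and xy: "x ` {..<k} \<inter> y ` {..<k} = {}"
    and A: "\<And>i j e. i < k \<Longrightarrow> j < k \<Longrightarrow>
      A i j e = (if fs_supported {x i, y j} e then B i j (e (x i)) (e (y j)) else 0)"
    and \<sigma>: "\<sigma> permutes {..<k}"
  shows "fs_prod (map (\<lambda>i. A i (\<sigma> i)) [0..<k]) e =
    (if fs_supported (x ` {..<k} \<union> y ` {..<k}) e then \<Prod>i<k. B i (\<sigma> i) (e (x i)) (e (y (\<sigma> i))) else 0)"
proof -
  have \<sigma>k: "\<sigma> i < k" if "i < k" for i using \<sigma> that permutes_in_image by fastforce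
  have "fs_prod (map (\<lambda>i. A i (\<sigma> i)) [0..<k]) e =
    (if fs_supported (\<Union>i\<in>set [0..<k]. {x i, y (\<sigma> i)}) e
     then \<Prod>i\<in>set [0..<k]. A i (\<sigma> i) (fs_restrict e {x i, y (\<sigma> i)}) else 0)"
  proof (rule fs_prod_disjoint)
    show "fs_supported {x i, y (\<sigma> i)} e" if "i \<in> set [0..<k]" "A i (\<sigma> i) e \<noteq> 0" for i e
      using that A[of i "\<sigma> i" e] \<sigma>k by (auto split: if_splits)
    show "{x i, y (\<sigma> i)} \<inter> {x j, y (\<sigma> j)} = {}" if "i \<in> set [0..<k]" "j \<in> set [0..<k]" "i \<noteq> j" for i j
    proof -
      have "i < k" "j < k" using that by auto
      then have "x i \<noteq> x j" "y (\<sigma> i) \<noteq> y (\<sigma> j)" "x i \<noteq> y (\<sigma> j)" "x j \<noteq> y (\<sigma> i)"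
        using that(3) x y xy \<sigma>k permutes_inj[OF \<sigma>] by (auto dest: inj_onD injD)
      then show ?thesis by auto
    qed
  qed simp
  also have "(\<Union>i\<in>set [0..<k]. {x i, y (\<sigma> i)}) = x ` {..<k} \<union> y ` \<sigma> ` {..<k}"
    by auto
  also have "\<sigma> ` {..<k} = {..<k}" by (rule permutes_image[OF \<sigma>])
  also have "(\<Prod>i\<in>set [0..<k]. A i (\<sigma> i) (fs_restrict e {x i, y (\<sigma> i)})) =
      (\<Prod>i<k. B i (\<sigma> i) (e (x i)) (e (y (\<sigma> i))))"
    by (rule prod.cong) (auto simp: A \<sigma>k)
  finally show ?thesis .
qed

section \<open>Tensor products over a subring\<close>

locale tensor_module = ring N for N (structure) +
  fixes S :: "'a set" and act :: "'a \<Rightarrow> 'm::ab_group_add \<Rightarrow> 'm"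
  assumes S_carrier: "S \<subseteq> carrier N"
begin

abbreviation cls :: "('a \<times> 'm \<Rightarrow>\<^sub>0 int) \<Rightarrow> ('a \<times> 'm \<Rightarrow>\<^sub>0 int) set" where
  "cls g \<equiv> tp_rel N S act #>\<^bsub>tp_free N\<^esub> g"

abbreviation lact :: "'a \<Rightarrow> ('a \<times> 'm \<Rightarrow>\<^sub>0 int) \<Rightarrow> ('a \<times> 'm \<Rightarrow>\<^sub>0 int)" where
  "lact p \<equiv> frag_extend (\<lambda>(q, u). frag_of (p \<otimes> q, u))"

abbreviation chains :: "('a \<times> 'm \<Rightarrow>\<^sub>0 int) set" where
  "chains \<equiv> {g. Poly_Mapping.keys g \<subseteq> carrier N \<times> UNIV}"

definition tp_gens :: "('a \<times> 'm \<Rightarrow>\<^sub>0 int) set" where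
  "tp_gens = {frag_of (p \<oplus> q, u) - frag_of (p, u) - frag_of (q, u) | p q u.
         p \<in> carrier N \<and> q \<in> carrier N} \<union>
      {frag_of (p, u + v) - frag_of (p, u) - frag_of (p, v) | p u v. p \<in> carrier N} \<union>
      {frag_of (p \<otimes> q, u) - frag_of (p, act q u) | p q u. p \<in> carrier N \<and> q \<in> S}"

lemma carrier_tp_free: "carrier (tp_free N) = chains"
  by (auto simp: tp_free_def)

lemma tp_free_simps [simp]: "x \<otimes>\<^bsub>tp_free N\<^esub> y = x + y" "\<one>\<^bsub>tp_free N\<^esub> = 0"
  by (simp_all add: tp_free_def)

lemma comm_group_tp_free: "comm_group (tp_free N)"
  unfolding tp_free_def by (rule abelian_free_Abelian_group)

lemma tp_rel_eq: "tp_rel N S act = generate (tp_free N) tp_gens"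
  by (simp add: tp_rel_def tp_gens_def)

lemma chains_diff: "x \<in> chains \<Longrightarrow> y \<in> chains \<Longrightarrow> x - y \<in> chains"
  using keys_diff[of x y] by auto

lemma chains_add: "x \<in> chains \<Longrightarrow> y \<in> chains \<Longrightarrow> x + y \<in> chains"
  using Poly_Mapping.keys_add[of x y] by auto

lemma chains_frag: "frag_of (p, u) \<in> chains \<longleftrightarrow> p \<in> carrier N"
  by auto

lemma tp_gens_chains: "tp_gens \<subseteq> chains"
proof -
  have "q \<in> carrier N" if "q \<in> S" for q using that S_carrier by auto
  then show ?thesis
    unfolding tp_gens_def
    by (intro subsetI; elim UnE CollectE exE conjE; hypsubst; intro chains_diff; unfold chains_frag) auto
qed

lemma tp_rel_subgroup: "subgroup (tp_rel N S act) (tp_free N)"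
  unfolding tp_rel_eq using comm_group_tp_free tp_gens_chains carrier_tp_free
  by (intro group.generate_is_subgroup) (auto simp: comm_group_def)

lemma tp_rel_chains: "x \<in> tp_rel N S act \<Longrightarrow> x \<in> chains"
  using subgroup.subset[OF tp_rel_subgroup] carrier_tp_free by blast

lemma tp_rel_0: "0 \<in> tp_rel N S act"
  using subgroup.one_closed[OF tp_rel_subgroup] by simp

lemma tp_rel_add: "x \<in> tp_rel N S act \<Longrightarrow> y \<in> tp_rel N S act \<Longrightarrow> x + y \<in> tp_rel N S act"
  using subgroup.m_closed[OF tp_rel_subgroup] by simp

lemma tp_rel_minus: "x \<in> tp_rel N S act \<Longrightarrow> - x \<in> tp_rel N S act"
  using subgroup.m_inv_closed[OF tp_rel_subgroup, of x] tp_rel_chains[of x]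
  by (simp add: tp_free_def)

lemma tp_rel_diff: "x \<in> tp_rel N S act \<Longrightarrow> y \<in> tp_rel N S act \<Longrightarrow> x - y \<in> tp_rel N S act"
  using tp_rel_add[of x "- y"] tp_rel_minus[of y] by simp

lemma tp_gens_rel: "x \<in> tp_gens \<Longrightarrow> x \<in> tp_rel N S act"
  unfolding tp_rel_eq by (rule generate.incl)

lemma cls_eqI:
  assumes "a \<in> chains" "b \<in> chains" "a - b \<in> tp_rel N S act"
  shows "cls a = cls b"
proof -
  interpret G: comm_group "tp_free N" by (rule comm_group_tp_free)
  have "a \<in> cls b"
    unfolding r_coset_def using assms(3) by (auto intro!: bexI[of _ "a - b"])
  from G.repr_independence[OF this _ tp_rel_subgroup] assms(2) show ?thesis
    by (simp add: carrier_tp_free)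
qed

lemma lact_chains: "p \<in> carrier N \<Longrightarrow> x \<in> chains \<Longrightarrow> lact p x \<in> chains"
proof -
  assume p: "p \<in> carrier N" and "x \<in> chains"
  then have "Poly_Mapping.keys x \<subseteq> carrier N \<times> UNIV" by simp
  then show "lact p x \<in> chains"
  proof (induction rule: frag_induction)
    case (diff a b)
    then show ?case by (simp only: frag_extend_diff chains_diff)
  next
    case (one x)
    then show ?case using p by (cases x) auto
  qed auto
qed

lemma lact_rel:
  assumes p: "p \<in> carrier N" and "x \<in> tp_rel N S act"
  shows "lact p x \<in> tp_rel N S act"
proof -
  have gens: "lact p x \<in> tp_gens" if "x \<in> tp_gens" for x
  proof -
    consider (1) q r u where "x = frag_of (q \<oplus> r, u) - frag_of (q, u) - frag_of (r, u)"
        "q \<in> carrier N" "r \<in> carrier N"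
      | (2) q u v where "x = frag_of (q, u + v) - frag_of (q, u) - frag_of (q, v)" "q \<in> carrier N"
      | (3) q s u where "x = frag_of (q \<otimes> s, u) - frag_of (q, act s u)" "q \<in> carrier N" "s \<in> S"
      using \<open>x \<in> tp_gens\<close> unfolding tp_gens_def by blast
    then show ?thesis
    proof cases
      case 1
      then have "lact p x = frag_of ((p \<otimes> q) \<oplus> (p \<otimes> r), u) - frag_of (p \<otimes> q, u) - frag_of (p \<otimes> r, u)"
        using p by (simp add: frag_extend_diff r_distr)
      with 1 p show ?thesis unfolding tp_gens_def by blast
    next
      case 2
      then have "lact p x = frag_of (p \<otimes> q, u + v) - frag_of (p \<otimes> q, u) - frag_of (p \<otimes> q, v)"
        by (simp add: frag_extend_diff)
      with 2 p show ?thesis unfolding tp_gens_def by blast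
    next
      case 3
      then have "lact p x = frag_of ((p \<otimes> q) \<otimes> s, u) - frag_of (p \<otimes> q, act s u)"
        using p S_carrier by (simp add: frag_extend_diff m_assoc subset_iff)
      with 3 p show ?thesis unfolding tp_gens_def by blast
    qed
  qed
  have "x \<in> generate (tp_free N) tp_gens" using assms(2) by (simp add: tp_rel_eq)
  then show ?thesis
  proof (induction rule: generate.induct)
    case (inv h)
    then have "inv\<^bsub>tp_free N\<^esub> h = - h"
      using tp_gens_chains by (auto simp: tp_free_def)
    with inv show ?case by (simp add: frag_extend_minus gens tp_gens_rel tp_rel_minus)
  qed (auto simp: tp_rel_0 gens tp_gens_rel frag_extend_add tp_rel_add)
qed

lemma tp_act_cls:
  assumes "p \<in> carrier N" "g \<in> chains"
  shows "tp_act N S act p (cls g) = cls (lact p g)"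
proof -
  have "cls (lact p f) = cls (lact p g)" if f: "f \<in> cls g" for f
  proof -
    obtain x where x: "x \<in> tp_rel N S act" "f = x + g"
      using f unfolding r_coset_def tp_free_simps by blast
    show ?thesis
      using x assms lact_rel tp_rel_chains lact_chains chains_add
      by (intro cls_eqI) (auto simp only: frag_extend_add add_diff_cancel_right')
  qed
  moreover have "cls g \<noteq> {}"
    using tp_rel_0 by (auto simp: r_coset_def)
  ultimately show ?thesis
    unfolding tp_act_def by auto
qed

context
  fixes const :: "complex \<Rightarrow> 'a"
begin

abbreviation TP where "TP \<equiv> tensor_product N const S act"

lemma TP_simps:
  "carrier TP = carrier (tp_free N Mod tp_rel N S act)"
  "v \<oplus>\<^bsub>TP\<^esub> w = v \<otimes>\<^bsub>tp_free N Mod tp_rel N S act\<^esub> w"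
  "\<zero>\<^bsub>TP\<^esub> = \<one>\<^bsub>tp_free N Mod tp_rel N S act\<^esub>"
  "z \<odot>\<^bsub>TP\<^esub> w = tp_act N S act (const z) w"
  by (simp_all add: tensor_product_def FactGroup_def Let_def)

lemma carrier_TP: "carrier TP = cls ` chains"
  unfolding TP_simps by (auto simp: FactGroup_def RCOSETS_def carrier_tp_free)

lemma TP_cases:
  assumes "w \<in> carrier TP"
  obtains g where "g \<in> chains" "w = cls g"
  using assms carrier_TP by blast

lemma abelian_group_TP: "abelian_group TP"
proof -
  interpret Q: comm_group "tp_free N Mod tp_rel N S act"
    by (rule comm_group.abelian_FactGroup[OF comm_group_tp_free tp_rel_subgroup])
  show ?thesis
  proof (rule abelian_groupI)
    show "\<exists>y\<in>carrier TP. y \<oplus>\<^bsub>TP\<^esub> x = \<zero>\<^bsub>TP\<^esub>" if "x \<in> carrier TP" for x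
      using that Q.l_inv_ex unfolding TP_simps by blast
  qed (unfold TP_simps, (rule Q.m_closed Q.one_closed Q.m_assoc Q.m_comm Q.l_one; assumption?)+)
qed

lemma TP_add: "a \<in> chains \<Longrightarrow> b \<in> chains \<Longrightarrow> cls a \<oplus>\<^bsub>TP\<^esub> cls b = cls (a + b)"
proof -
  assume ab: "a \<in> chains" "b \<in> chains"
  have "tp_rel N S act \<lhd> tp_free N"
    by (rule comm_group.subgroup_imp_normal[OF comm_group_tp_free tp_rel_subgroup])
  from normal.rcos_sum[OF this, of a b] ab show ?thesis
    by (simp add: tensor_product_def FactGroup_def Let_def carrier_tp_free)
qed

lemma tp_act_closed:
  assumes "p \<in> carrier N" "w \<in> carrier TP"
  shows "tp_act N S act p w \<in> carrier TP"
proof -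
  obtain g where g: "g \<in> chains" "w = cls g" using assms(2) by (rule TP_cases)
  then show ?thesis
    using tp_act_cls[OF assms(1) g(1)] lact_chains[OF assms(1) g(1)] carrier_TP by blast
qed

lemma tp_act_add:
  assumes "p \<in> carrier N" "v \<in> carrier TP" "w \<in> carrier TP"
  shows "tp_act N S act p (v \<oplus>\<^bsub>TP\<^esub> w) = tp_act N S act p v \<oplus>\<^bsub>TP\<^esub> tp_act N S act p w"
proof -
  obtain f where "f \<in> chains" "v = cls f" using assms(2) by (rule TP_cases)
  moreover obtain g where "g \<in> chains" "w = cls g" using assms(3) by (rule TP_cases)
  ultimately show ?thesis
    using assms by (simp only: TP_add tp_act_cls frag_extend_add lact_chains chains_add)
qed

lemma tp_act_mult:
  assumes "p \<in> carrier N" "q \<in> carrier N" "w \<in> carrier TP"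
  shows "tp_act N S act (p \<otimes> q) w = tp_act N S act p (tp_act N S act q w)"
proof -
  obtain g where g: "g \<in> chains" "w = cls g" using assms(3) by (rule TP_cases)
  have "Poly_Mapping.keys g \<subseteq> carrier N \<times> UNIV" using g by simp
  then have "lact (p \<otimes> q) g = lact p (lact q g)"
    by (induction rule: frag_induction) (auto simp: frag_extend_diff assms m_assoc)
  with g assms show ?thesis by (simp only: tp_act_cls lact_chains m_closed)
qed

lemma tp_act_one:
  assumes "w \<in> carrier TP"
  shows "tp_act N S act \<one> w = w"
proof -
  obtain g where g: "g \<in> chains" "w = cls g" using assms by (rule TP_cases)
  have "Poly_Mapping.keys g \<subseteq> carrier N \<times> UNIV" using g by simp
  then have "lact \<one> g = g"
    by (induction rule: frag_induction) (auto simp: frag_extend_diff)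
  with g show ?thesis by (simp only: tp_act_cls one_closed)
qed

lemma tp_act_plus:
  assumes "p \<in> carrier N" "q \<in> carrier N" "w \<in> carrier TP"
  shows "tp_act N S act (p \<oplus> q) w = tp_act N S act p w \<oplus>\<^bsub>TP\<^esub> tp_act N S act q w"
proof -
  obtain g where g: "g \<in> chains" "w = cls g" using assms(3) by (rule TP_cases)
  have "Poly_Mapping.keys g \<subseteq> carrier N \<times> UNIV" using g by simp
  then have "lact (p \<oplus> q) g - (lact p g + lact q g) \<in> tp_rel N S act"
  proof (induction rule: frag_induction)
    case (one x)
    obtain r u where x: "x = (r, u)" "r \<in> carrier N" using one by (cases x) auto
    have "lact (p \<oplus> q) (frag_of x) - (lact p (frag_of x) + lact q (frag_of x)) =
       frag_of ((p \<otimes> r) \<oplus> (q \<otimes> r), u) - frag_of (p \<otimes> r, u) - frag_of (q \<otimes> r, u)"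
      using x assms by (simp add: l_distr)
    also have "\<dots> \<in> tp_gens" unfolding tp_gens_def using x assms by blast
    finally show ?case by (rule tp_gens_rel)
  next
    case (diff a b)
    have "lact (p \<oplus> q) (a - b) - (lact p (a - b) + lact q (a - b)) =
       (lact (p \<oplus> q) a - (lact p a + lact q a)) - (lact (p \<oplus> q) b - (lact p b + lact q b))"
      by (simp add: frag_extend_diff)
    with diff show ?case by (simp only: tp_rel_diff)
  qed (simp add: tp_rel_0)
  then have "cls (lact (p \<oplus> q) g) = cls (lact p g + lact q g)"
    using g assms by (intro cls_eqI lact_chains chains_add) auto
  with g assms show ?thesis by (simp only: tp_act_cls TP_add lact_chains a_closed)
qed

lemma tp_act_central:
  assumes "s \<in> S" "t \<in> S" "\<And>u. act s u = act t u" "w \<in> carrier TP"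
    "\<And>q. q \<in> carrier N \<Longrightarrow> s \<otimes> q = q \<otimes> s" "\<And>q. q \<in> carrier N \<Longrightarrow> t \<otimes> q = q \<otimes> t"
  shows "tp_act N S act s w = tp_act N S act t w"
proof -
  obtain g where g: "g \<in> chains" "w = cls g" using assms(4) by (rule TP_cases)
  have st: "s \<in> carrier N" "t \<in> carrier N" using assms S_carrier by auto
  have "Poly_Mapping.keys g \<subseteq> carrier N \<times> UNIV" using g by simp
  then have "lact s g - lact t g \<in> tp_rel N S act"
  proof (induction rule: frag_induction)
    case (one x)
    obtain r u where x: "x = (r, u)" "r \<in> carrier N" using one by (cases x) auto
    have "frag_of (r \<otimes> s, u) - frag_of (r, act s u) \<in> tp_gens"
      "frag_of (r \<otimes> t, u) - frag_of (r, act t u) \<in> tp_gens"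
      unfolding tp_gens_def using x assms by blast+
    then have "(frag_of (r \<otimes> s, u) - frag_of (r, act s u)) - (frag_of (r \<otimes> t, u) - frag_of (r, act t u))
      \<in> tp_rel N S act"
      by (intro tp_rel_diff tp_gens_rel)
    then show ?case using x assms by simp
  next
    case (diff a b)
    have "lact s (a - b) - lact t (a - b) = (lact s a - lact t a) - (lact s b - lact t b)"
      by (simp add: frag_extend_diff)
    with diff show ?case by (simp only: tp_rel_diff)
  qed (simp add: tp_rel_0)
  then have "cls (lact s g) = cls (lact t g)"
    using g st by (intro cls_eqI lact_chains) auto
  with g st show ?thesis by (simp only: tp_act_cls)
qed

end

end

section \<open>The algebra \<open>N\<^sup>t\<^sup>w\<close> as a quotient of the free algebra\<close>

lemma poly_mapping_add_induct [case_names zero add]: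
  fixes f :: "'a \<Rightarrow>\<^sub>0 'b::comm_monoid_add"
  assumes "P 0" "\<And>k v f. P f \<Longrightarrow> P (Poly_Mapping.single k v + f)"
  shows "P f"
proof (induction f rule: update_induct)
  case const
  show ?case by (rule assms(1))
next
  case (update f a b)
  have "Poly_Mapping.update a b f = Poly_Mapping.single a b + f"
    using update by (intro poly_mapping_eqI) (auto simp: lookup_update lookup_add lookup_single when_def in_keys_iff)
  with update assms(2) show ?case by simp
qed

abbreviation fconst :: "complex \<Rightarrow> 'v free_alg" where "fconst c \<equiv> Poly_Mapping.single 0 c"
abbreviation fgen :: "'v \<Rightarrow> 'v free_alg" where "fgen v \<equiv> Poly_Mapping.single (Word [v]) 1"

lemma free_alg_simps [simp]:
  "carrier free_alg = UNIV" "x \<otimes>\<^bsub>free_alg\<^esub> y = x * y" "x \<oplus>\<^bsub>free_alg\<^esub> y = x + y"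
  "\<one>\<^bsub>free_alg\<^esub> = 1" "\<zero>\<^bsub>free_alg\<^esub> = 0"
  by (simp_all add: free_alg_def)

lemma ring_free_alg: "ring free_alg"
proof (intro ringI abelian_groupI monoidI)
  show "\<exists>y\<in>carrier free_alg. y \<oplus>\<^bsub>free_alg\<^esub> x = \<zero>\<^bsub>free_alg\<^esub>" for x :: "'a free_alg"
    by (auto intro!: exI[of _ "- x"])
qed (auto simp: algebra_simps)

lemma a_inv_free_alg [simp]: "\<ominus>\<^bsub>free_alg\<^esub> x = - x"
proof -
  interpret ring free_alg by (rule ring_free_alg)
  show ?thesis by (rule minus_equality) auto
qed

lemma fconst_central: "fconst c * f = f * fconst c"
proof (induction f rule: poly_mapping_add_induct)
  case (add k v f)
  then show ?case by (simp add: distrib_left distrib_right mult_single mult.commute)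
qed simp

locale twisted =
  fixes sc :: "complex \<Rightarrow> 'h::ab_group_add \<Rightarrow> 'h" and form :: "'h \<Rightarrow> 'h \<Rightarrow> complex"
begin

abbreviation I1 where "I1 \<equiv> tensor_ideal (hhat_scale sc)"
abbreviation T where "T \<equiv> tensor_alg (hhat_scale sc)"
abbreviation I2 where "I2 \<equiv> Ntw_ideal sc form"
abbreviation N where "N \<equiv> Ntw sc form"

definition to_T :: "'h hhat free_alg \<Rightarrow> 'h hhat free_alg set" where
  "to_T f = I1 +>\<^bsub>free_alg\<^esub> f"

definition to_N :: "'h hhat free_alg \<Rightarrow> 'h Ntw" where
  "to_N f = Ntw_class sc form (to_T f)"

lemma ideal_I1: "ideal I1 free_alg"
  unfolding tensor_ideal_def by (rule ring.genideal_ideal[OF ring_free_alg]) simp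

lemma ring_T: "ring T"
  unfolding tensor_alg_def by (rule ideal.quotient_is_ring[OF ideal_I1])

lemma to_T_hom: "ring_hom_ring free_alg T to_T"
  unfolding tensor_alg_def to_T_def[abs_def] by (rule ideal.rcos_ring_hom_ring[OF ideal_I1])

lemma to_T_ops:
  "to_T f \<in> carrier T" "to_T f \<otimes>\<^bsub>T\<^esub> to_T g = to_T (f * g)"
  "to_T f \<ominus>\<^bsub>T\<^esub> to_T g = to_T (f - g)"
proof -
  interpret ring_hom_ring free_alg T to_T by (rule to_T_hom)
  show "to_T f \<in> carrier T" by simp
  show "to_T f \<otimes>\<^bsub>T\<^esub> to_T g = to_T (f * g)" using hom_mult[of f g] by simp
  show "to_T f \<ominus>\<^bsub>T\<^esub> to_T g = to_T (f - g)"
    using hom_add[of f "- g"] hom_a_inv[of g] by (simp add: a_minus_def)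
qed

lemma to_T_surj: "carrier T = range to_T"
  by (auto simp: tensor_alg_def FactRing_def A_RCOSETS_def' to_T_def)

lemma tensor_to_T:
  "tensor_emb (hhat_scale sc) v = to_T (fgen v)" "tensor_const (hhat_scale sc) c = to_T (fconst c)"
  by (simp_all add: tensor_emb_def tensor_const_def to_T_def)

lemma T_comm_to_T: "T_comm sc p q (to_T f) (to_T g) = to_T (f * g - fconst ((-1) ^ (p * q)) * (g * f))"
  by (simp add: T_comm_def Let_def tensor_to_T to_T_ops)

lemma tw_rels_carrier: "tw_rels sc form \<subseteq> carrier T"
  unfolding tw_rels_def Let_def tensor_to_T T_comm_to_T to_T_ops by (auto simp: to_T_ops)

lemma ideal_I2: "ideal I2 T"
  unfolding Ntw_ideal_def by (rule ring.genideal_ideal[OF ring_T tw_rels_carrier])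

lemma ring_N: "ring N"
  unfolding Ntw_def by (rule ideal.quotient_is_ring[OF ideal_I2])

lemma class_hom: "ring_hom_ring T N (Ntw_class sc form)"
  unfolding Ntw_def Ntw_class_def[abs_def] by (rule ideal.rcos_ring_hom_ring[OF ideal_I2])

lemma to_N_ops:
  "to_N f \<in> carrier N" "to_N (f * g) = to_N f \<otimes>\<^bsub>N\<^esub> to_N g" "to_N (f + g) = to_N f \<oplus>\<^bsub>N\<^esub> to_N g"
  "to_N 1 = \<one>\<^bsub>N\<^esub>" "to_N 0 = \<zero>\<^bsub>N\<^esub>"
proof -
  interpret t: ring_hom_ring free_alg T to_T by (rule to_T_hom)
  interpret n: ring_hom_ring T N "Ntw_class sc form" by (rule class_hom)
  show "to_N f \<in> carrier N" by (simp add: to_N_def to_T_ops)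
  show "to_N (f * g) = to_N f \<otimes>\<^bsub>N\<^esub> to_N g"
    using n.hom_mult[of "to_T f" "to_T g"] by (simp add: to_N_def to_T_ops)
  show "to_N (f + g) = to_N f \<oplus>\<^bsub>N\<^esub> to_N g"
    using n.hom_add[of "to_T f" "to_T g"] t.hom_add[of f g] by (simp add: to_N_def to_T_ops)
  show "to_N 1 = \<one>\<^bsub>N\<^esub>" using t.hom_one n.hom_one by (simp add: to_N_def)
  show "to_N 0 = \<zero>\<^bsub>N\<^esub>" using t.hom_zero n.hom_zero by (simp add: to_N_def)
qed

lemma to_N_surj:
  assumes "p \<in> carrier N"
  obtains f where "p = to_N f"
proof -
  have "carrier N = Ntw_class sc form ` carrier T"
    by (auto simp: Ntw_def FactRing_def A_RCOSETS_def' Ntw_class_def)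
  with assms to_T_surj that show ?thesis by (auto simp: to_N_def)
qed

lemma N_to_N:
  "Ntw_class sc form (tensor_emb (hhat_scale sc) v) = to_N (fgen v)"
  "N_const sc form c = to_N (fconst c)"
  by (simp_all add: to_N_def tensor_to_T)

lemma to_N_rel:
  assumes "to_T f \<in> tw_rels sc form"
  shows "to_N f = \<zero>\<^bsub>N\<^esub>"
proof -
  interpret ideal I2 T by (rule ideal_I2)
  have "to_T f \<in> I2"
    unfolding Ntw_ideal_def using ring.genideal_self[OF ring_T tw_rels_carrier] assms by blast
  then show ?thesis
    unfolding to_N_def Ntw_class_def using a_rcos_const by (simp add: Ntw_def FactRing_def)
qed

lemma to_N_tensor_rel:
  assumes "f \<in> I1"
  shows "to_N f = \<zero>\<^bsub>N\<^esub>"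
proof -
  interpret ideal I1 free_alg by (rule ideal_I1)
  have "to_T f = to_T 0"
    unfolding to_T_def using a_rcos_const[OF assms] a_rcos_const[of 0] by (metis a_Hcarr free_alg_simps(5) additive_subgroup.zero_closed is_additive_subgroup)
  then show ?thesis using to_N_ops(5) by (simp add: to_N_def)
qed

end

section \<open>The module \<open>W\<close>\<close>

context twisted
begin

definition mode_elt :: "'h bf \<Rightarrow> int \<Rightarrow> 'h hhat free_alg" where
  "mode_elt a n = fgen (Poly_Mapping.single n (bf_emb a), 0, 0)"

definition kB :: "'h hhat free_alg" where "kB = fgen (0, 1, 0)"
definition kF :: "'h hhat free_alg" where "kF = fgen (0, 0, 1)"

lemma elt_to_T:
  "T_mode sc a n = to_T (mode_elt a n)" "T_kB sc = to_T kB" "T_kF sc = to_T kF"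
  by (simp_all add: tensor_to_T mode_elt_def kB_def kF_def)

lemma elt_to_N:
  "N_mode sc form a n = to_N (mode_elt a n)" "N_kB sc form = to_N kB" "N_kF sc form = to_N kF"
  by (simp_all add: N_to_N mode_elt_def kB_def kF_def)

lemma to_N_eqI:
  assumes "to_N (f - g) = \<zero>\<^bsub>N\<^esub>"
  shows "to_N f = to_N g"
proof -
  interpret ring N by (rule ring_N)
  have "to_N f = to_N (f - g) \<oplus>\<^bsub>N\<^esub> to_N g"
    using to_N_ops(3)[of "f - g" g] by simp
  then show ?thesis using assms by (simp add: to_N_ops(1))
qed

lemma to_N_eqI': "to_T (f - g) \<in> tw_rels sc form \<Longrightarrow> to_N f = to_N g"
  by (intro to_N_eqI to_N_rel)

lemma to_N_rels:
  "to_N (kB * kF) = to_N (kF * kB)"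
  "to_N (mode_elt a m * kB) = to_N (kB * mode_elt a m)"
  "to_N (mode_elt a m * kF) = to_N (kF * mode_elt a m)"
  "m \<noteq> 0 \<Longrightarrow> to_N (mode_elt a m * mode_elt b 0) =
     to_N (fconst ((-1) ^ (parity a * parity b)) * (mode_elt b 0 * mode_elt a m))"
  "\<not> is_fer a \<Longrightarrow> is_fer b \<Longrightarrow> 0 < m \<and> n < 0 \<or> m < 0 \<and> 0 < n \<Longrightarrow>
     to_N (mode_elt a m * mode_elt b n) = to_N (mode_elt b n * mode_elt a m)"
  "\<not> is_fer a \<Longrightarrow> \<not> is_fer b \<Longrightarrow> 0 < m \<Longrightarrow> n < 0 \<Longrightarrow> to_N (mode_elt a m * mode_elt b n) =
     to_N (fconst ((-1) ^ (parity a * parity b)) * (mode_elt b n * mode_elt a m) +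
       fconst (of_int m * bf_form form a b * of_bool (m + n = 0)) * kB)"
  "is_fer a \<Longrightarrow> is_fer b \<Longrightarrow> 0 < m \<Longrightarrow> n < 0 \<Longrightarrow> to_N (mode_elt a m * mode_elt b n) =
     to_N (fconst ((-1) ^ (parity a * parity b)) * (mode_elt b n * mode_elt a m) +
       fconst (bf_form form a b * of_bool (m + n = 0)) * kF)"
proof -
  have "T_comm sc 0 0 (T_kB sc) (T_kF sc) \<in> tw_rels sc form"
    unfolding tw_rels_def Let_def by blast
  then show "to_N (kB * kF) = to_N (kF * kB)"
    unfolding elt_to_T T_comm_to_T by (intro to_N_eqI') simp
  have "T_comm sc (parity a) 0 (T_mode sc a m) (T_kB sc) \<in> tw_rels sc form"
    unfolding tw_rels_def Let_def by blast
  then show "to_N (mode_elt a m * kB) = to_N (kB * mode_elt a m)"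
    unfolding elt_to_T T_comm_to_T by (intro to_N_eqI') simp
  have "T_comm sc (parity a) 0 (T_mode sc a m) (T_kF sc) \<in> tw_rels sc form"
    unfolding tw_rels_def Let_def by blast
  then show "to_N (mode_elt a m * kF) = to_N (kF * mode_elt a m)"
    unfolding elt_to_T T_comm_to_T by (intro to_N_eqI') simp
  show "to_N (mode_elt a m * mode_elt b 0) =
     to_N (fconst ((-1) ^ (parity a * parity b)) * (mode_elt b 0 * mode_elt a m))" if "m \<noteq> 0"
  proof -
    have "T_comm sc (parity a) (parity b) (T_mode sc a m) (T_mode sc b 0) \<in> tw_rels sc form"
      unfolding tw_rels_def Let_def using that by blast
    then show ?thesis unfolding elt_to_T T_comm_to_T by (rule to_N_eqI')
  qed
  show "to_N (mode_elt a m * mode_elt b n) = to_N (mode_elt b n * mode_elt a m)"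
    if "\<not> is_fer a" "is_fer b" "0 < m \<and> n < 0 \<or> m < 0 \<and> 0 < n"
  proof -
    have "T_comm sc (parity a) (parity b) (T_mode sc a m) (T_mode sc b n) \<in> tw_rels sc form"
      unfolding tw_rels_def Let_def using that by blast
    then show ?thesis unfolding elt_to_T T_comm_to_T using that by (intro to_N_eqI') simp
  qed
  show "to_N (mode_elt a m * mode_elt b n) =
     to_N (fconst ((-1) ^ (parity a * parity b)) * (mode_elt b n * mode_elt a m) +
       fconst (of_int m * bf_form form a b * of_bool (m + n = 0)) * kB)"
    if "\<not> is_fer a" "\<not> is_fer b" "0 < m" "n < 0"
  proof -
    have "T_comm sc (parity a) (parity b) (T_mode sc a m) (T_mode sc b n) \<ominus>\<^bsub>T\<^esub>
        tensor_const (hhat_scale sc) (of_int m * bf_form form a b * of_bool (m + n = 0)) \<otimes>\<^bsub>T\<^esub> T_kB sc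
        \<in> tw_rels sc form"
      unfolding tw_rels_def Let_def using that by blast
    then show ?thesis
      unfolding elt_to_T T_comm_to_T tensor_to_T(2) to_T_ops by (intro to_N_eqI') (simp only: diff_diff_eq)
  qed
  show "to_N (mode_elt a m * mode_elt b n) =
     to_N (fconst ((-1) ^ (parity a * parity b)) * (mode_elt b n * mode_elt a m) +
       fconst (bf_form form a b * of_bool (m + n = 0)) * kF)"
    if "is_fer a" "is_fer b" "0 < m" "n < 0"
  proof -
    have "T_comm sc (parity a) (parity b) (T_mode sc a m) (T_mode sc b n) \<ominus>\<^bsub>T\<^esub>
        tensor_const (hhat_scale sc) (bf_form form a b * of_bool (m + n = 0)) \<otimes>\<^bsub>T\<^esub> T_kF sc
        \<in> tw_rels sc form"
      unfolding tw_rels_def Let_def using that by blast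
    then show ?thesis
      unfolding elt_to_T T_comm_to_T tensor_to_T(2) to_T_ops by (intro to_N_eqI') (simp only: diff_diff_eq)
  qed
qed

lemma to_N_fgen_add: "to_N (fgen (u + v)) = to_N (fgen u + fgen v)"
proof -
  have "fgen (u + v) - fgen u - fgen v \<in> I1"
    unfolding tensor_ideal_def
    by (rule set_mp[OF ring.genideal_self[OF ring_free_alg]], simp, blast)
  then have "to_N (fgen (u + v) - (fgen u + fgen v)) = \<zero>\<^bsub>N\<^esub>"
    by (intro to_N_tensor_rel) (simp add: diff_diff_eq)
  then show ?thesis by (rule to_N_eqI)
qed

lemma to_N_fgen_scale: "to_N (fgen (hhat_scale sc c v)) = to_N (fconst c * fgen v)"
proof -
  have "fgen (hhat_scale sc c v) - Poly_Mapping.single (Word [v]) c \<in> I1"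
    unfolding tensor_ideal_def
    by (rule set_mp[OF ring.genideal_self[OF ring_free_alg]], simp, blast)
  then have "to_N (fgen (hhat_scale sc c v) - fconst c * fgen v) = \<zero>\<^bsub>N\<^esub>"
    by (intro to_N_tensor_rel) (simp add: mult_single)
  then show ?thesis by (rule to_N_eqI)
qed

lemma poly_mapping_map_zero [simp]: "Poly_Mapping.map g 0 = 0"
  by (rule poly_mapping_eqI) (simp add: map.rep_eq)

lemma to_N_commute:
  assumes "\<And>a m. to_N (mode_elt a m * k) = to_N (k * mode_elt a m)"
    "to_N (kB * k) = to_N (k * kB)" "to_N (kF * k) = to_N (k * kF)"
  shows "to_N (f * k) = to_N (k * f)"
proof -
  interpret N: ring N by (rule ring_N)
  define comm where "comm f \<longleftrightarrow> to_N f \<otimes>\<^bsub>N\<^esub> to_N k = to_N k \<otimes>\<^bsub>N\<^esub> to_N f" for f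
  have comm_alt: "comm f \<longleftrightarrow> to_N (f * k) = to_N (k * f)" for f
    by (simp add: comm_def to_N_ops)
  have plus: "comm (f + g)" if "comm f" "comm g" for f g
    using that by (simp add: comm_def to_N_ops N.l_distr N.r_distr)
  have mult: "comm (f * g)" if "comm f" "comm g" for f g
  proof -
    have "to_N (f * g) \<otimes>\<^bsub>N\<^esub> to_N k = to_N f \<otimes>\<^bsub>N\<^esub> (to_N g \<otimes>\<^bsub>N\<^esub> to_N k)"
      by (simp add: to_N_ops N.m_assoc)
    also have "\<dots> = to_N f \<otimes>\<^bsub>N\<^esub> (to_N k \<otimes>\<^bsub>N\<^esub> to_N g)"
      using that(2) by (simp only: comm_def)
    also have "\<dots> = (to_N f \<otimes>\<^bsub>N\<^esub> to_N k) \<otimes>\<^bsub>N\<^esub> to_N g"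
      by (simp add: to_N_ops(1) N.m_assoc)
    also have "\<dots> = (to_N k \<otimes>\<^bsub>N\<^esub> to_N f) \<otimes>\<^bsub>N\<^esub> to_N g"
      using that(1) by (simp only: comm_def)
    also have "\<dots> = to_N k \<otimes>\<^bsub>N\<^esub> to_N (f * g)"
      by (simp add: to_N_ops(1,2) N.m_assoc)
    finally show ?thesis by (simp add: comm_def)
  qed
  have cong: "comm f" if "to_N f = to_N g" "comm g" for f g
    using that by (simp add: comm_def)
  have const: "comm (fconst c)" for c
    by (simp add: comm_alt fconst_central)
  have gen_add: "comm (fgen (u + v))" if "comm (fgen u)" "comm (fgen v)" for u v
    by (rule cong[OF to_N_fgen_add plus[OF that]])
  have gen_scale: "comm (fgen (hhat_scale sc c v))" if "comm (fgen v)" for c v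
    by (rule cong[OF to_N_fgen_scale mult[OF const that]])
  have kB: "comm (fgen (0, 1, 0))" and kF: "comm (fgen (0, 0, 1))"
    and mode: "comm (fgen (Poly_Mapping.single n (bf_emb a), 0, 0))" for a n
    using assms unfolding comm_alt kB_def kF_def mode_elt_def by auto
  have laurent: "comm (fgen (g, 0, 0))" for g
  proof (induction g rule: poly_mapping_add_induct)
    case zero
    show ?case using gen_scale[OF kB, of 0] by (simp add: hhat_scale_def)
  next
    case (add n v g)
    obtain u w where v: "v = (u, w)" by (cases v)
    have "(Poly_Mapping.single n v + g, 0, 0) = ((Poly_Mapping.single n (bf_emb (Bos u)), 0, 0) +
       ((Poly_Mapping.single n (bf_emb (Fer w)), 0, 0) + (g, 0, 0)) :: 'h hhat)"
      by (simp add: v single_add[symmetric] add.assoc[symmetric])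
    then show ?case using gen_add[OF mode gen_add[OF mode add.IH]] by metis
  qed
  have gen: "comm (fgen v)" for v
  proof -
    obtain g x y where v: "v = (g, x, y)" by (cases v)
    have "v = (g, 0, 0) + (hhat_scale sc x (0, 1, 0) + hhat_scale sc y (0, 0, 1))"
      by (simp add: v hhat_scale_def)
    then show ?thesis using gen_add[OF laurent gen_add[OF gen_scale[OF kB] gen_scale[OF kF]]] by metis
  qed
  have word: "comm (Poly_Mapping.single (Word l) 1)" for l
  proof (induction l)
    case Nil
    show ?case using const[of 1] by (simp add: zero_word_def)
  next
    case (Cons v l)
    have "Poly_Mapping.single (Word (v # l)) 1 = fgen v * (Poly_Mapping.single (Word l) 1 :: 'h hhat free_alg)"
      by (simp add: mult_single plus_word_def)
    with mult[OF gen Cons] show ?case by metis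
  qed
  have "comm f"
  proof (induction f rule: poly_mapping_add_induct)
    case zero
    show ?case using const[of 0] by simp
  next
    case (add w c f)
    have "Poly_Mapping.single w c = fconst c * (Poly_Mapping.single (Word (letters w)) 1 :: 'h hhat free_alg)"
      by (simp add: mult_single)
    then have "comm (Poly_Mapping.single w c)" using mult[OF const word] by metis
    then show ?case using add.IH plus by blast
  qed
  then show ?thesis by (simp add: comm_alt)
qed

lemma kB_central: "to_N (f * kB) = to_N (kB * f)"
  by (rule to_N_commute) (simp_all add: to_N_rels)

lemma kF_central: "to_N (f * kF) = to_N (kF * f)"
  by (rule to_N_commute) (simp_all add: to_N_rels)

lemma Ntw_ge0_carrier: "Ntw_ge0 sc form \<subseteq> carrier N"
  unfolding Ntw_ge0_def
  by (rule ring.generate_ring_incl[OF ring_N]) (auto simp: N_to_N elt_to_N to_N_ops(1))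

lemma Ntw_ge0_const: "to_N (fconst c) \<in> Ntw_ge0 sc form"
  unfolding Ntw_ge0_def by (rule generate_ring.incl) (auto simp: N_to_N)

lemma Ntw_ge0_k: "to_N kB \<in> Ntw_ge0 sc form" "to_N kF \<in> Ntw_ge0 sc form"
  unfolding Ntw_ge0_def by (auto intro!: generate_ring.incl simp: elt_to_N)

end

locale twisted_module = twisted sc form
  for sc :: "complex \<Rightarrow> 'h::ab_group_add \<Rightarrow> 'h" and form :: "'h \<Rightarrow> 'h \<Rightarrow> complex" +
  fixes lB lF :: complex and scM :: "complex \<Rightarrow> 'm::ab_group_add \<Rightarrow> 'm"
    and actT :: "('h \<times> 'h) free_alg set \<Rightarrow> 'm \<Rightarrow> 'm" and act0 :: "'h Ntw \<Rightarrow> 'm \<Rightarrow> 'm"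
  assumes induced: "induced_ge0_action sc form lB lF scM actT act0"
begin

sublocale tp: tensor_module N "Ntw_ge0 sc form" act0
proof -
  interpret ring N by (rule ring_N)
  show "tensor_module N (Ntw_ge0 sc form)"
    by standard (rule Ntw_ge0_carrier)
qed

abbreviation W where "W \<equiv> Wtw sc form act0"

definition elt_act :: "'h hhat free_alg \<Rightarrow> ('h, 'm) Wtw \<Rightarrow> ('h, 'm) Wtw" where
  "elt_act f = tp_act N (Ntw_ge0 sc form) act0 (to_N f)"

lemma W_smult: "z \<odot>\<^bsub>W\<^esub> w = elt_act (fconst z) w"
  by (simp add: Wtw_def tp.TP_simps elt_act_def N_to_N)

lemma W_mode_eq: "W_mode sc form act0 a n = elt_act (mode_elt a n)"
  by (simp add: W_mode_def elt_act_def elt_to_N)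

lemma elt_act_closed: "w \<in> carrier W \<Longrightarrow> elt_act f w \<in> carrier W"
  unfolding Wtw_def elt_act_def by (rule tp.tp_act_closed[OF to_N_ops(1)])

lemma elt_act_add:
  "v \<in> carrier W \<Longrightarrow> w \<in> carrier W \<Longrightarrow> elt_act f (v \<oplus>\<^bsub>W\<^esub> w) = elt_act f v \<oplus>\<^bsub>W\<^esub> elt_act f w"
  unfolding Wtw_def elt_act_def by (rule tp.tp_act_add[OF to_N_ops(1)])

lemma elt_act_mult: "w \<in> carrier W \<Longrightarrow> elt_act (f * g) w = elt_act f (elt_act g w)"
  unfolding Wtw_def elt_act_def to_N_ops(2) by (rule tp.tp_act_mult[OF to_N_ops(1) to_N_ops(1)])

lemma elt_act_plus: "w \<in> carrier W \<Longrightarrow> elt_act (f + g) w = elt_act f w \<oplus>\<^bsub>W\<^esub> elt_act g w"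
  unfolding Wtw_def elt_act_def to_N_ops(3) by (rule tp.tp_act_plus[OF to_N_ops(1) to_N_ops(1)])

lemma elt_act_one: "w \<in> carrier W \<Longrightarrow> elt_act 1 w = w"
  unfolding Wtw_def elt_act_def to_N_ops(4) by (rule tp.tp_act_one)

lemma elt_act_cong: "to_N f = to_N g \<Longrightarrow> elt_act f w = elt_act g w"
  by (simp add: elt_act_def)

sublocale complex_space W
proof -
  interpret abelian_group W unfolding Wtw_def by (rule tp.abelian_group_TP)
  show "complex_space W"
    by standard (simp_all add: W_smult elt_act_closed elt_act_add single_add elt_act_plus
      elt_act_mult[symmetric] mult_single elt_act_one)
qed

lemma act0_const: "act0 (to_N (fconst c)) u = scM c u"
  using induced unfolding induced_ge0_action_def left_module_def by (simp add: N_to_N)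

lemma elt_act_k:
  assumes "w \<in> carrier W"
  shows "elt_act kB w = lB \<odot>\<^bsub>W\<^esub> w" "elt_act kF w = lF \<odot>\<^bsub>W\<^esub> w"
proof -
  have k: "act0 (to_N kB) u = act0 (to_N (fconst lB)) u" "act0 (to_N kF) u = act0 (to_N (fconst lF)) u" for u
    using induced unfolding induced_ge0_action_def act0_const by (simp_all add: elt_to_N)
  have central: "to_N k \<otimes>\<^bsub>N\<^esub> q = q \<otimes>\<^bsub>N\<^esub> to_N k"
    if "q \<in> carrier N" "\<And>f. to_N (f * k) = to_N (k * f)" for q k
    using that by (metis to_N_surj to_N_ops(2))
  have c: "to_N (f * fconst z) = to_N (fconst z * f)" for f z
    by (simp add: fconst_central)
  note w = assms[unfolded Wtw_def]
  show "elt_act kB w = lB \<odot>\<^bsub>W\<^esub> w"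
    unfolding W_smult unfolding elt_act_def
    by (rule tp.tp_act_central[OF Ntw_ge0_k(1) Ntw_ge0_const k(1) w
          central[OF _ kB_central] central[OF _ c]])
  show "elt_act kF w = lF \<odot>\<^bsub>W\<^esub> w"
    unfolding W_smult unfolding elt_act_def
    by (rule tp.tp_act_central[OF Ntw_ge0_k(2) Ntw_ge0_const k(2) w
          central[OF _ kF_central] central[OF _ c]])
qed

lemma elt_act_exchange:
  assumes "to_N (x * y) = to_N (fconst e * (y * x) + fconst d * k)"
    "w \<in> carrier W" "elt_act k w = l \<odot>\<^bsub>W\<^esub> w"
  shows "elt_act x (elt_act y w) = e \<odot>\<^bsub>W\<^esub> elt_act y (elt_act x w) \<oplus>\<^bsub>W\<^esub> (l * d) \<odot>\<^bsub>W\<^esub> w"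
proof -
  have "elt_act x (elt_act y w) = elt_act (fconst e * (y * x) + fconst d * k) w"
    using elt_act_cong[OF assms(1), of w] assms(2) by (simp add: elt_act_mult)
  also have "\<dots> = e \<odot>\<^bsub>W\<^esub> elt_act y (elt_act x w) \<oplus>\<^bsub>W\<^esub> d \<odot>\<^bsub>W\<^esub> (l \<odot>\<^bsub>W\<^esub> w)"
    using assms(2,3) by (simp add: elt_act_mult elt_act_plus W_smult[symmetric])
  also have "d \<odot>\<^bsub>W\<^esub> (l \<odot>\<^bsub>W\<^esub> w) = (l * d) \<odot>\<^bsub>W\<^esub> w"
    using assms(2) by (simp add: smult_smult mult.commute)
  finally show ?thesis .
qed

lemma elt_act_commute:
  assumes "to_N (x * y) = to_N (fconst e * (y * x))" "w \<in> carrier W"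
  shows "elt_act x (elt_act y w) = e \<odot>\<^bsub>W\<^esub> elt_act y (elt_act x w) \<oplus>\<^bsub>W\<^esub> 0 \<odot>\<^bsub>W\<^esub> w"
  using elt_act_exchange[of x y e 0 1 w 1] assms by (simp add: elt_act_one smult_1)

sublocale mode_space W form lB lF "W_mode sc form act0"
proof -
  interpret mode_contraction form lB lF .
  have ex: "elt_act (mode_elt a n) (elt_act (mode_elt b m) u) =
      eps (a, n) (b, m) \<odot>\<^bsub>W\<^esub> elt_act (mode_elt b m) (elt_act (mode_elt a n) u)
      \<oplus>\<^bsub>W\<^esub> mctr (a, n) (b, m) \<odot>\<^bsub>W\<^esub> u"
    if u: "u \<in> carrier W" and nm: "0 \<le> n" "m < 0 \<or> (n = 0 \<and> m \<noteq> 0)" for a b n m u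
  proof -
    have sign: "(-1) ^ (parity a * parity b) = eps (a, n) (b, m)"
      by (simp add: eps_def)
    have rev: "to_N (x * y) = to_N (fconst e * (y * x))"
      if "to_N (y * x) = to_N (fconst e * (x * y))" "e * e = 1" for x y e
    proof -
      have "to_N (fconst e * (y * x)) = to_N (fconst e * (fconst e * (x * y)))"
        using that(1) by (simp only: to_N_ops(2))
      also have "fconst e * (fconst e * (x * y)) = x * y"
        using that(2) by (simp add: mult.assoc[symmetric] mult_single)
      finally show ?thesis by simp
    qed
    show ?thesis
    proof (cases "n = 0")
      case True
      then have "m \<noteq> 0" using nm by auto
      have "(-1) ^ (parity b * parity a) = eps (a, n) (b, m)"
        by (simp add: eps_def)
      with to_N_rels(4)[OF \<open>m \<noteq> 0\<close>, of b a]
      have "to_N (mode_elt b m * mode_elt a 0) = to_N (fconst (eps (a, n) (b, m)) * (mode_elt a 0 * mode_elt b m))"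
        by (simp only:)
      from elt_act_commute[OF rev[OF this] u] True \<open>m \<noteq> 0\<close> show ?thesis
        by (simp add: mode_contr_def)
    next
      case False
      then have n: "0 < n" "m < 0" using nm by auto
      show ?thesis
      proof (cases "is_fer a"; cases "is_fer b")
        assume ab: "is_fer a" "is_fer b"
        from elt_act_exchange[OF to_N_rels(7)[OF this n] u elt_act_k(2)[OF u]] ab n
        show ?thesis unfolding sign by (simp add: mode_contr_def)
      next
        assume ab: "is_fer a" "\<not> is_fer b"
        have "to_N (mode_elt a n * mode_elt b m) = to_N (fconst 1 * (mode_elt b m * mode_elt a n))"
          using to_N_rels(5)[OF ab(2,1), of m n] n by simp
        moreover have "mctr (a, n) (b, m) = 0" "eps (a, n) (b, m) = 1"
          using ab c_parity[of "(a, n)" "(b, m)"] by (auto simp: eps_def)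
        ultimately show ?thesis using elt_act_commute[OF _ u] by metis
      next
        assume ab: "\<not> is_fer a" "is_fer b"
        have "to_N (mode_elt a n * mode_elt b m) = to_N (fconst 1 * (mode_elt b m * mode_elt a n))"
          using to_N_rels(5)[OF ab, of n m] n by simp
        moreover have "mctr (a, n) (b, m) = 0" "eps (a, n) (b, m) = 1"
          using ab c_parity[of "(a, n)" "(b, m)"] by (auto simp: eps_def)
        ultimately show ?thesis using elt_act_commute[OF _ u] by metis
      next
        assume ab: "\<not> is_fer a" "\<not> is_fer b"
        from elt_act_exchange[OF to_N_rels(6)[OF this n] u elt_act_k(1)[OF u]] ab n
        show ?thesis unfolding sign by (simp add: mode_contr_def mult.commute mult.left_commute)
      qed
    qed
  qed
  show "mode_space W form lB lF (W_mode sc form act0)"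
    unfolding W_mode_eq[abs_def]
  proof
    show "elt_act (mode_elt a n) (z \<odot>\<^bsub>W\<^esub> u) = z \<odot>\<^bsub>W\<^esub> elt_act (mode_elt a n) u"
      if "u \<in> carrier W" for a n z u
      using that by (simp add: W_smult elt_act_mult[symmetric] fconst_central)
  qed (simp_all add: elt_act_closed elt_act_add ex)
qed

end

section \<open>The Wick theorem for fields\<close>

lemma finite_incr_tuples: "finite A \<Longrightarrow> finite (incr_tuples A k)"
  by (rule finite_subset[OF _ finite_lists_length_eq[of A k]]) (auto simp: incr_tuples_def)

lemma sum_incr_tuples:
  fixes h :: "nat set \<Rightarrow> nat set \<Rightarrow> complex"
  assumes fin: "finite X" "finite Y"
    and h: "\<And>B C. B \<subseteq> X \<Longrightarrow> C \<subseteq> Y \<Longrightarrow> card B \<noteq> card C \<Longrightarrow> h B C = 0"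
    and K: "min (card X) (card Y) \<le> K"
  shows "(\<Sum>k\<in>{0..K}. \<Sum>(I, J)\<in>incr_tuples X k \<times> incr_tuples Y k. h (set I) (set J)) =
    (\<Sum>B\<in>Pow X. \<Sum>C\<in>Pow Y. h B C)"
proof -
  have "(\<Sum>k\<in>{0..K}. \<Sum>(I, J)\<in>incr_tuples X k \<times> incr_tuples Y k. h (set I) (set J)) =
     (\<Sum>(k, I, J)\<in>Sigma {0..K} (\<lambda>k. incr_tuples X k \<times> incr_tuples Y k). h (set I) (set J))"
    using fin by (subst sum.Sigma) (auto simp: finite_incr_tuples)
  also have "\<dots> = (\<Sum>(B, C)\<in>{(B, C). B \<subseteq> X \<and> C \<subseteq> Y \<and> card B = card C}. h B C)"
  proof (rule sum.reindex_bij_witness[where j = "\<lambda>(k, I, J). (set I, set J)"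
        and i = "\<lambda>(B, C). (card B, sorted_list_of_set B, sorted_list_of_set C)"])
    fix p assume "p \<in> Sigma {0..K} (\<lambda>k. incr_tuples X k \<times> incr_tuples Y k)"
    then obtain k I J where p: "p = (k, I, J)" "I \<in> incr_tuples X k" "J \<in> incr_tuples Y k" by auto
    then have "distinct I" "distinct J" and s: "sorted_list_of_set (set I) = I" "sorted_list_of_set (set J) = J"
      by (auto simp: incr_tuples_def strict_sorted_iff sorted_list_of_set.idem_if_sorted_distinct)
    with p have "card (set I) = k" "card (set J) = k"
      by (auto simp: distinct_card incr_tuples_def)
    with p s show "(\<lambda>(B, C). (card B, sorted_list_of_set B, sorted_list_of_set C))
        ((\<lambda>(k, I, J). (set I, set J)) p) = p"
      and "(\<lambda>(k, I, J). (set I, set J)) p \<in> {(B, C). B \<subseteq> X \<and> C \<subseteq> Y \<and> card B = card C}"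
      by (auto simp: incr_tuples_def)
  next
    fix q assume "q \<in> {(B, C). B \<subseteq> X \<and> C \<subseteq> Y \<and> card B = card C}"
    then obtain B C where q: "q = (B, C)" "B \<subseteq> X" "C \<subseteq> Y" "card B = card C" by auto
    then have f: "finite B" "finite C" using fin finite_subset by auto
    have "card B \<le> K"
      using card_mono[OF fin(1) q(2)] card_mono[OF fin(2) q(3)] q(4) K by linarith
    with q f show "(\<lambda>(k, I, J). (set I, set J))
        ((\<lambda>(B, C). (card B, sorted_list_of_set B, sorted_list_of_set C)) q) = q"
      and "(\<lambda>(B, C). (card B, sorted_list_of_set B, sorted_list_of_set C)) q
        \<in> Sigma {0..K} (\<lambda>k. incr_tuples X k \<times> incr_tuples Y k)"
      by (auto simp: incr_tuples_def)
  qed auto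
  also have "\<dots> = (\<Sum>(B, C)\<in>Pow X \<times> Pow Y. h B C)"
    using fin h by (intro sum.mono_neutral_left) auto
  also have "\<dots> = (\<Sum>B\<in>Pow X. \<Sum>C\<in>Pow Y. h B C)"
    using fin by (subst sum.Sigma) auto
  finally show ?thesis .
qed

lemma sum_Pow_filter:
  fixes g :: "nat set \<Rightarrow> nat set \<Rightarrow> complex"
  assumes "finite S"
  shows "(\<Sum>I\<in>Pow S. g {i \<in> I. \<not> P i} {i \<in> I. P i}) =
    (\<Sum>B\<in>Pow {i \<in> S. \<not> P i}. \<Sum>F\<in>Pow {i \<in> S. P i}. g B F)"
proof -
  have "(\<Sum>I\<in>Pow S. g {i \<in> I. \<not> P i} {i \<in> I. P i}) =
      (\<Sum>(B, F)\<in>Pow {i \<in> S. \<not> P i} \<times> Pow {i \<in> S. P i}. g B F)"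
  proof (rule sum.reindex_bij_witness[where j = "\<lambda>I. ({i \<in> I. \<not> P i}, {i \<in> I. P i})"
        and i = "\<lambda>(B, F). B \<union> F"])
    fix q assume "q \<in> Pow {i \<in> S. \<not> P i} \<times> Pow {i \<in> S. P i}"
    then obtain B F where q: "q = (B, F)" "B \<subseteq> {i \<in> S. \<not> P i}" "F \<subseteq> {i \<in> S. P i}" by auto
    then have "{i \<in> B \<union> F. \<not> P i} = B" "{i \<in> B \<union> F. P i} = F" by blast+
    with q show "(\<lambda>I. ({i \<in> I. \<not> P i}, {i \<in> I. P i})) ((\<lambda>(B, F). B \<union> F) q) = q" by simp
    show "(\<lambda>(B, F). B \<union> F) q \<in> Pow S" using q by auto
  qed auto
  also have "\<dots> = (\<Sum>B\<in>Pow {i \<in> S. \<not> P i}. \<Sum>F\<in>Pow {i \<in> S. P i}. g B F)"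
    using assms by (subst sum.Sigma) auto
  finally show ?thesis .
qed

definition field_vars :: "('h bf \<times> nat \<times> var) list \<Rightarrow> var set" where
  "field_vars fs = set (map (snd \<circ> snd) fs)"

definition fields_coeff :: "('h bf \<times> nat \<times> var) list \<Rightarrow> expo \<Rightarrow> complex" where
  "fields_coeff fs e = (if fs_supported (field_vars fs) e then \<Prod>(a, k, v)\<leftarrow>fs. field_coeff a k (e v) else 0)"

definition fields_modes :: "('h bf \<times> nat \<times> var) list \<Rightarrow> expo \<Rightarrow> ('h bf \<times> int) list" where
  "fields_modes fs e = map (\<lambda>(a, k, v). (a, mode_index a k (e v))) fs"

lemma fields_modes_restrict:
  "field_vars fs \<subseteq> S \<Longrightarrow> fields_modes fs (fs_restrict e S) = fields_modes fs e"
  by (force simp: fields_modes_def field_vars_def fs_restrict_def)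

lemma fields_coeff_restrict:
  "field_vars fs \<subseteq> S \<Longrightarrow> (\<Prod>(a, k, v)\<leftarrow>fs. field_coeff a k (fs_restrict e S v)) =
    (\<Prod>(a, k, v)\<leftarrow>fs. field_coeff a k (e v))"
  by (intro arg_cong[of _ _ prod_list] map_cong) (force simp: field_vars_def fs_restrict_def)+

context complex_space
begin

lemma foldr_add_smult:
  "(\<And>i. i \<in> set l \<Longrightarrow> f i \<in> carrier W) \<Longrightarrow> u \<in> carrier W \<Longrightarrow>
    foldr (\<oplus>) (map (\<lambda>i. z \<odot> f i) l) (z \<odot> u) = z \<odot> foldr (\<oplus>) (map f l) u \<and>
    foldr (\<oplus>) (map f l) u \<in> carrier W"
  by (induction l) (auto simp: smult_add)

end

context mode_space
begin

abbreviation NO where "NO \<equiv> no_fields W md form lF"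

lemma ops_smult: "u \<in> carrier W \<Longrightarrow> ops l (z \<odot> u) = z \<odot> ops l u"
  by (induction l) (auto simp: md_smult)

lemma nz_smult: "u \<in> carrier W \<Longrightarrow> nz l (z \<odot> u) = z \<odot> nz l u"
proof (induction l rule: length_induct)
  case (1 l)
  show ?case
  proof (cases l)
    case (Cons a l')
    then have IH: "nz l' (z \<odot> u) = z \<odot> nz l' u"
      "\<And>i. i < length l' \<Longrightarrow> nz (delete_nth i l') (z \<odot> u) = z \<odot> nz (delete_nth i l') u"
      using 1 by auto
    show ?thesis
    proof (cases "is_fer a")
      case True
      let ?c = "\<lambda>i. (- 1) ^ (count_fer (a # take (Suc i) l') - 1) / 2 * lF * bf_form form a (l' ! i)"
      let ?l = "filter (\<lambda>i. is_fer (l' ! i)) [0..<length l']"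
      have *: "map (\<lambda>i. ?c i \<odot> nz (delete_nth i l') (z \<odot> u)) ?l =
          map (\<lambda>i. z \<odot> (?c i \<odot> nz (delete_nth i l') u)) ?l"
        using 1(2) IH(2) by (auto simp: smult_smult mult.commute)
      have "foldr (\<oplus>) (map (\<lambda>i. z \<odot> (?c i \<odot> nz (delete_nth i l') u)) ?l) (z \<odot> md a 0 (nz l' u)) =
          z \<odot> foldr (\<oplus>) (map (\<lambda>i. ?c i \<odot> nz (delete_nth i l') u) ?l) (md a 0 (nz l' u))"
        using foldr_add_smult[of ?l "\<lambda>i. ?c i \<odot> nz (delete_nth i l') u" "md a 0 (nz l' u)" z] 1(2) by auto
      with True Cons show ?thesis
        using 1(2) by (simp only: no_zero.simps if_True * IH(1) md_smult nz_closed)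
    qed (use Cons IH 1(2) in \<open>simp add: md_smult\<close>)
  qed simp
qed

lemma nord_smult: "u \<in> carrier W \<Longrightarrow> nord l (z \<odot> u) = z \<odot> nord l u"
  by (simp add: normal_order_def nz_smult ops_smult[of _ "_ @ _", simplified] ops_smult smult_smult mult.commute)

lemma nord_zero: "nord l \<zero> = \<zero>"
  using nord_smult[of \<zero> l 0] by (simp add: smult_0)

lemma smult_zero: "z \<odot> \<zero> = \<zero>"
  using finsum_smult[of "{}" "\<lambda>i. i" z] by simp

lemma NO_closed: "w \<in> carrier W \<Longrightarrow> NO fs e w \<in> carrier W"
  unfolding no_fields_def by (rule finsum_closed) auto

lemma NO_apply:
  assumes "distinct (map (snd \<circ> snd) fs)" "w \<in> carrier W"
  shows "NO fs e w = fields_coeff fs e \<odot> nord (fields_modes fs e) w"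
proof -
  let ?n = "map (\<lambda>(a, k, v). mode_index a k (e v)) fs"
  have z: "zip (map fst fs) ?n = fields_modes fs e"
    by (induction fs) (auto simp: fields_modes_def)
  have n: "fs_prod (map2 mode_coeff fs ?n) e = fields_coeff fs e"
    using mode_coeff_prod[OF assms(1), of ?n e] by (simp add: fields_coeff_def field_vars_def)
  have "{ns. length ns = length fs \<and> fs_prod (map2 mode_coeff fs ns) e \<noteq> 0} =
      (if fields_coeff fs e \<noteq> 0 then {?n} else {})"
    using mode_coeff_prod[OF assms(1), of _ e] n by (auto split: if_splits)
  then show ?thesis
    unfolding no_fields_def using assms(2) n z by (auto simp: smult_0)
qed

lemma NO_nonzero:
  assumes "distinct (map (snd \<circ> snd) fs)" "op_nonzero W (NO fs e)"
  shows "fs_supported (field_vars fs) e"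
  using assms unfolding op_nonzero_def
  by (auto simp: NO_apply fields_coeff_def smult_0 split: if_splits)

lemma os_mult_NO:
  assumes d: "distinct (map (snd \<circ> snd) (fa @ fb))" and w: "w \<in> carrier W"
  shows "os_mult W (NO fa) (NO fb) e w =
    fields_coeff (fa @ fb) e \<odot> nord (fields_modes fa e) (nord (fields_modes fb e) w)"
proof -
  let ?X = "field_vars fa" and ?Y = "field_vars fb"
  let ?ea = "fs_restrict e ?X" and ?eb = "fs_restrict e ?Y"
  have da: "distinct (map (snd \<circ> snd) fa)" and db: "distinct (map (snd \<circ> snd) fb)"
    and XY: "?X \<inter> ?Y = {}"
    using d by (auto simp: field_vars_def)
  have vars: "field_vars (fa @ fb) = ?X \<union> ?Y" by (auto simp: field_vars_def)
  have set: "{(e1, e2). op_nonzero W (NO fa e1) \<and> op_nonzero W (NO fb e2) \<and> (\<forall>v. e1 v + e2 v = e v)} =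
     (if fs_supported (?X \<union> ?Y) e \<and> op_nonzero W (NO fa ?ea) \<and> op_nonzero W (NO fb ?eb)
      then {(?ea, ?eb)} else {})"
    by (rule disjoint_decomposition[OF NO_nonzero[OF da] NO_nonzero[OF db] XY])
  show ?thesis
  proof (cases "fs_supported (?X \<union> ?Y) e")
    case False
    with w show ?thesis
      unfolding os_mult_def set by (simp add: fields_coeff_def vars smult_0)
  next
    case True
    have "NO fa ?ea (NO fb ?eb w) = \<zero>" if "\<not> op_nonzero W (NO fa ?ea) \<or> \<not> op_nonzero W (NO fb ?eb)"
      using that w NO_closed[OF w, of fb ?eb] unfolding op_nonzero_def
      by (auto simp: NO_apply[OF da] nord_zero smult_zero)
    then have "os_mult W (NO fa) (NO fb) e w = NO fa ?ea (NO fb ?eb w)"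
      unfolding os_mult_def set using True w by (auto simp: NO_closed)
    also have "\<dots> = (fields_coeff fa ?ea * fields_coeff fb ?eb) \<odot>
        nord (fields_modes fa e) (nord (fields_modes fb e) w)"
      using w by (simp add: NO_apply[OF da] NO_apply[OF db] nord_smult smult_smult fields_modes_restrict)
    also have "fields_coeff fa ?ea * fields_coeff fb ?eb = fields_coeff (fa @ fb) e"
      using True by (simp add: fields_coeff_def vars fields_coeff_restrict)
    finally show ?thesis .
  qed
qed

lemma os_smult_NO:
  assumes d: "distinct (map (snd \<circ> snd) fs)" and w: "w \<in> carrier W"
    and f: "\<And>e. f e \<noteq> 0 \<Longrightarrow> fs_supported V e" and V: "V \<inter> field_vars fs = {}"
  shows "os_smult W f (NO fs) e w =
    (if fs_supported (V \<union> field_vars fs) e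
     then f (fs_restrict e V) * (\<Prod>(a, k, v)\<leftarrow>fs. field_coeff a k (e v)) else 0) \<odot> nord (fields_modes fs e) w"
proof -
  let ?X = "field_vars fs"
  let ?e1 = "fs_restrict e V" and ?e2 = "fs_restrict e ?X"
  have set: "{(e1, e2). f e1 \<noteq> 0 \<and> op_nonzero W (NO fs e2) \<and> (\<forall>v. e1 v + e2 v = e v)} =
     (if fs_supported (V \<union> ?X) e \<and> f ?e1 \<noteq> 0 \<and> op_nonzero W (NO fs ?e2)
      then {(?e1, ?e2)} else {})"
    by (rule disjoint_decomposition[OF f NO_nonzero[OF d] V])
  show ?thesis
  proof (cases "fs_supported (V \<union> ?X) e")
    case False
    with w show ?thesis
      unfolding os_smult_def set by (simp add: smult_0)
  next
    case True
    have "f ?e1 \<odot> NO fs ?e2 w = \<zero>" if "f ?e1 = 0 \<or> \<not> op_nonzero W (NO fs ?e2)"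
      using that w NO_closed[OF w, of fs ?e2] unfolding op_nonzero_def
      by (auto simp: smult_0 smult_zero)
    then have "os_smult W f (NO fs) e w = f ?e1 \<odot> NO fs ?e2 w"
      unfolding os_smult_def set using True w by (auto simp: NO_closed)
    also have "\<dots> = (f ?e1 * fields_coeff fs ?e2) \<odot> nord (fields_modes fs e) w"
      using w by (simp add: NO_apply[OF d] smult_smult fields_modes_restrict)
    finally show ?thesis
      using True by (simp add: fields_coeff_def fields_coeff_restrict)
  qed
qed

lemma os_smult_closed: "w \<in> carrier W \<Longrightarrow> os_smult W f (NO fs) e w \<in> carrier W"
  unfolding os_smult_def by (rule finsum_closed) (auto simp: NO_closed)

lemma functional_os_sum:
  assumes "functional \<phi>" "\<And>i. i \<in> I \<Longrightarrow> A i e w \<in> carrier W"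
  shows "\<phi> (os_sum W I A e w) = (\<Sum>i\<in>I. \<phi> (A i e w))"
  unfolding os_sum_def by (rule functional_finsum[OF assms])

lemma os_sum_closed: "(\<And>i. i \<in> I \<Longrightarrow> A i e w \<in> carrier W) \<Longrightarrow> os_sum W I A e w \<in> carrier W"
  unfolding os_sum_def by (rule finsum_closed) auto

context
  fixes a b :: "nat \<Rightarrow> 'h bf" and m n :: "nat \<Rightarrow> nat" and e :: expo
begin

abbreviation modeA :: "nat \<Rightarrow> 'h bf \<times> int" where
  "modeA i \<equiv> (a i, mode_index (a i) (m i - 1) (e (Xv i)))"
abbreviation modeB :: "nat \<Rightarrow> 'h bf \<times> int" where
  "modeB j \<equiv> (b j, mode_index (b j) (n j - 1) (e (Yv j)))"
abbreviation coeffA :: "nat \<Rightarrow> complex" where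
  "coeffA i \<equiv> field_coeff (a i) (m i - 1) (e (Xv i))"
abbreviation coeffB :: "nat \<Rightarrow> complex" where
  "coeffB j \<equiv> field_coeff (b j) (n j - 1) (e (Yv j))"

interpretation ix: indexed_contraction "\<lambda>p. is_fer (fst p)" mctr modeA modeB ..

lemma contraction_prod:
  assumes I: "length I = k" "sorted_wrt (<) I" and J: "length J = k" "sorted_wrt (<) J"
    and A: "\<And>i j e. i < k \<Longrightarrow> j < k \<Longrightarrow> A i j e =
      (if fs_supported {Xv (I ! i), Yv (J ! j)} e then
         field_coeff (a (I ! i)) (m (I ! i) - 1) (e (Xv (I ! i))) *
         field_coeff (b (J ! j)) (n (J ! j) - 1) (e (Yv (J ! j))) *
         mctr (a (I ! i), mode_index (a (I ! i)) (m (I ! i) - 1) (e (Xv (I ! i))))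
           (b (J ! j), mode_index (b (J ! j)) (n (J ! j) - 1) (e (Yv (J ! j)))) else 0)"
    and e': "\<And>i. i \<in> set I \<Longrightarrow> e' (Xv i) = e (Xv i)" "\<And>j. j \<in> set J \<Longrightarrow> e' (Yv j) = e (Yv j)"
    and \<sigma>: "\<sigma> permutes {..<k}"
  shows "fs_prod (map (\<lambda>i. A i (\<sigma> i)) [0..<k]) e' =
    (if fs_supported (Xv ` set I \<union> Yv ` set J) e' then (\<Prod>i\<in>set I. coeffA i) * (\<Prod>j\<in>set J. coeffB j) *
      (\<Prod>i<k. mctr (modeA (I ! i)) (modeB (J ! \<sigma> i))) else 0)"
proof -
  have dist: "distinct I" "distinct J" using I J by (auto simp: strict_sorted_iff)
  have bij: "bij_betw ((!) I) {..<k} (set I)" "bij_betw ((!) J) {..<k} (set J)"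
    using I J dist by (auto simp: bij_betw_nth)
  have im: "(\<lambda>i. Xv (I ! i)) ` {..<k} = Xv ` set I" "(\<lambda>j. Yv (J ! j)) ` {..<k} = Yv ` set J"
    using bij by (auto simp: bij_betw_def)
  have \<sigma>k: "\<sigma> i < k" if "i < k" for i using \<sigma> that permutes_in_image by fastforce
  let ?B = "\<lambda>i j p q. field_coeff (a (I ! i)) (m (I ! i) - 1) p * field_coeff (b (J ! j)) (n (J ! j) - 1) q *
         mctr (a (I ! i), mode_index (a (I ! i)) (m (I ! i) - 1) p)
           (b (J ! j), mode_index (b (J ! j)) (n (J ! j) - 1) q)"
  have "fs_prod (map (\<lambda>i. A i (\<sigma> i)) [0..<k]) e' =
    (if fs_supported ((\<lambda>i. Xv (I ! i)) ` {..<k} \<union> (\<lambda>j. Yv (J ! j)) ` {..<k}) e'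
     then \<Prod>i<k. ?B i (\<sigma> i) (e' (Xv (I ! i))) (e' (Yv (J ! \<sigma> i))) else 0)"
    by (rule fs_prod_pairs[OF _ _ _ A \<sigma>]) (use bij in \<open>auto simp: inj_on_def bij_betw_def\<close>)
  also have "(\<Prod>i<k. ?B i (\<sigma> i) (e' (Xv (I ! i))) (e' (Yv (J ! \<sigma> i)))) =
      (\<Prod>i<k. coeffA (I ! i) * coeffB (J ! \<sigma> i) * mctr (modeA (I ! i)) (modeB (J ! \<sigma> i)))"
    by (rule prod.cong) (use \<sigma>k I J in \<open>auto simp: e'\<close>)
  also have "\<dots> = (\<Prod>i<k. coeffA (I ! i)) * (\<Prod>i<k. coeffB (J ! \<sigma> i)) *
      (\<Prod>i<k. mctr (modeA (I ! i)) (modeB (J ! \<sigma> i)))"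
    by (simp add: prod.distrib)
  also have "(\<Prod>i<k. coeffB (J ! \<sigma> i)) = (\<Prod>i<k. coeffB (J ! i))"
    by (rule prod.reindex_bij_betw[OF permutes_imp_bij[OF \<sigma>]])
  also have "\<dots> = (\<Prod>j\<in>set J. coeffB j)"
    by (rule prod.reindex_bij_betw[OF bij(2)])
  also have "(\<Prod>i<k. coeffA (I ! i)) = (\<Prod>i\<in>set I. coeffA i)"
    by (rule prod.reindex_bij_betw[OF bij(1)])
  finally show ?thesis unfolding im .
qed

lemma fs_perm_coeff:
  assumes I: "I \<in> incr_tuples (idxB a r) k" and J: "J \<in> incr_tuples (idxB b s) k"
    and e': "\<And>i. i \<in> set I \<Longrightarrow> e' (Xv i) = e (Xv i)" "\<And>j. j \<in> set J \<Longrightarrow> e' (Yv j) = e (Yv j)"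
  shows "fs_perm k (\<lambda>i j. fs_scale (lB * bf_form form (a (I ! i)) (b (J ! j)))
      (F_series (m (I ! i)) (n (J ! j)) (Xv (I ! i)) (Yv (J ! j)))) e' =
    (if fs_supported (Xv ` set I \<union> Yv ` set J) e'
     then (\<Prod>i\<in>set I. coeffA i) * (\<Prod>j\<in>set J. coeffB j) * ix.row_perm I (set J) else 0)"
proof -
  have I': "length I = k" "sorted_wrt (<) I" "\<And>i. i < k \<Longrightarrow> \<not> is_fer (a (I ! i))"
    using I by (auto simp: incr_tuples_def idxB_def subset_iff)
  have J': "length J = k" "sorted_wrt (<) J" "\<And>i. i < k \<Longrightarrow> \<not> is_fer (b (J ! i))"
    using J by (auto simp: incr_tuples_def idxB_def subset_iff)
  note prod = contraction_prod[OF I'(1,2) J'(1,2) F_series_apply[OF var.distinct(1) I'(3) J'(3)] e']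
  show ?thesis
    unfolding fs_perm_def ix.row_perm_eq[OF I'(1) J'(1,2), symmetric]
    by (simp add: prod sum_distrib_left)
qed

lemma fs_det_coeff:
  assumes I: "I \<in> incr_tuples (idxF a r) k" and J: "J \<in> incr_tuples (idxF b s) k"
    and e': "\<And>i. i \<in> set I \<Longrightarrow> e' (Xv i) = e (Xv i)" "\<And>j. j \<in> set J \<Longrightarrow> e' (Yv j) = e (Yv j)"
  shows "fs_det k (\<lambda>i j. fs_scale (lF * bf_form form (a (I ! i)) (b (J ! j)))
      (G_series (m (I ! i)) (n (J ! j)) (Xv (I ! i)) (Yv (J ! j)))) e' =
    (if fs_supported (Xv ` set I \<union> Yv ` set J) e'
     then (\<Prod>i\<in>set I. coeffA i) * (\<Prod>j\<in>set J. coeffB j) * ix.row_det I (set J) else 0)"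
proof -
  have I': "length I = k" "sorted_wrt (<) I" "\<And>i. i < k \<Longrightarrow> is_fer (a (I ! i))"
    using I by (auto simp: incr_tuples_def idxF_def subset_iff)
  have J': "length J = k" "sorted_wrt (<) J" "\<And>i. i < k \<Longrightarrow> is_fer (b (J ! i))"
    using J by (auto simp: incr_tuples_def idxF_def subset_iff)
  note prod = contraction_prod[OF I'(1,2) J'(1,2) G_series_apply[OF var.distinct(1) I'(3) J'(3)] e']
  show ?thesis
    unfolding fs_det_def ix.row_det_eq[OF I'(1) J'(1,2), symmetric]
    by (simp add: prod sum_distrib_left mult.left_commute)
qed

abbreviation all_coeff :: "nat \<Rightarrow> nat \<Rightarrow> complex" where
  "all_coeff r s \<equiv> (if fs_supported (Xv ` {1..r} \<union> Yv ` {1..s}) e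
     then (\<Prod>i\<in>{1..r}. coeffA i) * (\<Prod>j\<in>{1..s}. coeffB j) else 0)"

lemma vars_field_list: "map (snd \<circ> snd) (field_list x c l r D) = map x (filter (\<lambda>i. i \<notin> D) [1..<Suc r])"
  by (simp add: field_list_def o_def)

lemma distinct_field_lists:
  "distinct (map (snd \<circ> snd) (field_list Xv a m r D @ field_list Yv b n s D'))"
  unfolding map_append vars_field_list by (auto simp: distinct_map inj_on_def simp del: upt_Suc)

lemma field_vars_lists:
  "field_vars (field_list Xv a m r D @ field_list Yv b n s D') = Xv ` ({1..r} - D) \<union> Yv ` ({1..s} - D')"
  unfolding field_vars_def map_append vars_field_list by auto

lemma prod_list_filter_set:
  fixes f :: "nat \<Rightarrow> complex"
  shows "(\<Prod>i\<leftarrow>filter P [1..<Suc r]. f i) = (\<Prod>i\<in>{i \<in> {1..r}. P i}. f i)"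
  by (subst prod.distinct_set_conv_list[symmetric]) (auto intro!: prod.cong)

lemma field_lists_coeff:
  "(\<Prod>(a, k, v)\<leftarrow>field_list Xv a m r D @ field_list Yv b n s D'. field_coeff a k (e v)) =
    (\<Prod>i\<in>{1..r} - D. coeffA i) * (\<Prod>j\<in>{1..s} - D'. coeffB j)"
  unfolding field_list_def map_append prod_list.append map_map o_def case_prod_conv prod_list_filter_set
  by (intro arg_cong2[of _ _ _ _ "(*)"] prod.cong) auto

lemma field_lists_modes:
  "fields_modes (field_list Xv a m r D @ field_list Yv b n s D') e =
    map modeA (filter (\<lambda>i. i \<notin> D) [1..<Suc r]) @ map modeB (filter (\<lambda>j. j \<notin> D') [1..<Suc s])"
  by (simp add: fields_modes_def field_list_def del: upt_Suc)

lemma os_mult_field_lists: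
  assumes \<phi>: "functional \<phi>" and w: "w \<in> carrier W"
  shows "\<phi> (os_mult W (NO (field_list Xv a m r {})) (NO (field_list Yv b n s {})) e w) =
    all_coeff r s * (\<Sum>I\<in>Pow {1..r}. \<Sum>J\<in>Pow {1..s}. ix.wick_weight {1..r} {1..s} I J *
      \<phi> (nord (map modeA (filter (\<lambda>i. i \<notin> I) [1..<Suc r]) @ map modeB (filter (\<lambda>j. j \<notin> J) [1..<Suc s])) w))"
proof -
  have s: "sorted_wrt (<) [1..<Suc l]" for l :: nat
    by (simp only: strict_sorted_iff sorted_upt distinct_upt simp_thms)
  have "\<phi> (os_mult W (NO (field_list Xv a m r {})) (NO (field_list Yv b n s {})) e w) =
      fields_coeff (field_list Xv a m r {} @ field_list Yv b n s {}) e *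
      \<phi> (nord (fields_modes (field_list Xv a m r {}) e) (nord (fields_modes (field_list Yv b n s {}) e) w))"
    using w by (simp only: os_mult_NO[OF distinct_field_lists w] functional_smult[OF \<phi>] nord_closed)
  also have "fields_coeff (field_list Xv a m r {} @ field_list Yv b n s {}) e = all_coeff r s"
    unfolding fields_coeff_def field_vars_lists field_lists_coeff by simp
  also have "fields_modes (field_list Xv a m r {}) e = map modeA [1..<Suc r]"
    by (simp add: fields_modes_def field_list_def del: upt_Suc)
  also have "fields_modes (field_list Yv b n s {}) e = map modeB [1..<Suc s]"
    by (simp add: fields_modes_def field_list_def del: upt_Suc)
  also have "\<phi> (nord (map modeA [1..<Suc r]) (nord (map modeB [1..<Suc s]) w)) =
      wick (map modeA [1..<Suc r]) (\<lambda>l. \<phi> (nord l w)) (map modeB [1..<Suc s])"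
    by (rule nord_mult[OF \<phi> w])
  finally show ?thesis
    unfolding ix.wick_explicit[OF s s] set_upt atLeastLessThanSuc_atLeastAtMost .
qed

lemma num_fer_ferA: "i \<le> r \<Longrightarrow> num_fer a i = card {k \<in> ix.ferA {1..r}. k \<le> i}"
  unfolding num_fer_def ix.ferA_def by (rule arg_cong[of _ _ card]) auto

lemma num_fer_ferB: "j \<le> s \<Longrightarrow> num_fer b j = card {k \<in> ix.ferB {1..s}. k \<le> j}"
  unfolding num_fer_def ix.ferB_def by (rule arg_cong[of _ _ card]) auto

lemma wick_sign:
  assumes I: "I \<in> incr_tuples (idxF a r) k" and J: "J \<in> incr_tuples (idxF b s) k"
  shows "(- 1) ^ (sum_list (map (num_fer a) I) + sum_list (map (num_fer b) J)) *
      (- 1) ^ (num_fer a r * k + k * (k + 1) div 2) =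
    ((- 1) ^ ix.wick_exponent {1..r} {1..s} (set I) (set J) :: complex)"
proof -
  have dist: "distinct I" "distinct J" and len: "length I = k"
    and sub: "set I \<subseteq> {1..r}" "set J \<subseteq> {1..s}"
    using I J by (auto simp: incr_tuples_def strict_sorted_iff idxF_def)
  have "sum_list (map (num_fer a) I) = (\<Sum>i\<in>set I. card {k \<in> ix.ferA {1..r}. k \<le> i})"
    unfolding sum_list_distinct_conv_sum_set[OF dist(1)]
    by (rule sum.cong[OF refl]) (use sub num_fer_ferA in auto)
  moreover have "sum_list (map (num_fer b) J) = (\<Sum>j\<in>set J. card {k \<in> ix.ferB {1..s}. k \<le> j})"
    unfolding sum_list_distinct_conv_sum_set[OF dist(2)]
    by (rule sum.cong[OF refl]) (use sub num_fer_ferB in auto)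
  moreover have "num_fer a r = card (ix.ferA {1..r})"
    unfolding num_fer_def ix.ferA_def by simp
  moreover have "card (set I) = k" using dist len by (simp add: distinct_card)
  ultimately show ?thesis
    unfolding ix.wick_exponent_def by (simp add: power_add mult.assoc)
qed

end

lemma fs_perm_supported:
  assumes "I \<in> incr_tuples (idxB a r) k" "J \<in> incr_tuples (idxB b s) k"
    "fs_perm k (\<lambda>i j. fs_scale (lB * bf_form form (a (I ! i)) (b (J ! j)))
      (F_series (m (I ! i)) (n (J ! j)) (Xv (I ! i)) (Yv (J ! j)))) e \<noteq> 0"
  shows "fs_supported (Xv ` set I \<union> Yv ` set J) e"
  using fs_perm_coeff[where e = e and e' = e, OF assms(1,2) refl refl] assms(3) by (metis (no_types, lifting))

lemma fs_det_supported:
  assumes "I \<in> incr_tuples (idxF a r) k" "J \<in> incr_tuples (idxF b s) k"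
    "fs_det k (\<lambda>i j. fs_scale (lF * bf_form form (a (I ! i)) (b (J ! j)))
      (G_series (m (I ! i)) (n (J ! j)) (Xv (I ! i)) (Yv (J ! j)))) e \<noteq> 0"
  shows "fs_supported (Xv ` set I \<union> Yv ` set J) e"
  using fs_det_coeff[where e = e and e' = e, OF assms(1,2) refl refl] assms(3) by (metis (no_types, lifting))

lemma prod_split:
  fixes f :: "nat \<Rightarrow> complex"
  assumes "finite T" "X \<subseteq> T" "Y \<subseteq> T" "X \<inter> Y = {}"
  shows "prod f T = prod f X * prod f Y * prod f (T - (X \<union> Y))"
proof -
  have f: "finite X" "finite Y" using assms(2,3) finite_subset[OF _ assms(1)] by auto
  have "prod f T = prod f (X \<union> Y) * prod f (T - (X \<union> Y))"
    using assms f prod.subset_diff[of "X \<union> Y" T f] by (simp add: mult.commute)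
  then show ?thesis using f assms(4) by (simp add: prod.union_disjoint)
qed

context
  fixes a b :: "nat \<Rightarrow> 'h bf" and m n :: "nat \<Rightarrow> nat" and e :: expo and r s :: nat
    and \<phi> :: "'w \<Rightarrow> complex" and w :: 'w
  assumes \<phi>: "functional \<phi>" and w: "w \<in> carrier W"
begin

interpretation ix: indexed_contraction "\<lambda>p. is_fer (fst p)" mctr "modeA a m e" "modeB b n e" ..

abbreviation wick_term :: "nat set \<Rightarrow> nat set \<Rightarrow> nat set \<Rightarrow> nat set \<Rightarrow> complex" where
  "wick_term Ib Jb Ia Ja \<equiv>
     (-1) ^ ix.wick_exponent {1..r} {1..s} Ia Ja * ix.row_perm (sorted_list_of_set Ib) Jb *
     ix.row_det (sorted_list_of_set Ia) Ja *
     \<phi> (nord (map (modeA a m e) (filter (\<lambda>i. i \<notin> Ib \<union> Ia) [1..<Suc r]) @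
        map (modeB b n e) (filter (\<lambda>j. j \<notin> Jb \<union> Ja) [1..<Suc s])) w)"

lemma summand_coeff:
  assumes Ib: "Ib \<in> incr_tuples (idxB a r) \<eta>" and Jb: "Jb \<in> incr_tuples (idxB b s) \<eta>"
    and Ia: "Ia \<in> incr_tuples (idxF a r) \<rho>" and Ja: "Ja \<in> incr_tuples (idxF b s) \<rho>"
  shows "\<phi> (os_smult W
           (fs_scale
             ((- 1) ^ (sum_list (map (num_fer a) Ia) + sum_list (map (num_fer b) Ja))
               * (- 1) ^ (num_fer a r * \<rho> + \<rho> * (\<rho> + 1) div 2))
             (fs_mult
               (fs_perm \<eta> (\<lambda>\<alpha> \<beta>. fs_scale (lB * bf_form form (a (Ib ! \<alpha>)) (b (Jb ! \<beta>)))
                  (F_series (m (Ib ! \<alpha>)) (n (Jb ! \<beta>)) (Xv (Ib ! \<alpha>)) (Yv (Jb ! \<beta>)))))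
               (fs_det \<rho> (\<lambda>\<gamma> \<delta>. fs_scale (lF * bf_form form (a (Ia ! \<gamma>)) (b (Ja ! \<delta>)))
                  (G_series (m (Ia ! \<gamma>)) (n (Ja ! \<delta>)) (Xv (Ia ! \<gamma>)) (Yv (Ja ! \<delta>)))))))
           (NO (field_list Xv a m r (set Ib \<union> set Ia) @ field_list Yv b n s (set Jb \<union> set Ja))) e w) =
    all_coeff a b m n e r s * wick_term (set Ib) (set Jb) (set Ia) (set Ja)"
    (is "\<phi> (os_smult W (fs_scale ?sg (fs_mult ?P ?D)) (NO ?fs) e w) = _")
proof -
  let ?Vb = "Xv ` set Ib \<union> Yv ` set Jb" and ?Va = "Xv ` set Ia \<union> Yv ` set Ja"
  let ?V = "?Vb \<union> ?Va"
  have sub: "set Ib \<subseteq> {1..r}" "set Ia \<subseteq> {1..r}" "set Ib \<inter> set Ia = {}"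
    "set Jb \<subseteq> {1..s}" "set Ja \<subseteq> {1..s}" "set Jb \<inter> set Ja = {}"
    using Ib Jb Ia Ja by (auto simp: incr_tuples_def idxB_def idxF_def subset_iff)
  have sl: "sorted_list_of_set (set Ib) = Ib" "sorted_list_of_set (set Ia) = Ia"
    using Ib Ia by (auto simp: incr_tuples_def strict_sorted_iff sorted_list_of_set.idem_if_sorted_distinct)
  have P: "fs_supported ?Vb e" if "?P e \<noteq> 0" for e
    by (rule fs_perm_supported[OF Ib Jb that])
  have D: "fs_supported ?Va e" if "?D e \<noteq> 0" for e
    by (rule fs_det_supported[OF Ia Ja that])
  have disj: "?Vb \<inter> ?Va = {}" using sub by auto
  note mult = fs_mult_disjoint[OF P D disj]
  let ?f = "fs_scale ?sg (fs_mult ?P ?D)"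
  have f: "fs_supported ?V e" if "?f e \<noteq> 0" for e
    using that by (auto simp: fs_scale_def mult split: if_splits)
  have fv: "field_vars ?fs = Xv ` ({1..r} - (set Ib \<union> set Ia)) \<union> Yv ` ({1..s} - (set Jb \<union> set Ja))"
    by (rule field_vars_lists)
  have V: "?V \<inter> field_vars ?fs = {}" unfolding fv by auto
  have vars: "?V \<union> field_vars ?fs = Xv ` {1..r} \<union> Yv ` {1..s}"
    unfolding fv using sub by auto
  have eq: "os_smult W ?f (NO ?fs) e w =
    (if fs_supported (?V \<union> field_vars ?fs) e then ?f (fs_restrict e ?V) *
       (\<Prod>(a, k, v)\<leftarrow>?fs. field_coeff a k (e v)) else 0) \<odot> nord (fields_modes ?fs e) w"
    by (rule os_smult_NO[OF distinct_field_lists w f V])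
  have "\<phi> (os_smult W ?f (NO ?fs) e w) =
    (if fs_supported (?V \<union> field_vars ?fs) e then ?f (fs_restrict e ?V) *
       (\<Prod>(a, k, v)\<leftarrow>?fs. field_coeff a k (e v)) else 0) * \<phi> (nord (fields_modes ?fs e) w)"
    unfolding eq by (rule functional_smult[OF \<phi> nord_closed[OF w]])
  also have "?f (fs_restrict e ?V) = (-1) ^ ix.wick_exponent {1..r} {1..s} (set Ia) (set Ja) *
     (((\<Prod>i\<in>set Ib. coeffA a m e i) * (\<Prod>j\<in>set Jb. coeffB b n e j) * ix.row_perm Ib (set Jb)) *
      ((\<Prod>i\<in>set Ia. coeffA a m e i) * (\<Prod>j\<in>set Ja. coeffB b n e j) * ix.row_det Ia (set Ja)))"
  proof -
    let ?e1 = "fs_restrict (fs_restrict e ?V) ?Vb" and ?e2 = "fs_restrict (fs_restrict e ?V) ?Va"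
    have "?P ?e1 = (\<Prod>i\<in>set Ib. coeffA a m e i) * (\<Prod>j\<in>set Jb. coeffB b n e j) * ix.row_perm Ib (set Jb)"
      by (subst fs_perm_coeff[OF Ib Jb, where e = e]) auto
    moreover have "?D ?e2 = (\<Prod>i\<in>set Ia. coeffA a m e i) * (\<Prod>j\<in>set Ja. coeffB b n e j) * ix.row_det Ia (set Ja)"
      by (subst fs_det_coeff[OF Ia Ja, where e = e]) auto
    ultimately have "?f (fs_restrict e ?V) = ?sg *
       (((\<Prod>i\<in>set Ib. coeffA a m e i) * (\<Prod>j\<in>set Jb. coeffB b n e j) * ix.row_perm Ib (set Jb)) *
        ((\<Prod>i\<in>set Ia. coeffA a m e i) * (\<Prod>j\<in>set Ja. coeffB b n e j) * ix.row_det Ia (set Ja)))"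
      by (simp add: fs_scale_def mult)
    from trans[OF this arg_cong2[where f = "(*)", OF wick_sign[OF Ia Ja] refl]]
    show ?thesis .
  qed
  also have "(\<Prod>(a, k, v)\<leftarrow>?fs. field_coeff a k (e v)) =
      (\<Prod>i\<in>{1..r} - (set Ib \<union> set Ia). coeffA a m e i) * (\<Prod>j\<in>{1..s} - (set Jb \<union> set Ja). coeffB b n e j)"
    by (rule field_lists_coeff)
  finally show ?thesis
    unfolding vars field_lists_modes sl
      prod_split[OF finite_atLeastAtMost sub(1-3)] prod_split[OF finite_atLeastAtMost sub(4-6)]
    by (cases "fs_supported (Xv ` {1..r} \<union> Yv ` {1..s}) e")
      (simp_all only: if_True if_False mult_zero_left mult_ac)
qed

lemma sum_wick_term:
  "(\<Sum>\<rho>\<in>{0..min r s}. \<Sum>\<eta>\<in>{0..min r s}.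
      \<Sum>(Ib, Jb)\<in>incr_tuples (idxB a r) \<eta> \<times> incr_tuples (idxB b s) \<eta>.
      \<Sum>(Ia, Ja)\<in>incr_tuples (idxF a r) \<rho> \<times> incr_tuples (idxF b s) \<rho>.
        wick_term (set Ib) (set Jb) (set Ia) (set Ja)) =
    (\<Sum>I\<in>Pow {1..r}. \<Sum>J\<in>Pow {1..s}. ix.wick_weight {1..r} {1..s} I J *
      \<phi> (nord (map (modeA a m e) (filter (\<lambda>i. i \<notin> I) [1..<Suc r]) @
        map (modeB b n e) (filter (\<lambda>j. j \<notin> J) [1..<Suc s])) w))"
proof -
  have fin: "finite (idxB a r)" "finite (idxF a r)" "finite (idxB b s)" "finite (idxF b s)"
    by (auto simp: idxB_def idxF_def)
  have card: "card (idxB a r) \<le> r" "card (idxF a r) \<le> r" "card (idxB b s) \<le> s" "card (idxF b s) \<le> s"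
  proof -
    have le: "card X \<le> l" if "X \<subseteq> {1..l}" for X l
      using card_mono[OF finite_atLeastAtMost that] by simp
    have sub: "idxB c l \<subseteq> {1..l}" "idxF c l \<subseteq> {1..l}" for c :: "nat \<Rightarrow> 'h bf" and l
      by (auto simp: idxB_def idxF_def)
    show "card (idxB a r) \<le> r" "card (idxF a r) \<le> r" "card (idxB b s) \<le> s" "card (idxF b s) \<le> s"
      by (rule le[OF sub(1)] le[OF sub(2)])+
  qed
  have "(\<Sum>\<rho>\<in>{0..min r s}. \<Sum>\<eta>\<in>{0..min r s}.
      \<Sum>(Ib, Jb)\<in>incr_tuples (idxB a r) \<eta> \<times> incr_tuples (idxB b s) \<eta>.
      \<Sum>(Ia, Ja)\<in>incr_tuples (idxF a r) \<rho> \<times> incr_tuples (idxF b s) \<rho>.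
        wick_term (set Ib) (set Jb) (set Ia) (set Ja)) =
    (\<Sum>\<eta>\<in>{0..min r s}. \<Sum>(Ib, Jb)\<in>incr_tuples (idxB a r) \<eta> \<times> incr_tuples (idxB b s) \<eta>.
      \<Sum>\<rho>\<in>{0..min r s}. \<Sum>(Ia, Ja)\<in>incr_tuples (idxF a r) \<rho> \<times> incr_tuples (idxF b s) \<rho>.
        wick_term (set Ib) (set Jb) (set Ia) (set Ja))"
    unfolding case_prod_beta by (subst sum.swap, rule sum.cong[OF refl], rule sum.swap)
  also have "\<dots> = (\<Sum>\<eta>\<in>{0..min r s}. \<Sum>(Ib, Jb)\<in>incr_tuples (idxB a r) \<eta> \<times> incr_tuples (idxB b s) \<eta>.
      (\<lambda>B C. \<Sum>F\<in>Pow (idxF a r). \<Sum>G\<in>Pow (idxF b s). wick_term B C F G) (set Ib) (set Jb))"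
  proof (intro sum.cong[OF refl], clarify)
    fix Ib Jb :: "nat list"
    show "(\<Sum>\<rho>\<in>{0..min r s}. \<Sum>(Ia, Ja)\<in>incr_tuples (idxF a r) \<rho> \<times> incr_tuples (idxF b s) \<rho>.
        wick_term (set Ib) (set Jb) (set Ia) (set Ja)) =
      (\<Sum>F\<in>Pow (idxF a r). \<Sum>G\<in>Pow (idxF b s). wick_term (set Ib) (set Jb) F G)"
    proof (rule sum_incr_tuples[OF fin(2,4)])
      fix F G assume "F \<subseteq> idxF a r" "G \<subseteq> idxF b s" "card F \<noteq> card G"
      then have "ix.row_det (sorted_list_of_set F) G = 0"
        using ix.row_det_card[of G "sorted_list_of_set F"] finite_subset[OF _ fin(2)] finite_subset[OF _ fin(4)]
        by auto
      then show "wick_term (set Ib) (set Jb) F G = 0" by simp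
    qed (use card in auto)
  qed
  also have "\<dots> = (\<Sum>B\<in>Pow (idxB a r). \<Sum>C\<in>Pow (idxB b s).
      \<Sum>F\<in>Pow (idxF a r). \<Sum>G\<in>Pow (idxF b s). wick_term B C F G)"
  proof (rule sum_incr_tuples[OF fin(1,3)])
    fix B C assume "B \<subseteq> idxB a r" "C \<subseteq> idxB b s" "card B \<noteq> card C"
    then have "ix.row_perm (sorted_list_of_set B) C = 0"
      using ix.row_perm_card[of C "sorted_list_of_set B"] finite_subset[OF _ fin(1)] finite_subset[OF _ fin(3)]
      by auto
    then show "(\<Sum>F\<in>Pow (idxF a r). \<Sum>G\<in>Pow (idxF b s). wick_term B C F G) = 0" by simp
  qed (use card in auto)
  also have "\<dots> = (\<Sum>B\<in>Pow (idxB a r). \<Sum>F\<in>Pow (idxF a r). \<Sum>C\<in>Pow (idxB b s).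
      \<Sum>G\<in>Pow (idxF b s). wick_term B C F G)"
    by (rule sum.cong[OF refl], rule sum.swap)
  also have "\<dots> = (\<Sum>B\<in>Pow (idxB a r). \<Sum>F\<in>Pow (idxF a r). \<Sum>J\<in>Pow {1..s}.
      wick_term B {j \<in> J. \<not> is_fer (b j)} F {j \<in> J. is_fer (b j)})"
    unfolding idxB_def[of b] idxF_def[of b]
    by (intro sum.cong[OF refl] sum_Pow_filter[symmetric]) simp
  also have "\<dots> = (\<Sum>I\<in>Pow {1..r}. \<Sum>J\<in>Pow {1..s}.
      wick_term {i \<in> I. \<not> is_fer (a i)} {j \<in> J. \<not> is_fer (b j)} {i \<in> I. is_fer (a i)} {j \<in> J. is_fer (b j)})"
    unfolding idxB_def[of a] idxF_def[of a]
    by (rule sum_Pow_filter[symmetric]) simp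
  also have "\<dots> = (\<Sum>I\<in>Pow {1..r}. \<Sum>J\<in>Pow {1..s}. ix.wick_weight {1..r} {1..s} I J *
      \<phi> (nord (map (modeA a m e) (filter (\<lambda>i. i \<notin> I) [1..<Suc r]) @
        map (modeB b n e) (filter (\<lambda>j. j \<notin> J) [1..<Suc s])) w))"
  proof (intro sum.cong[OF refl])
    fix I J :: "nat set"
    have "{i \<in> I. \<not> is_fer (a i)} \<union> {i \<in> I. is_fer (a i)} = I"
      "{j \<in> J. \<not> is_fer (b j)} \<union> {j \<in> J. is_fer (b j)} = J" by auto
    then show "wick_term {i \<in> I. \<not> is_fer (a i)} {j \<in> J. \<not> is_fer (b j)} {i \<in> I. is_fer (a i)} {j \<in> J. is_fer (b j)} =
      ix.wick_weight {1..r} {1..s} I J *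
      \<phi> (nord (map (modeA a m e) (filter (\<lambda>i. i \<notin> I) [1..<Suc r]) @
        map (modeB b n e) (filter (\<lambda>j. j \<notin> J) [1..<Suc s])) w)"
      unfolding ix.wick_weight_def ix.bosA_def ix.ferA_def ix.bosB_def ix.ferB_def by simp
  qed
  finally show ?thesis .
qed

end

lemma no_fields_mult:
  "os_eq W
    (os_mult W (NO (field_list Xv a m r {})) (NO (field_list Yv b n s {})))
    (os_sum W {0..min r s} (\<lambda>\<rho>. os_sum W {0..min r s} (\<lambda>\<eta>.
       os_sum W (incr_tuples (idxB a r) \<eta> \<times> incr_tuples (idxB b s) \<eta>) (\<lambda>(I_b, J_b).
       os_sum W (incr_tuples (idxF a r) \<rho> \<times> incr_tuples (idxF b s) \<rho>) (\<lambda>(I_f, J_f).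
         os_smult W
           (fs_scale
             ((- 1) ^ (sum_list (map (num_fer a) I_f) + sum_list (map (num_fer b) J_f))
               * (- 1) ^ (num_fer a r * \<rho> + \<rho> * (\<rho> + 1) div 2))
             (fs_mult
               (fs_perm \<eta> (\<lambda>\<alpha> \<beta>. fs_scale (lB * bf_form form (a (I_b ! \<alpha>)) (b (J_b ! \<beta>)))
                  (F_series (m (I_b ! \<alpha>)) (n (J_b ! \<beta>)) (Xv (I_b ! \<alpha>)) (Yv (J_b ! \<beta>)))))
               (fs_det \<rho> (\<lambda>\<gamma> \<delta>. fs_scale (lF * bf_form form (a (I_f ! \<gamma>)) (b (J_f ! \<delta>)))
                  (G_series (m (I_f ! \<gamma>)) (n (J_f ! \<delta>)) (Xv (I_f ! \<gamma>)) (Yv (J_f ! \<delta>)))))))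
           (NO (field_list Xv a m r (set I_b \<union> set I_f) @ field_list Yv b n s (set J_b \<union> set J_f))))))))"
    (is "os_eq W ?lhs (os_sum W ?K (\<lambda>\<rho>. os_sum W ?K (\<lambda>\<eta>. os_sum W (?XB \<eta>) (\<lambda>(I_b, J_b).
       os_sum W (?XF \<rho>) (\<lambda>(I_f, J_f). os_smult W (?f \<rho> \<eta> I_b J_b I_f J_f) (NO (?fs I_b J_b I_f J_f)))))))")
  unfolding os_eq_def
proof (intro allI ballI)
  fix e w assume w: "w \<in> carrier W"
  let ?T = "\<lambda>\<rho> \<eta> I_b J_b I_f J_f. os_smult W (?f \<rho> \<eta> I_b J_b I_f J_f) (NO (?fs I_b J_b I_f J_f))"
  let ?S1 = "\<lambda>\<rho> \<eta> I_b J_b. os_sum W (?XF \<rho>) (\<lambda>(I_f, J_f). ?T \<rho> \<eta> I_b J_b I_f J_f)"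
  let ?S2 = "\<lambda>\<rho> \<eta>. os_sum W (?XB \<eta>) (\<lambda>(I_b, J_b). ?S1 \<rho> \<eta> I_b J_b)"
  let ?S3 = "\<lambda>\<rho>. os_sum W ?K (\<lambda>\<eta>. ?S2 \<rho> \<eta>)"
  let ?rhs = "os_sum W ?K (\<lambda>\<rho>. ?S3 \<rho>)"
  have T: "?T \<rho> \<eta> I_b J_b I_f J_f e w \<in> carrier W" for \<rho> \<eta> I_b J_b I_f J_f
    by (rule os_smult_closed[OF w])
  have S1: "?S1 \<rho> \<eta> I_b J_b e w \<in> carrier W" for \<rho> \<eta> I_b J_b
    by (rule os_sum_closed) (use T in \<open>simp add: case_prod_beta\<close>)
  have S2: "?S2 \<rho> \<eta> e w \<in> carrier W" for \<rho> \<eta>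
    by (rule os_sum_closed) (use S1 in \<open>simp add: case_prod_beta\<close>)
  have S3: "?S3 \<rho> e w \<in> carrier W" for \<rho>
    by (rule os_sum_closed) (rule S2)
  have lhs: "?lhs e w \<in> carrier W"
    unfolding os_mult_NO[OF distinct_field_lists w] using w by simp
  have rhs: "?rhs e w \<in> carrier W"
    by (rule os_sum_closed) (rule S3)
  show "?lhs e w = ?rhs e w"
  proof (rule functional_separates[OF lhs rhs])
    fix \<phi> assume \<phi>: "functional \<phi>"
    let ?c = "all_coeff a b m n e r s"
    let ?t = "wick_term a b m n e r s \<phi> w"
    have t: "\<phi> (?T \<rho> \<eta> I_b J_b I_f J_f e w) = ?c * ?t (set I_b) (set J_b) (set I_f) (set J_f)"
      if "(I_b, J_b) \<in> ?XB \<eta>" "(I_f, J_f) \<in> ?XF \<rho>" for \<rho> \<eta> I_b J_b I_f J_f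
      using that by (intro summand_coeff[OF \<phi> w]) auto
    have s1: "\<phi> (?S1 \<rho> \<eta> I_b J_b e w) =
        (\<Sum>(I_f, J_f)\<in>?XF \<rho>. ?c * ?t (set I_b) (set J_b) (set I_f) (set J_f))"
      if "(I_b, J_b) \<in> ?XB \<eta>" for \<rho> \<eta> I_b J_b
    proof -
      have "\<phi> (?S1 \<rho> \<eta> I_b J_b e w) = (\<Sum>p\<in>?XF \<rho>. \<phi> ((case p of (I_f, J_f) \<Rightarrow> ?T \<rho> \<eta> I_b J_b I_f J_f) e w))"
        by (rule functional_os_sum[OF \<phi>]) (use T in \<open>simp add: case_prod_beta\<close>)
      also have "\<dots> = (\<Sum>(I_f, J_f)\<in>?XF \<rho>. ?c * ?t (set I_b) (set J_b) (set I_f) (set J_f))"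
      proof (rule sum.cong[OF refl])
        fix p assume "p \<in> ?XF \<rho>"
        then obtain I_f J_f where p: "p = (I_f, J_f)" "(I_f, J_f) \<in> ?XF \<rho>" by (cases p) simp
        show "\<phi> ((case p of (I_f, J_f) \<Rightarrow> ?T \<rho> \<eta> I_b J_b I_f J_f) e w) =
            (case p of (I_f, J_f) \<Rightarrow> ?c * ?t (set I_b) (set J_b) (set I_f) (set J_f))"
          unfolding p(1) prod.case by (rule t[OF that p(2)])
      qed
      finally show ?thesis .
    qed
    have s2: "\<phi> (?S2 \<rho> \<eta> e w) = (\<Sum>(I_b, J_b)\<in>?XB \<eta>. \<Sum>(I_f, J_f)\<in>?XF \<rho>.
        ?c * ?t (set I_b) (set J_b) (set I_f) (set J_f))" for \<rho> \<eta>
    proof -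
      have "\<phi> (?S2 \<rho> \<eta> e w) = (\<Sum>p\<in>?XB \<eta>. \<phi> ((case p of (I_b, J_b) \<Rightarrow> ?S1 \<rho> \<eta> I_b J_b) e w))"
        by (rule functional_os_sum[OF \<phi>]) (use S1 in \<open>simp add: case_prod_beta\<close>)
      also have "\<dots> = (\<Sum>(I_b, J_b)\<in>?XB \<eta>. \<Sum>(I_f, J_f)\<in>?XF \<rho>.
          ?c * ?t (set I_b) (set J_b) (set I_f) (set J_f))"
      proof (rule sum.cong[OF refl])
        fix p assume "p \<in> ?XB \<eta>"
        then obtain I_b J_b where p: "p = (I_b, J_b)" "(I_b, J_b) \<in> ?XB \<eta>" by (cases p) simp
        show "\<phi> ((case p of (I_b, J_b) \<Rightarrow> ?S1 \<rho> \<eta> I_b J_b) e w) =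
            (case p of (I_b, J_b) \<Rightarrow> \<Sum>(I_f, J_f)\<in>?XF \<rho>. ?c * ?t (set I_b) (set J_b) (set I_f) (set J_f))"
          unfolding p(1) prod.case by (rule s1[OF p(2)])
      qed
      finally show ?thesis .
    qed
    have "\<phi> (?rhs e w) = (\<Sum>\<rho>\<in>?K. \<Sum>\<eta>\<in>?K. \<phi> (?S2 \<rho> \<eta> e w))"
      by (simp only: functional_os_sum[OF \<phi>] S3 S2)
    also have "\<dots> = ?c * (\<Sum>\<rho>\<in>?K. \<Sum>\<eta>\<in>?K. \<Sum>(I_b, J_b)\<in>?XB \<eta>. \<Sum>(I_f, J_f)\<in>?XF \<rho>.
        ?t (set I_b) (set J_b) (set I_f) (set J_f))"
      unfolding s2 unfolding case_prod_unfold sum_distrib_left ..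
    also have "\<dots> = \<phi> (?lhs e w)"
      unfolding sum_wick_term[OF \<phi> w] by (rule os_mult_field_lists[OF \<phi> w, symmetric])
    finally show "\<phi> (?lhs e w) = \<phi> (?rhs e w)" ..
  qed
qed

end

theorem theorem7p5:
  fixes sc :: "complex \<Rightarrow> 'h::ab_group_add \<Rightarrow> 'h"
    and basis :: "'h set"
    and form :: "'h \<Rightarrow> 'h \<Rightarrow> complex"
    and scM :: "complex \<Rightarrow> 'm::ab_group_add \<Rightarrow> 'm"
    and actT :: "('h \<times> 'h) free_alg set \<Rightarrow> 'm \<Rightarrow> 'm"
    and gr :: "complex \<Rightarrow> 'm set"
    and act0 :: "'h Ntw \<Rightarrow> 'm \<Rightarrow> 'm"
    and lB lF :: complex
    and r s :: nat
    and a b :: "nat \<Rightarrow> 'h bf"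
    and m n :: "nat \<Rightarrow> nat"
  defines "W \<equiv> Wtw sc form act0"
  defines "NO \<equiv> no_fields W (W_mode sc form act0) form lF"
  assumes "finite_dimensional_vector_space sc basis"
    and "nondegenerate_symmetric_form sc form"
    and "left_module (tensor_alg (dsum_scale sc)) (tensor_const (dsum_scale sc)) scM actT"
    and "lower_bounded_grading scM gr"
    and "\<And>t z u. t \<in> carrier (tensor_alg (dsum_scale sc)) \<Longrightarrow> u \<in> gr z \<Longrightarrow> actT t u \<in> gr z"
    and "induced_ge0_action sc form lB lF scM actT act0"
    and "1 \<le> r" and "1 \<le> s"
    and "\<And>i. i \<in> {1..r} \<Longrightarrow> 1 \<le> m i" and "\<And>j. j \<in> {1..s} \<Longrightarrow> 1 \<le> n j"
  shows "os_eq W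
    (os_mult W (NO (field_list Xv a m r {})) (NO (field_list Yv b n s {})))
    (os_sum W {0..min r s} (\<lambda>\<rho>. os_sum W {0..min r s} (\<lambda>\<eta>.
       os_sum W (incr_tuples (idxB a r) \<eta> \<times> incr_tuples (idxB b s) \<eta>) (\<lambda>(I_b, J_b).
       os_sum W (incr_tuples (idxF a r) \<rho> \<times> incr_tuples (idxF b s) \<rho>) (\<lambda>(I_f, J_f).
         os_smult W
           (fs_scale
             ((- 1) ^ (sum_list (map (num_fer a) I_f) + sum_list (map (num_fer b) J_f))
               * (- 1) ^ (num_fer a r * \<rho> + \<rho> * (\<rho> + 1) div 2))
             (fs_mult
               (fs_perm \<eta> (\<lambda>\<alpha> \<beta>. fs_scale (lB * bf_form form (a (I_b ! \<alpha>)) (b (J_b ! \<beta>)))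
                  (F_series (m (I_b ! \<alpha>)) (n (J_b ! \<beta>)) (Xv (I_b ! \<alpha>)) (Yv (J_b ! \<beta>)))))
               (fs_det \<rho> (\<lambda>\<gamma> \<delta>. fs_scale (lF * bf_form form (a (I_f ! \<gamma>)) (b (J_f ! \<delta>)))
                  (G_series (m (I_f ! \<gamma>)) (n (J_f ! \<delta>)) (Xv (I_f ! \<gamma>)) (Yv (J_f ! \<delta>)))))))
           (NO (field_list Xv a m r (set I_b \<union> set I_f) @ field_list Yv b n s (set J_b \<union> set J_f))))))))"
proof -
  interpret twisted_module sc form lB lF scM actT act0
    by (rule twisted_module.intro) fact
  show ?thesis
    unfolding NO_def W_def by (rule no_fields_mult)
qed

end
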